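(* Let $(V,\omega)$ be a real symplectic vector space with a linear symplectic action of a finite group $G$ such that no non-identity element of $G$ fixes a nonempty open subset of $V$. Let $\pi$ be the Poisson bivector of $\omega$, let $S\subset G$ be the set of $g$ with $\dim N^g=2$, and let $\kappa=\pi+\sum_{g\in S}\Lambda_g$ with $\sum_{g\in S}\Lambda_g\in\Gamma\big(\bigoplus_{g\in S}\wedge^2N^g\big)^G$ and each $\Lambda_g$ constant on $V^g$. Then the noncommutative Poisson structure $\kappa$ on $\mathrm{Poly}(V)\rtimes G$ can be deformation quantized: there exists a deformation quantization of $\kappa$.
   Context: $\mathrm{Poly}(V)$: polynomial functions, with $(gf)(x)=f(g^{-1}x)$; $\mathrm{Poly}(V)\rtimes G$ is spanned by $aU_g$ with $(aU_g)(bU_h)=a\,g(b)U_{gh}$. $V^g$ is the fixed subspace of $g$, $N^g$ the sum of the nontrivial irreducible subrepresentations of $\langle g\rangle$, $V=V^g\oplus N^g$, $l(g)=\dim N^g$. $G$ acts on $\bigoplus_g\Gamma(\wedge^{\bullet-l(g)}TV^g\otimes\wedge^{l(g)}N^g)$ by $(h\xi)_{hgh^{-1}}=h_*\xi_g$. Gerstenhaber bracket: for $\phi\in C^k(B,B)$, $\psi\in C^l(B,B)$, $\phi\circ\psi(a_1,\dots,a_{k+l-1})=\sum_{i=1}^k(-1)^{(i-1)(l-1)}\phi(a_1,\dots,a_{i-1},\psi(a_i,\dots,a_{i+l-1}),a_{i+l},\dots,a_{k+l-1})$, $[\phi,\psi]_G=\phi\circ\psi-(-1)^{(k-1)(l-1)}\psi\circ\phi$.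 A noncommutative Poisson structure on an algebra $B$ is $\Pi\in HH^2(B,B)$ with $[\Pi,\Pi]_G=0$ in $HH^3(B,B)$. Classes are identified through the known isomorphism $L:HH^k(\mathrm{Poly}(V)\rtimes G,\mathrm{Poly}(V)\rtimes G)\cong\Gamma\big(\bigoplus_g\wedge^{k-l(g)}TV^g\otimes\wedge^{l(g)}N^g\big)^G$ (polynomial coefficients): restrict a cocycle $\Psi$ to $\mathrm{Poly}(V)$, average over $G$ with respect to $(h\Psi)(f_1,\dots,f_k)=U_h\Psi(h^{-1}f_1,\dots,h^{-1}f_k)U_{h^{-1}}$, write it as $\sum_g\Psi_gU_g$, and for $p\in V^g$ let $L(\Psi)_g(p)$ be the projection to $\wedge^{k-l(g)}TV^g\otimes\wedge^{l(g)}N^g$ of $\sum_{i_1,\dots,i_k}\frac1{k!}\sum_\sigma(-1)^\sigma\Psi_g(x^{i_{\sigma(1)}}-x^{i_{\sigma(1)}}(p),\dots,x^{i_{\sigma(k)}}-x^{i_{\sigma(k)}}(p))(p)\,\frac{\partial}{\partial x^{i_1}}\wedge\cdots\wedge\frac{\partial}{\partial x^{i_k}}$, with $x^i$ linear coordinates. A deformation quantization of a noncommutative Poisson structure $\Pi$ on an associative algebra $B$ is an associative product $\star_\hbar$ on $B[[\hbar]]$ ($\hbar$-bilinear), $f\star_\hbar g=\sum_{i\ge0}\hbar^iC_i(f,g)$ for $f,g\in B$, with $C_0(f,g)=fg$ and Hochschild class $[C_1]=\Pi$. *)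

theory Defs
  imports
    "HOL-Analysis.Analysis"
    "HOL-Algebra.Group_Action"
    "HOL-Algebra.Generated_Groups"
    "HOL-Algebra.Module"
    "HOL-Combinatorics.Permutations"
begin

section \<open>Hochschild cohomology of an associative real algebra\<close>

text \<open>
  A real algebra is given by a record of type (real, 'b) module, whose fields are the ring
  operations and the scalar multiplication. A k-cochain is a function on lists; only its values on
  lists of length k with entries in the carrier are meaningful.
\<close>

definition args :: "(real, 'b) module \<Rightarrow> nat \<Rightarrow> 'b list set" where
  "args B k = {as. length as = k \<and> set as \<subseteq> carrier B}"

definition cochains :: "(real, 'b) module \<Rightarrow> nat \<Rightarrow> ('b list \<Rightarrow> 'b) set" where
  "cochains B k = {\<phi>. \<forall>as \<in> args B k. \<phi> as \<in> carrier B \<and>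
     (\<forall>i<k. \<forall>x \<in> carrier B. \<forall>y \<in> carrier B. \<forall>c.
        \<phi> (as[i := x \<oplus>\<^bsub>B\<^esub> y]) = \<phi> (as[i := x]) \<oplus>\<^bsub>B\<^esub> \<phi> (as[i := y]) \<and>
        \<phi> (as[i := c \<odot>\<^bsub>B\<^esub> x]) = c \<odot>\<^bsub>B\<^esub> \<phi> (as[i := x]))}"

definition hochschild_diff ::
  "(real, 'b) module \<Rightarrow> nat \<Rightarrow> ('b list \<Rightarrow> 'b) \<Rightarrow> 'b list \<Rightarrow> 'b" where
  "hochschild_diff B k \<phi> as =
     as ! 0 \<otimes>\<^bsub>B\<^esub> \<phi> (tl as)
     \<oplus>\<^bsub>B\<^esub> (\<Oplus>\<^bsub>B\<^esub>i\<in>{..<k}. (-1) ^ (i + 1) \<odot>\<^bsub>B\<^esub>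
            \<phi> (take i as @ [as ! i \<otimes>\<^bsub>B\<^esub> as ! (i + 1)] @ drop (i + 2) as))
     \<oplus>\<^bsub>B\<^esub> (-1) ^ (k + 1) \<odot>\<^bsub>B\<^esub> (\<phi> (take k as) \<otimes>\<^bsub>B\<^esub> as ! k)"

definition cocycles :: "(real, 'b) module \<Rightarrow> nat \<Rightarrow> ('b list \<Rightarrow> 'b) set" where
  "cocycles B k =
     {\<phi> \<in> cochains B k. \<forall>as \<in> args B (k + 1). hochschild_diff B k \<phi> as = \<zero>\<^bsub>B\<^esub>}"

definition coboundaries :: "(real, 'b) module \<Rightarrow> nat \<Rightarrow> ('b list \<Rightarrow> 'b) set" where
  "coboundaries B k = {\<psi> \<in> cochains B k.
     case k of
       0 \<Rightarrow> \<forall>as \<in> args B 0. \<psi> as = \<zero>\<^bsub>B\<^esub>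
     | Suc j \<Rightarrow> \<exists>\<eta> \<in> cochains B j. \<forall>as \<in> args B k. \<psi> as = hochschild_diff B j \<eta> as}"

definition cohomologous ::
  "(real, 'b) module \<Rightarrow> nat \<Rightarrow> (('b list \<Rightarrow> 'b) \<times> ('b list \<Rightarrow> 'b)) set" where
  "cohomologous B k = {(\<phi>, \<psi>). \<phi> \<in> cocycles B k \<and> \<psi> \<in> cocycles B k \<and>
     (\<lambda>as. \<phi> as \<ominus>\<^bsub>B\<^esub> \<psi> as) \<in> coboundaries B k}"

definition HH :: "(real, 'b) module \<Rightarrow> nat \<Rightarrow> ('b list \<Rightarrow> 'b) set set" where
  "HH B k = cocycles B k // cohomologous B k"

text \<open>
  In the signs below, l + 1 and k + 1 replace l - 1 and k - 1: they have the same parity, and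
  subtraction of natural numbers would truncate. Likewise the summation index starts at 0, so that
  i stands for the usual i - 1.
\<close>

definition gerstenhaber_circ ::
  "(real, 'b) module \<Rightarrow> nat \<Rightarrow> nat \<Rightarrow> ('b list \<Rightarrow> 'b) \<Rightarrow> ('b list \<Rightarrow> 'b) \<Rightarrow> 'b list \<Rightarrow> 'b" where
  "gerstenhaber_circ B k l \<phi> \<psi> as =
     (\<Oplus>\<^bsub>B\<^esub>i\<in>{..<k}. (-1) ^ (i * (l + 1)) \<odot>\<^bsub>B\<^esub>
        \<phi> (take i as @ [\<psi> (take l (drop i as))] @ drop (i + l) as))"

definition gerstenhaber_bracket ::
  "(real, 'b) module \<Rightarrow> nat \<Rightarrow> nat \<Rightarrow> ('b list \<Rightarrow> 'b) \<Rightarrow> ('b list \<Rightarrow> 'b) \<Rightarrow> 'b list \<Rightarrow> 'b" where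
  "gerstenhaber_bracket B k l \<phi> \<psi> as =
     gerstenhaber_circ B k l \<phi> \<psi> as
     \<ominus>\<^bsub>B\<^esub> (-1) ^ ((k + 1) * (l + 1)) \<odot>\<^bsub>B\<^esub> gerstenhaber_circ B l k \<psi> \<phi> as"

definition noncommutative_poisson :: "(real, 'b) module \<Rightarrow> ('b list \<Rightarrow> 'b) set \<Rightarrow> bool" where
  "noncommutative_poisson B \<P> \<longleftrightarrow>
     \<P> \<in> HH B 2 \<and> (\<forall>\<Psi> \<in> \<P>. gerstenhaber_bracket B 2 2 \<Psi> \<Psi> \<in> coboundaries B 3)"


section \<open>Deformation quantization\<close>

text \<open>Formal power series over B are the sequences of their coefficients.\<close>

definition formal_series :: "(real, 'b) module \<Rightarrow> (nat \<Rightarrow> 'b) set" where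
  "formal_series B = {F. \<forall>n. F n \<in> carrier B}"

definition fseries_const :: "(real, 'b) module \<Rightarrow> 'b \<Rightarrow> nat \<Rightarrow> 'b" where
  "fseries_const B a = (\<lambda>n. if n = 0 then a else \<zero>\<^bsub>B\<^esub>)"

definition fseries_add ::
  "(real, 'b) module \<Rightarrow> (nat \<Rightarrow> 'b) \<Rightarrow> (nat \<Rightarrow> 'b) \<Rightarrow> nat \<Rightarrow> 'b" where
  "fseries_add B F H = (\<lambda>n. F n \<oplus>\<^bsub>B\<^esub> H n)"

definition fseries_smult :: "(real, 'b) module \<Rightarrow> real fps \<Rightarrow> (nat \<Rightarrow> 'b) \<Rightarrow> nat \<Rightarrow> 'b" where
  "fseries_smult B c F = (\<lambda>n. \<Oplus>\<^bsub>B\<^esub>i\<in>{..n}. fps_nth c i \<odot>\<^bsub>B\<^esub> F (n - i))"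

text \<open>
  Bilinearity is over the ring of real formal power series; it forces continuity in the adic
  topology, so the product is determined by the cochains star_coeff.
\<close>

definition formal_product ::
  "(real, 'b) module \<Rightarrow> ((nat \<Rightarrow> 'b) \<Rightarrow> (nat \<Rightarrow> 'b) \<Rightarrow> nat \<Rightarrow> 'b) \<Rightarrow> bool" where
  "formal_product B star \<longleftrightarrow>
     (\<forall>F \<in> formal_series B. \<forall>H \<in> formal_series B. star F H \<in> formal_series B) \<and>
     (\<forall>F \<in> formal_series B. \<forall>F' \<in> formal_series B. \<forall>H \<in> formal_series B.
        star (fseries_add B F F') H = fseries_add B (star F H) (star F' H) \<and>
        star H (fseries_add B F F') = fseries_add B (star H F) (star H F')) \<and>
     (\<forall>c. \<forall>F \<in> formal_series B. \<forall>H \<in> formal_series B.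
        star (fseries_smult B c F) H = fseries_smult B c (star F H) \<and>
        star F (fseries_smult B c H) = fseries_smult B c (star F H)) \<and>
     (\<forall>F \<in> formal_series B. \<forall>H \<in> formal_series B. \<forall>K \<in> formal_series B.
        star (star F H) K = star F (star H K))"

definition star_coeff ::
  "(real, 'b) module \<Rightarrow> ((nat \<Rightarrow> 'b) \<Rightarrow> (nat \<Rightarrow> 'b) \<Rightarrow> nat \<Rightarrow> 'b) \<Rightarrow> nat \<Rightarrow> 'b list \<Rightarrow> 'b" where
  "star_coeff B star i as = star (fseries_const B (as ! 0)) (fseries_const B (as ! 1)) i"

definition deformation_quantization ::
  "(real, 'b) module \<Rightarrow> ('b list \<Rightarrow> 'b) set \<Rightarrow>
   ((nat \<Rightarrow> 'b) \<Rightarrow> (nat \<Rightarrow> 'b) \<Rightarrow> nat \<Rightarrow> 'b) \<Rightarrow> bool" where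
  "deformation_quantization B \<P> star \<longleftrightarrow>
     formal_product B star \<and>
     (\<forall>f \<in> carrier B. \<forall>g \<in> carrier B. star_coeff B star 0 [f, g] = f \<otimes>\<^bsub>B\<^esub> g) \<and>
     star_coeff B star 1 \<in> cocycles B 2 \<and>
     cohomologous B 2 `` {star_coeff B star 1} = \<P>"


section \<open>The crossed product of polynomial functions with a group\<close>

text \<open>An element is the family of its coefficients: a represents the sum of all a g U_g.\<close>

definition crossed_product ::
  "('g, 'm) monoid_scheme \<Rightarrow> ('g \<Rightarrow> 'v::real_normed_vector \<Rightarrow> 'v) \<Rightarrow> (real, 'g \<Rightarrow> 'v \<Rightarrow> real) module"
where
  "crossed_product G \<phi> =
     \<lparr>carrier = {a. (\<forall>g \<in> carrier G. real_polynomial_function (a g)) \<and>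
                    (\<forall>g. g \<notin> carrier G \<longrightarrow> a g = (\<lambda>x. 0))},
      mult = (\<lambda>a b k x. \<Sum>(g, h) \<in> {(g, h) \<in> carrier G \<times> carrier G. g \<otimes>\<^bsub>G\<^esub> h = k}.
                a g x * b h (\<phi> (inv\<^bsub>G\<^esub> g) x)),
      one = (\<lambda>g x. if g = \<one>\<^bsub>G\<^esub> then 1 else 0),
      zero = (\<lambda>g x. 0),
      add = (\<lambda>a b g x. a g x + b g x),
      smult = (\<lambda>c a g x. c * a g x)\<rparr>"

definition cp_term :: "('v \<Rightarrow> real) \<Rightarrow> 'g \<Rightarrow> 'g \<Rightarrow> 'v \<Rightarrow> real" where
  "cp_term f h = (\<lambda>g x. if g = h then f x else 0)"

definition poly_act ::
  "('g, 'm) monoid_scheme \<Rightarrow> ('g \<Rightarrow> 'v \<Rightarrow> 'v) \<Rightarrow> 'g \<Rightarrow> ('v \<Rightarrow> real) \<Rightarrow> 'v \<Rightarrow> real" where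
  "poly_act G \<phi> g f = (\<lambda>x. f (\<phi> (inv\<^bsub>G\<^esub> g) x))"


section \<open>Fixed subspaces and their complements\<close>

definition subrepresentation ::
  "('g, 'm) monoid_scheme \<Rightarrow> ('g \<Rightarrow> 'v::real_vector \<Rightarrow> 'v) \<Rightarrow> 'g \<Rightarrow> 'v set \<Rightarrow> bool" where
  "subrepresentation G \<phi> g W \<longleftrightarrow>
     subspace W \<and> (\<forall>h \<in> generate G {g}. \<forall>w \<in> W. \<phi> h w \<in> W)"

definition irreducible_subrep ::
  "('g, 'm) monoid_scheme \<Rightarrow> ('g \<Rightarrow> 'v::real_vector \<Rightarrow> 'v) \<Rightarrow> 'g \<Rightarrow> 'v set \<Rightarrow> bool" where
  "irreducible_subrep G \<phi> g W \<longleftrightarrow>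
     subrepresentation G \<phi> g W \<and> W \<noteq> {0} \<and>
     (\<forall>U. subrepresentation G \<phi> g U \<and> U \<subseteq> W \<longrightarrow> U = {0} \<or> U = W)"

abbreviation fixed_space :: "('g \<Rightarrow> 'v \<Rightarrow> 'v) \<Rightarrow> 'g \<Rightarrow> 'v set" where
  "fixed_space \<phi> g \<equiv> invariants UNIV \<phi> g"

definition moving_space ::
  "('g, 'm) monoid_scheme \<Rightarrow> ('g \<Rightarrow> 'v::real_vector \<Rightarrow> 'v) \<Rightarrow> 'g \<Rightarrow> 'v set" where
  "moving_space G \<phi> g =
     span (\<Union>{W. irreducible_subrep G \<phi> g W \<and> (\<exists>h \<in> generate G {g}. \<exists>w \<in> W. \<phi> h w \<noteq> w)})"

definition codim_fixed ::
  "('g, 'm) monoid_scheme \<Rightarrow> ('g \<Rightarrow> 'v::real_vector \<Rightarrow> 'v) \<Rightarrow> 'g \<Rightarrow> nat" where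
  "codim_fixed G \<phi> g = dim (moving_space G \<phi> g)"

text \<open>The projections belonging to the direct sum of fixed_space and moving_space.\<close>

definition moving_part ::
  "('g, 'm) monoid_scheme \<Rightarrow> ('g \<Rightarrow> 'v::real_vector \<Rightarrow> 'v) \<Rightarrow> 'g \<Rightarrow> 'v \<Rightarrow> 'v" where
  "moving_part G \<phi> g v = (THE n. n \<in> moving_space G \<phi> g \<and> v - n \<in> fixed_space \<phi> g)"

definition fixed_part ::
  "('g, 'm) monoid_scheme \<Rightarrow> ('g \<Rightarrow> 'v::real_vector \<Rightarrow> 'v) \<Rightarrow> 'g \<Rightarrow> 'v \<Rightarrow> 'v" where
  "fixed_part G \<phi> g v = v - moving_part G \<phi> g v"


section \<open>Multivectors\<close>

text \<open>
  The k-th exterior power of a finite-dimensional V is identified with the alternating k-linear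
  functions of covectors, a product of vectors pairing with covectors through the determinant. To
  make such a function unique, it is set to 0 on lists that do not consist of k linear functionals.
\<close>

type_synonym 'v multivector = "('v \<Rightarrow> real) list \<Rightarrow> real"

definition wedge :: "'v::real_vector list \<Rightarrow> 'v multivector" where
  "wedge vs \<alpha>s =
     (if length \<alpha>s = length vs \<and> (\<forall>\<alpha> \<in> set \<alpha>s. linear \<alpha>)
      then \<Sum>\<sigma> | \<sigma> permutes {..<length vs}.
             of_int (sign \<sigma>) * (\<Prod>j<length vs. (\<alpha>s ! j) (vs ! \<sigma> j))
      else 0)"

definition exterior_power :: "nat \<Rightarrow> 'v::real_vector set \<Rightarrow> 'v multivector set" where
  "exterior_power k W = {T. \<exists>I c. finite I \<and> I \<subseteq> {ws. length ws = k \<and> set ws \<subseteq> W} \<and>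
     T = (\<lambda>\<alpha>s. \<Sum>ws\<in>I. c ws * wedge ws \<alpha>s)}"

definition pushforward :: "('v \<Rightarrow> 'v) \<Rightarrow> 'v multivector \<Rightarrow> 'v multivector" where
  "pushforward h T = (\<lambda>\<alpha>s. T (map (\<lambda>\<alpha>. \<alpha> \<circ> h) \<alpha>s))"

text \<open>
  The component of a wedge product in the summand with l factors in the moving space and the other
  factors in the fixed space of g, where l = codim_fixed G \<phi> g: expand each factor as
  fixed part + moving part; A is the set of positions at which the moving part is chosen. The sum is
  empty, hence 0, if l exceeds the degree.
\<close>

definition wedge_component ::
  "('g, 'm) monoid_scheme \<Rightarrow> ('g \<Rightarrow> 'v::real_vector \<Rightarrow> 'v) \<Rightarrow> 'g \<Rightarrow> 'v list \<Rightarrow> 'v multivector"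
where
  "wedge_component G \<phi> g vs \<alpha>s =
     (\<Sum>A | A \<subseteq> {..<length vs} \<and> card A = codim_fixed G \<phi> g.
        wedge (map (\<lambda>j. if j \<in> A then moving_part G \<phi> g (vs ! j) else fixed_part G \<phi> g (vs ! j))
                   [0..<length vs]) \<alpha>s)"


section \<open>From Hochschild cocycles to multivector fields\<close>

text \<open>
  restrict_average restricts a cochain to polynomials (embedded at the unit of G) and
  averages it over G; its value at g is the coefficient of U_g.
\<close>

definition restrict_average ::
  "('g, 'm) monoid_scheme \<Rightarrow> ('g \<Rightarrow> 'v::real_normed_vector \<Rightarrow> 'v) \<Rightarrow>
   (('g \<Rightarrow> 'v \<Rightarrow> real) list \<Rightarrow> 'g \<Rightarrow> 'v \<Rightarrow> real) \<Rightarrow> ('v \<Rightarrow> real) list \<Rightarrow> 'g \<Rightarrow> 'v \<Rightarrow> real" where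
  "restrict_average G \<phi> \<Psi> fs =
     (let B = crossed_product G \<phi>; U = cp_term (\<lambda>x. 1) in
      (1 / card (carrier G)) \<odot>\<^bsub>B\<^esub>
      (\<Oplus>\<^bsub>B\<^esub>h\<in>carrier G.
         U h \<otimes>\<^bsub>B\<^esub> \<Psi> (map (\<lambda>f. cp_term (poly_act G \<phi> (inv\<^bsub>G\<^esub> h) f) \<one>\<^bsub>G\<^esub>) fs)
             \<otimes>\<^bsub>B\<^esub> U (inv\<^bsub>G\<^esub> h)))"

text \<open>
  E is a basis of V; the linear coordinate belonging to e in E is representation E v e, and the
  corresponding coordinate vector field is e.
\<close>

definition cocycle_to_multivector ::
  "('g, 'm) monoid_scheme \<Rightarrow> ('g \<Rightarrow> 'v::real_normed_vector \<Rightarrow> 'v) \<Rightarrow> 'v set \<Rightarrow> nat \<Rightarrow>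
   (('g \<Rightarrow> 'v \<Rightarrow> real) list \<Rightarrow> 'g \<Rightarrow> 'v \<Rightarrow> real) \<Rightarrow> 'g \<Rightarrow> 'v \<Rightarrow> 'v multivector" where
  "cocycle_to_multivector G \<phi> E k \<Psi> g p \<alpha>s =
     (\<Sum>es | length es = k \<and> set es \<subseteq> E.
        (1 / fact k) *
        (\<Sum>\<sigma> | \<sigma> permutes {..<k}.
           of_int (sign \<sigma>) *
           restrict_average G \<phi> \<Psi>
             (map (\<lambda>j v. representation E v (es ! \<sigma> j) - representation E p (es ! \<sigma> j)) [0..<k])
             g p) *
        wedge_component G \<phi> g es \<alpha>s)"

text \<open>
  The class \<P> corresponds to the family of multivector fields \<xi>, where \<xi> g is a field on the fixed
  space of g.
\<close>

definition class_of_multivector ::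
  "('g, 'm) monoid_scheme \<Rightarrow> ('g \<Rightarrow> 'v::real_normed_vector \<Rightarrow> 'v) \<Rightarrow> 'v set \<Rightarrow> nat \<Rightarrow>
   (('g \<Rightarrow> 'v \<Rightarrow> real) list \<Rightarrow> 'g \<Rightarrow> 'v \<Rightarrow> real) set \<Rightarrow> ('g \<Rightarrow> 'v \<Rightarrow> 'v multivector) \<Rightarrow> bool" where
  "class_of_multivector G \<phi> E k \<P> \<xi> \<longleftrightarrow>
     \<P> \<in> HH (crossed_product G \<phi>) k \<and>
     (\<forall>\<Psi> \<in> \<P>. \<forall>g \<in> carrier G. \<forall>p \<in> fixed_space \<phi> g.
        cocycle_to_multivector G \<phi> E k \<Psi> g p = \<xi> g p)"


section \<open>Symplectic forms\<close>

definition symplectic_form :: "('v::real_vector \<Rightarrow> 'v \<Rightarrow> real) \<Rightarrow> bool" where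
  "symplectic_form \<omega> \<longleftrightarrow>
     (\<forall>v. linear (\<omega> v)) \<and> (\<forall>w. linear (\<lambda>v. \<omega> v w)) \<and> (\<forall>v. \<omega> v v = 0) \<and>
     (\<forall>v. (\<forall>w. \<omega> v w = 0) \<longrightarrow> v = 0)"

text \<open>
  Convention: the Poisson bivector pairs covectors \<alpha>, \<beta> to \<omega> X Y, where \<omega> X _ = \<alpha> and \<omega> Y _ = \<beta>. For
  the form dx \<and> dp this is the bivector with {x, p} = 1. The opposite sign in the definition of
  the Hamiltonian vectors gives the same bivector.
\<close>

definition hamiltonian_vector :: "('v::real_vector \<Rightarrow> 'v \<Rightarrow> real) \<Rightarrow> ('v \<Rightarrow> real) \<Rightarrow> 'v" where
  "hamiltonian_vector \<omega> \<alpha> = (THE v. \<forall>w. \<omega> v w = \<alpha> w)"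

definition poisson_bivector :: "('v::real_vector \<Rightarrow> 'v \<Rightarrow> real) \<Rightarrow> 'v multivector" where
  "poisson_bivector \<omega> \<alpha>s =
     (if length \<alpha>s = 2 \<and> (\<forall>\<alpha> \<in> set \<alpha>s. linear \<alpha>)
      then \<omega> (hamiltonian_vector \<omega> (\<alpha>s ! 0)) (hamiltonian_vector \<omega> (\<alpha>s ! 1))
      else 0)"

definition symplectic_reflections ::
  "('g, 'm) monoid_scheme \<Rightarrow> ('g \<Rightarrow> 'v::real_vector \<Rightarrow> 'v) \<Rightarrow> 'g set" where
  "symplectic_reflections G \<phi> = {g \<in> carrier G. codim_fixed G \<phi> g = 2}"

text \<open>The Poisson bivector is placed at the unit of G.\<close>

definition poisson_plus_reflections ::
  "('g, 'm) monoid_scheme \<Rightarrow> ('g \<Rightarrow> 'v::real_vector \<Rightarrow> 'v) \<Rightarrow> ('v \<Rightarrow> 'v \<Rightarrow> real) \<Rightarrow>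
   ('g \<Rightarrow> 'v \<Rightarrow> 'v multivector) \<Rightarrow> 'g \<Rightarrow> 'v \<Rightarrow> 'v multivector" where
  "poisson_plus_reflections G \<phi> \<omega> \<Lambda> g p \<alpha>s =
     (if g = \<one>\<^bsub>G\<^esub> then poisson_bivector \<omega> \<alpha>s else 0) +
     (if g \<in> symplectic_reflections G \<phi> then \<Lambda> g p \<alpha>s else 0)"

end

theory Submission
  imports
    Defs
    "HOL-Library.Multiset"
    "HOL-Computational_Algebra.Polynomial"
    "HOL-Computational_Algebra.Formal_Power_Series"
begin

text \<open>
  A deformation quantization of \<kappa> should be the symplectic reflection algebra over formal power series
  in t: the algebra generated by the group and the covectors, in which the commutator of \<alpha> and \<beta> is
  t times the sum of all \<kappa> g \<alpha> \<beta> U g. What has to be shown is that this algebra is not too small, the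
  Poincare-Birkhoff-Witt property. It is obtained by realizing the algebra by operators.

  Since the group acts effectively, the crossed product acts faithfully on the polynomial functions
  (L_eq_0). The coordinates x i, as multiplication operators, are deformed to power series
  Y i = x i + O(t) of operators that satisfy the relations above and transform under the group as
  the coordinates are (deformed_coordinates_exist). This is done order by order. The obstruction in each
  order is a 2-cocycle of the Koszul complex of the endomorphisms of the polynomial algebra, by the
  Jacobi identity for commutators and for \<kappa>. As the polynomial algebra is free over itself, this
  complex is exact in degree 2 (poincare_endo), so the obstruction vanishes; averaging restores
  equivariance. The Jacobi identity for \<kappa> holds because for a symplectic reflection g it amounts to an
  alternating 3-form on the two-dimensional moving space of g.

  Normal ordering sends a polynomial times U g to a combination of sorted words in the Y i times U g. It is
  injective on formal series, because its constant term is the faithful action, and its image is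
  closed under products, because words can be sorted at the cost of shorter words (word_in_N). The
  product of operators therefore pulls back to an associative product on formal series.

  In this product affine functions have exactly the commutator t \<kappa>, and coboundaries do not contribute
  to commutators of affine functions vanishing at a fixed point (commutator_of_representative); hence its
  first order part has the required class. That the class is a noncommutative Poisson structure, for
  all its representatives, follows from associativity in the second order
  (second_order_deformation). The projections in the identification of classes with multivector fields
  are computed from the equality of the moving space of g with the image of 1 - g, which rests on
  Maschke's averaging argument (kernel_e_moving).
\<close>

section \<open>Polynomial functions, endomorphisms and power series as algebras\<close>

text \<open>
  Polynomial functions and their endomorphisms are made into types so that the ring of operator
  valued power series, where the whole construction takes place, is an instance of the ring classes.
\<close>

typedef (overloaded) 'v polyfun = "{f :: 'v::real_normed_vector \<Rightarrow> real. real_polynomial_function f}"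
  morphisms peval Polyfun
  by (rule exI[of _ "\<lambda>_. 0"]) auto

setup_lifting type_definition_polyfun

instantiation polyfun :: (real_normed_vector) "{comm_ring_1, real_algebra_1}"
begin

lift_definition zero_polyfun :: "'a polyfun" is "\<lambda>_. 0" by auto
lift_definition one_polyfun :: "'a polyfun" is "\<lambda>_. 1" by auto
lift_definition plus_polyfun :: "'a polyfun \<Rightarrow> 'a polyfun \<Rightarrow> 'a polyfun"
  is "\<lambda>f g x. f x + g x" by auto
lift_definition minus_polyfun :: "'a polyfun \<Rightarrow> 'a polyfun \<Rightarrow> 'a polyfun"
  is "\<lambda>f g x. f x - g x" by auto
lift_definition uminus_polyfun :: "'a polyfun \<Rightarrow> 'a polyfun"
  is "\<lambda>f x. - f x" by auto
lift_definition times_polyfun :: "'a polyfun \<Rightarrow> 'a polyfun \<Rightarrow> 'a polyfun"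
  is "\<lambda>f g x. f x * g x" by auto
lift_definition scaleR_polyfun :: "real \<Rightarrow> 'a polyfun \<Rightarrow> 'a polyfun"
  is "\<lambda>c f x. c * f x" by auto

instance
proof
  show "(0 :: 'a polyfun) \<noteq> 1" by transfer (auto simp: fun_eq_iff)
qed (transfer; auto simp: fun_eq_iff algebra_simps)+

end

lemma peval_simps [simp]:
  "peval 0 x = 0" "peval 1 x = 1" "peval (f + g) x = peval f x + peval g x"
  "peval (f - g) x = peval f x - peval g x" "peval (- f) x = - peval f x"
  "peval (f * g) x = peval f x * peval g x" "peval (c *\<^sub>R f) x = c * peval f x"
  by (transfer; simp)+

lemma peval_sum [simp]: "peval (sum f A) x = (\<Sum>a\<in>A. peval (f a) x)"
  by (induction A rule: infinite_finite_induct) auto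

lemma polyfun_eqI: "(\<And>x. peval f x = peval g x) \<Longrightarrow> f = g"
  by (metis peval_inject ext)

lemma peval_Polyfun: "real_polynomial_function f \<Longrightarrow> peval (Polyfun f) = f"
  by (simp add: Polyfun_inverse)

lemma real_polynomial_peval [simp, intro]: "real_polynomial_function (peval f)"
  using peval[of f] by simp

typedef (overloaded) 'a endo = "{T :: 'a::real_algebra_1 \<Rightarrow> 'a. linear T}"
  morphisms app Endo
  by (auto intro: linear_id)

setup_lifting type_definition_endo

instantiation endo :: (real_algebra_1) real_algebra_1
begin

lift_definition zero_endo :: "'a endo" is "\<lambda>_. 0" by (rule linear_zero)
lift_definition one_endo :: "'a endo" is "\<lambda>m. m" by (rule linear_ident)
lift_definition plus_endo :: "'a endo \<Rightarrow> 'a endo \<Rightarrow> 'a endo"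
  is "\<lambda>S T m. S m + T m" by (rule linear_compose_add)
lift_definition minus_endo :: "'a endo \<Rightarrow> 'a endo \<Rightarrow> 'a endo"
  is "\<lambda>S T m. S m - T m" by (rule linear_compose_sub)
lift_definition uminus_endo :: "'a endo \<Rightarrow> 'a endo"
  is "\<lambda>S m. - S m" by (rule linear_compose_neg)
lift_definition times_endo :: "'a endo \<Rightarrow> 'a endo \<Rightarrow> 'a endo"
  is "\<lambda>S T m. S (T m)" using linear_compose by (auto simp: o_def)
lift_definition scaleR_endo :: "real \<Rightarrow> 'a endo \<Rightarrow> 'a endo"
  is "\<lambda>c S m. c *\<^sub>R S m" by (rule linear_compose_scale_right)

instance
proof
  show "(0 :: 'a endo) \<noteq> 1" by transfer (metis zero_neq_one)
qed (transfer; auto simp: fun_eq_iff algebra_simps linear_add linear_scale)+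

end

lemma linear_app [simp, intro]: "linear (app T)"
  using app[of T] by simp

lemma app_simps [simp]:
  "app 0 m = 0" "app 1 m = m" "app (S + T) m = app S m + app T m"
  "app (S - T) m = app S m - app T m" "app (- S) m = - app S m"
  "app (S * T) m = app S (app T m)" "app (c *\<^sub>R S) m = c *\<^sub>R app S m"
  by (transfer; simp)+

lemma app_lin [simp]:
  "app T 0 = 0" "app T (m + m') = app T m + app T m'" "app T (m - m') = app T m - app T m'"
  "app T (- m) = - app T m" "app T (c *\<^sub>R m) = c *\<^sub>R app T m"
  using linear_app[of T] by (simp_all add: linear_0 linear_add linear_diff linear_neg linear_scale)

lemma app_sum [simp]: "app (sum f A) m = (\<Sum>a\<in>A. app (f a) m)"
  by (induction A rule: infinite_finite_induct) auto

lemma endo_eqI: "(\<And>m. app S m = app T m) \<Longrightarrow> S = T"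
  by (metis app_inject ext)

lemma app_Endo: "linear T \<Longrightarrow> app (Endo T) = T"
  by (simp add: Endo_inverse)

lift_definition mulop :: "'a::{comm_ring_1,real_algebra_1} \<Rightarrow> 'a endo" is "\<lambda>a m. a * m"
  by (auto intro!: linearI simp: algebra_simps)

lemma app_mulop [simp]: "app (mulop a) m = a * m"
  by transfer simp

lemma mulop_simps:
  "mulop (a + b) = mulop a + mulop b" "mulop (a * b) = mulop a * mulop b"
  "mulop (c *\<^sub>R a) = c *\<^sub>R mulop a" "mulop 0 = 0" "mulop 1 = 1"
  by (rule endo_eqI; simp add: algebra_simps)+

lemma linear_mulop: "linear mulop"
  by (rule linearI) (simp_all add: mulop_simps)

instantiation fps :: (real_algebra_1) real_algebra_1
begin

definition scaleR_fps :: "real \<Rightarrow> 'a fps \<Rightarrow> 'a fps" where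
  "scaleR_fps c F = Abs_fps (\<lambda>n. c *\<^sub>R fps_nth F n)"

instance
proof
  fix a b :: real and x y :: "'a fps"
  show "a *\<^sub>R x * y = a *\<^sub>R (x * y)"
    by (rule fps_ext) (simp add: scaleR_fps_def fps_mult_nth scaleR_sum_right)
  show "x * a *\<^sub>R y = a *\<^sub>R (x * y)"
    by (rule fps_ext) (simp add: scaleR_fps_def fps_mult_nth scaleR_sum_right)
qed (simp_all add: scaleR_fps_def fps_eq_iff algebra_simps)

end

lemma fps_nth_scaleR [simp]: "fps_nth (c *\<^sub>R F) n = c *\<^sub>R fps_nth F n"
  by (simp add: scaleR_fps_def)

lemma fps_const_scaleR: "fps_const (c *\<^sub>R a) = c *\<^sub>R fps_const a"
  by (rule fps_ext) simp

lemma fps_const_sum: "fps_const (sum f A) = (\<Sum>a\<in>A. fps_const (f a))"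
  by (induction A rule: infinite_finite_induct) (auto simp: fps_const_add [symmetric] simp del: fps_const_add)

section \<open>The Poincare lemma for endomorphisms of a polynomial algebra\<close>

definition comm :: "'r::ring \<Rightarrow> 'r \<Rightarrow> 'r" where "comm a b = a * b - b * a"

lemma comm_Jacobi: "comm a (comm b c) + comm b (comm c a) + comm c (comm a b) = 0"
  by (simp add: comm_def algebra_simps)

text \<open>
  The Koszul complex of commuting elements x acting on endomorphisms by commutators is exact in degree 2
  because the algebra is free on the monomials.
\<close>

locale polynomial_algebra =
  fixes x :: "nat \<Rightarrow> 'a::{comm_ring_1,real_algebra_1}" and n :: nat
  assumes monomials_inj: "inj_on (\<lambda>A. prod_mset (image_mset x A)) {A. set_mset A \<subseteq> {..<n}}"
    and monomials_independent: "independent ((\<lambda>A. prod_mset (image_mset x A)) ` {A. set_mset A \<subseteq> {..<n}})"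
    and monomials_span: "span ((\<lambda>A. prod_mset (image_mset x A)) ` {A. set_mset A \<subseteq> {..<n}}) = UNIV"
begin

definition mono :: "nat multiset \<Rightarrow> 'a" where "mono A = prod_mset (image_mset x A)"

definition exps :: "nat multiset set" where "exps = {A. set_mset A \<subseteq> {..<n}}"

lemma inj_mono: "inj_on mono exps"
  using monomials_inj by (simp add: mono_def[abs_def] exps_def)

lemma linear_on_monomials_exists: "\<exists>L. linear L \<and> (\<forall>A\<in>exps. L (mono A) = F A)"
  for F :: "nat multiset \<Rightarrow> 'b::real_vector"
proof -
  have "independent (mono ` exps)"
    using monomials_independent by (simp add: mono_def[abs_def] exps_def)
  then obtain L where L: "linear L" "\<forall>m\<in>mono ` exps. L m = F (inv_into exps mono m)"
    using linear_independent_extend[of "mono ` exps" "\<lambda>m. F (inv_into exps mono m)"] by blast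
  moreover have "inv_into exps mono (mono A) = A" if "A \<in> exps" for A
    using inj_mono that by (rule inv_into_f_f)
  ultimately have "\<forall>A\<in>exps. L (mono A) = F A" by simp
  with L(1) show ?thesis by blast
qed

lemma linear_eq_on_monomials:
  fixes L L' :: "'a \<Rightarrow> 'b::real_vector"
  assumes "linear L" "linear L'" "\<And>A. A \<in> exps \<Longrightarrow> L (mono A) = L' (mono A)"
  shows "L = L'"
proof
  fix m
  have "m \<in> span (mono ` exps)"
    using monomials_span by (simp add: mono_def[abs_def] exps_def)
  then show "L m = L' m"
    using linear_eq_on[OF assms(1,2), of m "mono ` exps"] assms(3) by blast
qed

lemma mono_simps [simp]: "mono {#} = 1" "mono (add_mset i A) = x i * mono A"
  by (simp_all add: mono_def)

lemma exps_simps [simp]: "{#} \<in> exps" "add_mset i A \<in> exps \<longleftrightarrow> i < n \<and> A \<in> exps"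
  by (auto simp: exps_def)

text \<open>
  A solution \<theta> of the Koszul equation is pinned down by normal ordering: \<theta> j vanishes on the monomials
  all of whose letters are at least j. The equation for the pair (l, j), where l < j is the smallest
  letter of a monomial, then forces the value of \<theta> j there.
\<close>

function potential :: "(nat \<Rightarrow> nat \<Rightarrow> 'a endo) \<Rightarrow> nat \<Rightarrow> nat multiset \<Rightarrow> 'a" where
  "potential \<Omega> j A =
     (if A = {#} \<or> j \<le> Min_mset A then 0
      else let l = Min_mset A in
        x l * potential \<Omega> j (A - {#l#}) - app (\<Omega> l j) (mono (A - {#l#})))"
  by pat_completeness auto
termination
  by (relation "Wellfounded.measure (\<lambda>(\<Omega>, j, A). size A)") (auto simp: size_Diff_singleton nonempty_has_size)

declare potential.simps [simp del]

lemma Min_mset_add_le: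
  assumes "\<And>i. i \<in># A \<Longrightarrow> l \<le> (i::nat)"
  shows "Min_mset (add_mset l A) = l"
  using assms by (intro Min_eqI) auto

text \<open>
  The equation for (l, j) holds by construction on monomials whose letters are all at least l. A monomial
  whose smallest letter is k < l is x k times a shorter one, and closedness of the error \<psi> in the letters
  k, l, j moves x k out of \<psi>: what remains is \<psi> on the shorter monomial and \<psi> with first index k on
  monomials whose letters are at least k.
\<close>

lemma poincare_endo:
  assumes antisym: "\<And>i j. i < n \<Longrightarrow> j < n \<Longrightarrow> \<Omega> j i = - \<Omega> i j"
    and closed: "\<And>i j l. i < n \<Longrightarrow> j < n \<Longrightarrow> l < n \<Longrightarrow>
      comm (mulop (x l)) (\<Omega> i j) + comm (mulop (x i)) (\<Omega> j l) + comm (mulop (x j)) (\<Omega> l i) = 0"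
  shows "\<exists>\<theta>. \<forall>i<n. \<forall>j<n. comm (mulop (x i)) (\<theta> j) - comm (mulop (x j)) (\<theta> i) = \<Omega> i j"
proof -
  have "\<exists>T. linear T \<and> (\<forall>A\<in>exps. T (mono A) = potential \<Omega> j A)" for j
    by (rule linear_on_monomials_exists)
  then have "\<exists>T. \<forall>A\<in>exps. app T (mono A) = potential \<Omega> j A" for j
    by (metis app_Endo)
  then obtain \<theta> where \<theta>: "\<And>j A. A \<in> exps \<Longrightarrow> app (\<theta> j) (mono A) = potential \<Omega> j A"
    by metis
  define \<psi> where "\<psi> i j = comm (mulop (x i)) (\<theta> j) - comm (mulop (x j)) (\<theta> i) - \<Omega> i j" for i j
  have \<psi>_antisym: "\<psi> j i = - \<psi> i j" if "i < n" "j < n" for i j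
    using antisym[OF that] by (simp add: \<psi>_def)
  have comm_x: "comm (mulop (x i)) (comm (mulop (x j)) T) = comm (mulop (x j)) (comm (mulop (x i)) T)"
    for i j T
    by (rule endo_eqI) (simp add: comm_def algebra_simps)
  have self_neg_zero: "T = - T \<longleftrightarrow> T = 0" for T :: "'a endo"
    by (simp add: eq_neg_iff_add_eq_0 flip: scaleR_2)
  have comm_diff: "comm a (b - c) = comm a b - comm a c" for a b c :: "'a endo"
    by (simp add: comm_def algebra_simps)
  have \<psi>_closed: "comm (mulop (x l)) (\<psi> i j) + comm (mulop (x i)) (\<psi> j l) + comm (mulop (x j)) (\<psi> l i) = 0"
    if "i < n" "j < n" "l < n" for i j l
    using closed[OF that] comm_x[of l i "\<theta> j"] comm_x[of l j "\<theta> i"] comm_x[of i j "\<theta> l"]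
    unfolding \<psi>_def comm_diff by (simp add: algebra_simps)
  have \<psi>_small: "app (\<psi> l j) (mono A) = 0"
    if "l < n" "j < n" "l < j" "A \<in> exps" and le: "\<And>i. i \<in># A \<Longrightarrow> l \<le> i" for l j A
  proof -
    have min: "Min_mset (add_mset l A) = l"
      using le by (rule Min_mset_add_le)
    have 1: "potential \<Omega> j (add_mset l A) = x l * potential \<Omega> j A - app (\<Omega> l j) (mono A)"
      using \<open>l < j\<close> by (subst potential.simps) (simp add: min Let_def del: set_mset_add_mset_insert)
    have 2: "potential \<Omega> l A = 0"
      using le by (subst potential.simps) (auto intro!: Min.boundedI)
    have "Min_mset (add_mset j A) \<ge> l"
      using le \<open>l < j\<close> by (auto intro!: Min.boundedI)
    then have 3: "potential \<Omega> l (add_mset j A) = 0"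
      by (subst potential.simps) simp
    have x: "x i * mono A = mono (add_mset i A)" for i by simp
    show ?thesis
      unfolding \<psi>_def comm_def
      using that \<theta>[of A l] \<theta>[of "add_mset l A" j] \<theta>[of A j] \<theta>[of "add_mset j A" l] 1 2 3
      by simp
  qed
  have \<psi>_mono: "\<forall>i<n. \<forall>j<n. A \<in> exps \<longrightarrow> app (\<psi> i j) (mono A) = 0" for A
  proof (induction "size A" arbitrary: A rule: less_induct)
    case less
    have lt: "app (\<psi> i j) (mono A) = 0" if "i < n" "j < n" "A \<in> exps" "i < j" for i j
    proof (cases "\<forall>k \<in># A. i \<le> k")
      case True
      then show ?thesis using \<psi>_small that by blast
    next
      case False
      define l where "l = Min_mset A"
      define B where "B = A - {#l#}"
      have "A \<noteq> {#}" using False by auto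
      then have "l \<in># A" by (auto simp: l_def)
      then have A: "A = add_mset l B" by (simp add: B_def)
      have l_le: "l \<le> k" if "k \<in># A" for k using that by (auto simp: l_def)
      have "l < i" using False l_le by (meson le_less_trans not_le)
      have "l < n" and B: "B \<in> exps" using \<open>A \<in> exps\<close> by (auto simp: A)
      have IH: "app (\<psi> a b) (mono B) = 0" if "a < n" "b < n" for a b
        using less[of B] that B by (simp add: A)
      have B_le: "l \<le> k" if "k \<in># B" for k using that l_le by (simp add: A)
      have small: "app (\<psi> l a) (mono (add_mset b B)) = 0"
        if "a < n" "b < n" "l < a" "l < b" for a b
        using that \<open>l < n\<close> B B_le by (intro \<psi>_small) auto
      have "app (comm (mulop (x l)) (\<psi> i j) + comm (mulop (x i)) (\<psi> j l) + comm (mulop (x j)) (\<psi> l i))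
              (mono B) = 0"
        using \<psi>_closed[OF that(1,2) \<open>l < n\<close>] by simp
      moreover have "app (\<psi> j l) (mono (add_mset i B)) = 0"
        using small[of j i] \<psi>_antisym[of l j] that \<open>l < i\<close> \<open>l < n\<close> by simp
      ultimately show ?thesis
        using IH[of i j] IH[of j l] IH[of l i] small[of i j] that \<open>l < i\<close> \<open>l < n\<close>
        by (simp add: comm_def A)
    qed
    show ?case
    proof (intro allI impI)
      fix i j assume ij: "i < n" "j < n" "A \<in> exps"
      consider "i < j" | "j < i" | "i = j" by linarith
      then show "app (\<psi> i j) (mono A) = 0"
      proof cases
        case 2
        then show ?thesis using lt[of j i] \<psi>_antisym[of j i] ij by simp
      next
        case 3
        then have "\<psi> i j = 0"
          using \<psi>_antisym[of i i] ij(1) by (simp add: self_neg_zero)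
        then show ?thesis by simp
      qed (use lt ij in auto)
    qed
  qed
  have "\<psi> i j = 0" if "i < n" "j < n" for i j
  proof -
    have "app (\<psi> i j) = app 0"
      using \<psi>_mono that by (intro linear_eq_on_monomials) auto
    then show ?thesis by (simp add: app_inject)
  qed
  then show ?thesis by (auto simp: \<psi>_def intro!: exI[of _ \<theta>])
qed

end

section \<open>Coordinates on a finite-dimensional space\<close>

text \<open>
  The polynomial functions are generated by bounded functionals, so coordinates are polynomial only
  because norms on a finite-dimensional space are equivalent: the norm attains a positive minimum
  on the compact set of vectors whose coefficients have absolute sum 1.
\<close>

lemma bounded_linear_of_finite_basis:
  fixes f :: "'v::real_normed_vector \<Rightarrow> real" and E :: "'v set"
  assumes E: "finite E" "independent E" "span E = UNIV" and f: "linear f"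
  shows "bounded_linear f"
proof (cases "E = {}")
  case True
  have "v = 0" for v :: 'v
  proof -
    have "v \<in> span E" by (simp add: E(3))
    then show ?thesis unfolding True by simp
  qed
  then have "f v = 0" for v using linear_0[OF f] by metis
  then have "f = (\<lambda>v. 0)" by auto
  then show ?thesis by simp
next
  case False
  define S :: "('v \<Rightarrow> real) set" where
    "S = PiE UNIV (\<lambda>e. if e \<in> E then {-1..1} else {0})"
  define s where "s a = (\<Sum>e\<in>E. \<bar>a e\<bar>)" for a :: "'v \<Rightarrow> real"
  define N where "N a = norm (\<Sum>e\<in>E. a e *\<^sub>R e)" for a
  have "compactin (product_topology (\<lambda>_. euclidean) UNIV) S"
    unfolding S_def compactin_PiE by auto
  then have "compact S" by (simp add: euclidean_product_topology)
  moreover have cont_s: "continuous_on UNIV s" and cont_N: "continuous_on UNIV N"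
    unfolding s_def N_def by (intro continuous_intros continuous_on_product_coordinates)+
  have "closed {a. s a = 1}"
    using cont_s by (intro closed_Collect_eq) (auto intro: continuous_intros)
  ultimately have K: "compact (S \<inter> {a. s a = 1})" (is "compact ?K")
    by (rule compact_Int_closed)
  obtain e0 where e0: "e0 \<in> E" using False by blast
  have "(\<lambda>e. if e = e0 then 1 else 0) \<in> ?K"
    using e0 E(1) by (auto simp: S_def s_def if_distrib cong: if_cong)
  then have "?K \<noteq> {}" by blast
  then obtain a0 where a0: "a0 \<in> ?K" "\<And>a. a \<in> ?K \<Longrightarrow> N a0 \<le> N a"
    using continuous_attains_inf[OF K] continuous_on_subset[OF cont_N] by (metis subset_UNIV)
  have "N a0 \<noteq> 0"
  proof
    assume "N a0 = 0"
    then have "(\<Sum>e\<in>E. a0 e *\<^sub>R e) = 0" by (simp add: N_def)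
    then have "\<forall>e\<in>E. a0 e = 0" using E(1,2) independent_explicit_finite_subsets by blast
    then show False using a0(1) by (simp add: s_def)
  qed
  then have pos: "N a0 > 0" by (simp add: N_def)
  have bound: "s (representation E v) \<le> norm v / N a0" for v
  proof (cases "s (representation E v) = 0")
    case False
    let ?a = "representation E v"
    have rep: "(\<Sum>e\<in>E. ?a e *\<^sub>R e) = v"
      using E by (intro real_vector.sum_representation_eq) auto
    have s: "s ?a > 0" using False by (simp add: s_def sum_nonneg less_le)
    have le: "- s ?a \<le> ?a e" "?a e \<le> s ?a" if "e \<in> E" for e
    proof -
      have "\<bar>?a e\<bar> \<le> s ?a"
        unfolding s_def using that E(1) by (intro member_le_sum) auto
      then show "- s ?a \<le> ?a e" "?a e \<le> s ?a" by linarith+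
    qed
    have z: "?a e = 0" if "e \<notin> E" for e using that representation_ne_zero by blast
    have "(\<lambda>e. ?a e / s ?a) \<in> ?K"
    proof
      show "(\<lambda>e. ?a e / s ?a) \<in> S"
        using s le z by (auto simp: S_def field_simps)
      have "s (\<lambda>e. ?a e / s ?a) = s ?a / s ?a"
        using s by (simp add: s_def[of "\<lambda>e. ?a e / s ?a"] s_def[of ?a, symmetric] flip: sum_divide_distrib)
      then show "(\<lambda>e. ?a e / s ?a) \<in> {a. s a = 1}" using s by simp
    qed
    from a0(2)[OF this] have "N a0 \<le> norm ((1 / s ?a) *\<^sub>R (\<Sum>e\<in>E. ?a e *\<^sub>R e))"
      by (simp add: N_def scaleR_sum_right)
    also have "\<dots> = norm v / s ?a" using s rep by simp
    finally show ?thesis using s pos by (simp add: field_simps)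
  qed (use pos in simp)
  show ?thesis
  proof (rule bounded_linear_intro[where K = "(\<Sum>e\<in>E. \<bar>f e\<bar>) / N a0"])
    fix v
    let ?a = "representation E v"
    have rep: "(\<Sum>e\<in>E. ?a e *\<^sub>R e) = v"
      using E by (intro real_vector.sum_representation_eq) auto
    have "f (\<Sum>e\<in>E. ?a e *\<^sub>R e) = (\<Sum>e\<in>E. ?a e * f e)"
      by (simp add: linear_sum[OF f] linear_scale[OF f])
    then have "f v = (\<Sum>e\<in>E. ?a e * f e)" by (simp only: rep)
    then have "\<bar>f v\<bar> \<le> (\<Sum>e\<in>E. \<bar>?a e\<bar> * \<bar>f e\<bar>)"
      using sum_abs[of "\<lambda>e. ?a e * f e" E] by (simp add: abs_mult)
    also have "\<dots> \<le> (\<Sum>e\<in>E. s ?a * \<bar>f e\<bar>)"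
      using E(1) by (intro sum_mono mult_right_mono) (auto simp: s_def intro!: member_le_sum)
    also have "\<dots> \<le> norm v / N a0 * (\<Sum>e\<in>E. \<bar>f e\<bar>)"
      unfolding sum_distrib_left[symmetric] by (intro mult_right_mono bound sum_nonneg) auto
    finally show "norm (f v) \<le> norm v * ((\<Sum>e\<in>E. \<bar>f e\<bar>) / N a0)"
      by simp
  qed (use f in \<open>auto simp: linear_add linear_scale\<close>)
qed

lemma digits_unique:
  fixes d e :: "nat \<Rightarrow> nat"
  assumes "\<And>i. i < n \<Longrightarrow> d i < N" "\<And>i. i < n \<Longrightarrow> e i < N"
    and "(\<Sum>i<n. d i * N ^ i) = (\<Sum>i<n. e i * N ^ i)" and "i < n"
  shows "d i = e i"
  using assms
proof (induction n arbitrary: d e i)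
  case (Suc n)
  have split: "(\<Sum>i<Suc n. f i * N ^ i) = f 0 + N * (\<Sum>i<n. f (Suc i) * N ^ i)" for f :: "nat \<Rightarrow> nat"
    by (subst sum.lessThan_Suc_shift) (simp add: sum_distrib_left algebra_simps)
  have eq: "d 0 + N * (\<Sum>i<n. d (Suc i) * N ^ i) = e 0 + N * (\<Sum>i<n. e (Suc i) * N ^ i)" (is "?l = ?r")
    using Suc.prems(3) by (simp only: split)
  have "d 0 < N" "e 0 < N" using Suc.prems(1,2) by auto
  then have "d 0 = e 0" using arg_cong[OF eq, of "\<lambda>k. k mod N"] by simp
  moreover have "d (Suc j) = e (Suc j)" if "j < n" for j
  proof (rule Suc.IH[of "\<lambda>i. d (Suc i)" "\<lambda>i. e (Suc i)" j])
    show "(\<Sum>i<n. d (Suc i) * N ^ i) = (\<Sum>i<n. e (Suc i) * N ^ i)"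
      using eq \<open>d 0 = e 0\<close> \<open>d 0 < N\<close> by simp
  qed (use Suc.prems(1,2) that in simp_all)
  ultimately show ?case using Suc.prems(4) by (cases i) auto
qed simp

locale coordinate_space =
  fixes b :: "nat \<Rightarrow> 'v::real_normed_vector" and n :: nat
  assumes b_inj: "inj_on b {..<n}"
    and b_independent: "independent (b ` {..<n})"
    and b_span: "span (b ` {..<n}) = UNIV"
begin

definition coord :: "nat \<Rightarrow> 'v \<Rightarrow> real" where
  "coord i v = representation (b ` {..<n}) v (b i)"

lemma linear_coord [simp]: "linear (coord i)"
  unfolding coord_def
  by (rule linearI) (use b_independent b_span in \<open>auto simp: representation_add representation_scale\<close>)

lemma coord_expansion: "(\<Sum>i<n. coord i v *\<^sub>R b i) = v"
proof -
  have "(\<Sum>e\<in>b ` {..<n}. representation (b ` {..<n}) v e *\<^sub>R e) = v"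
    using b_independent b_span by (intro real_vector.sum_representation_eq) auto
  then show ?thesis
    by (simp add: sum.reindex[OF b_inj] coord_def)
qed

lemma coord_basis: "i < n \<Longrightarrow> j < n \<Longrightarrow> coord i (b j) = (if i = j then 1 else 0)"
  using b_independent b_inj by (auto simp: coord_def representation_basis inj_on_eq_iff)

lemma linear_real_polynomial: "linear f \<Longrightarrow> real_polynomial_function f" for f :: "'v \<Rightarrow> real"
  using bounded_linear_of_finite_basis[OF _ b_independent b_span]
  by (intro real_polynomial_function.intros(1)) auto

definition cov :: "('v \<Rightarrow> real) \<Rightarrow> 'v polyfun" where "cov = Polyfun"

lemma peval_cov [simp]: "linear \<alpha> \<Longrightarrow> peval (cov \<alpha>) = \<alpha>"
  by (simp add: cov_def peval_Polyfun linear_real_polynomial)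

definition X :: "nat \<Rightarrow> 'v polyfun" where "X i = cov (coord i)"

lemma peval_X [simp]: "peval (X i) = coord i"
  by (simp add: X_def)

lemma peval_monomial: "peval (prod_mset (image_mset X A)) v = (\<Prod>i\<in>#A. coord i v)"
  by (induction A) auto

lemma monomials_linearly_independent:
  assumes fin: "finite I" and I: "\<And>A. A \<in> I \<Longrightarrow> set_mset A \<subseteq> {..<n}"
    and zero: "(\<Sum>A\<in>I. c A *\<^sub>R prod_mset (image_mset X A)) = 0" and "A \<in> I"
  shows "c A = 0"
proof -
  define N where "N = Suc (Max (insert 0 (size ` I)))"
  define wt where "wt A = (\<Sum>i<n. count A i * N ^ i)" for A
  have count: "count A i < N" if "A \<in> I" for A i
  proof -
    have "count A i \<le> size A" by (simp add: count_le_size)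
    also have "size A \<le> Max (insert 0 (size ` I))" using that fin by (intro Max_ge) auto
    finally show ?thesis by (simp add: N_def)
  qed
  have wt_inj: "A = B" if "A \<in> I" "B \<in> I" "wt A = wt B" for A B
  proof (rule multiset_eqI)
    fix i
    show "count A i = count B i"
    proof (cases "i < n")
      case True
      then show ?thesis
        using that count digits_unique[of n "count A" N "count B" i] by (simp add: wt_def)
    next
      case False
      then have "i \<notin># A" "i \<notin># B" using I that by auto
      then show ?thesis by (simp add: not_in_iff)
    qed
  qed
  \<comment> \<open>Kronecker's substitution: on the curve whose i-th coordinate is t ^ (N ^ i), the exponent vector of
    a monomial is read as the base N expansion of the exponent of t.\<close>
  define \<gamma> where "\<gamma> t = (\<Sum>i<n. t ^ (N ^ i) *\<^sub>R b i)" for t :: real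
  have coord_\<gamma>: "coord i (\<gamma> t) = t ^ (N ^ i)" if "i < n" for i t
    using that unfolding \<gamma>_def
    by (simp add: linear_sum[OF linear_coord] linear_scale[OF linear_coord] coord_basis if_distrib cong: if_cong)
  have "(\<Prod>i\<in>#A. coord i (\<gamma> t)) = t ^ wt A" if A: "set_mset A \<subseteq> {..<n}" for A t
  proof -
    have "(\<Prod>i\<in>#A. coord i (\<gamma> t)) = (\<Prod>i\<in>set_mset A. coord i (\<gamma> t) ^ count A i)"
      by (rule image_prod_mset_multiplicity)
    also have "\<dots> = (\<Prod>i<n. coord i (\<gamma> t) ^ count A i)"
      using A by (intro prod.mono_neutral_left) (auto simp: not_in_iff)
    also have "\<dots> = t ^ wt A"
      by (simp add: coord_\<gamma> wt_def power_sum mult.commute flip: power_mult)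
    finally show ?thesis .
  qed
  then have "(\<Sum>A\<in>I. c A * t ^ wt A) = 0" for t
    using arg_cong[OF zero, of "\<lambda>f. peval f (\<gamma> t)"] I by (simp add: peval_monomial)
  then have "(\<Sum>A\<in>I. monom (c A) (wt A)) = 0"
    by (intro poly_all_0_iff_0[THEN iffD1]) (simp add: poly_sum poly_monom)
  then have "0 = coeff (\<Sum>A\<in>I. monom (c A) (wt A)) (wt A)" by simp
  also have "\<dots> = (\<Sum>B\<in>I. if B = A then c A else 0)"
    unfolding coeff_sum using wt_inj \<open>A \<in> I\<close> by (intro sum.cong) auto
  also have "\<dots> = c A" using fin \<open>A \<in> I\<close> by simp
  finally show ?thesis by simp
qed

sublocale polynomial_algebra X n
proof
  let ?m = "\<lambda>A. prod_mset (image_mset X A)" and ?I = "{A. set_mset A \<subseteq> {..<n}}"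
  show inj: "inj_on ?m ?I"
  proof (rule inj_onI, rule ccontr)
    fix A B assume "A \<in> ?I" "B \<in> ?I" "?m A = ?m B" "A \<noteq> B"
    then show False
      using monomials_linearly_independent[of "{A, B}" "\<lambda>C. if C = A then 1 else -1" A] by auto
  qed
  show "independent (?m ` ?I)"
    unfolding real_vector.dependent_explicit
  proof clarify
    fix t u f
    assume t: "finite t" "t \<subseteq> ?m ` ?I" "(\<Sum>v\<in>t. u v *\<^sub>R v) = 0" "f \<in> t" "u f \<noteq> 0"
    then obtain I where I: "I \<subseteq> ?I" "t = ?m ` I" by (meson subset_imageE)
    have inj': "inj_on ?m I" using inj I(1) by (rule inj_on_subset)
    then have "finite I" using t(1) I(2) finite_imageD by blast
    obtain A where A: "A \<in> I" "f = ?m A" using t(4) I(2) by blast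
    have "(\<Sum>A\<in>I. u (?m A) *\<^sub>R ?m A) = 0"
      using t(3) unfolding I(2) sum.reindex[OF inj'] by simp
    then have "u (?m A) = 0"
      using monomials_linearly_independent[of I "\<lambda>A. u (?m A)" A] \<open>finite I\<close> I(1) A(1) by auto
    with t(5) A(2) show False by simp
  qed
  show "span (?m ` ?I) = UNIV"
  proof -
    let ?S = "span (?m ` ?I)"
    have base: "?m A \<in> ?S" if "A \<in> ?I" for A using that by (intro span_base) auto
    have mult1: "?m A * f \<in> ?S" if A: "A \<in> ?I" and "f \<in> ?S" for A f
      using that(2)
    proof (induction rule: span_induct_alt)
      case base then show ?case by (simp add: span_zero)
    next
      case (step c f g)
      then obtain B where B: "B \<in> ?I" "f = ?m B" by blast
      have "?m A * f = ?m (A + B)" by (simp add: B)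
      then have "?m A * f \<in> ?S" using A B base[of "A + B"] by simp
      then show ?case using step by (simp add: distrib_left span_add span_scale)
    qed
    have mult': "f * g \<in> ?S" if "f \<in> ?S" "g \<in> ?S" for f g
      using that(1)
    proof (induction rule: span_induct_alt)
      case base then show ?case by (simp add: span_zero)
    next
      case (step c f h)
      then show ?case using mult1 that(2) by (auto simp: distrib_right intro!: span_add span_scale)
    qed
    have "real_polynomial_function f \<Longrightarrow> Polyfun f \<in> ?S" for f
    proof (induction rule: real_polynomial_function.induct)
      case (linear f)
      then have f: "linear f" by (simp add: bounded_linear.linear)
      have "Polyfun f = (\<Sum>i<n. f (b i) *\<^sub>R ?m {#i#})"
      proof (rule polyfun_eqI)
        fix v
        have "f v = f (\<Sum>i<n. coord i v *\<^sub>R b i)" by (simp add: coord_expansion)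
        then show "peval (Polyfun f) v = peval (\<Sum>i<n. f (b i) *\<^sub>R ?m {#i#}) v"
          using f by (simp add: peval_Polyfun linear_real_polynomial linear_sum linear_scale mult.commute)
      qed
      also have "\<dots> \<in> ?S" by (intro span_sum span_scale base) auto
      finally show ?case .
    next
      case (const c)
      have "Polyfun (\<lambda>v. c) = c *\<^sub>R ?m {#}"
        by (rule polyfun_eqI) (simp add: peval_Polyfun real_polynomial_function.intros)
      then show ?case using base[of "{#}"] by (simp add: span_scale)
    next
      case (add f g)
      have "Polyfun (\<lambda>v. f v + g v) = Polyfun f + Polyfun g"
        by (rule polyfun_eqI) (use add in \<open>simp add: peval_Polyfun real_polynomial_function.intros\<close>)
      then show ?case using add by (simp add: span_add)
    next
      case (mult f g)
      have "Polyfun (\<lambda>v. f v * g v) = Polyfun f * Polyfun g"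
        by (rule polyfun_eqI) (use mult in \<open>simp add: peval_Polyfun real_polynomial_function.intros\<close>)
      then show ?case using mult mult' by simp
    qed
    then have "f \<in> ?S" for f using real_polynomial_peval[of f] by (metis peval_inverse)
    then show ?thesis by blast
  qed
qed

end

section \<open>Linear functions of a covector\<close>

context coordinate_space
begin

definition covector_linear :: "(('v \<Rightarrow> real) \<Rightarrow> 'r::real_vector) \<Rightarrow> bool" where
  "covector_linear F \<longleftrightarrow> (\<forall>\<alpha> \<beta> c. linear \<alpha> \<longrightarrow> linear \<beta> \<longrightarrow> F (\<lambda>v. \<alpha> v + c * \<beta> v) = F \<alpha> + c *\<^sub>R F \<beta>)"

text \<open>
  A family Y indexed by the coordinates extends linearly to covectors; lin Y \<alpha> plays the role of the
  generator attached to \<alpha> and frees the relations from the choice of coordinates.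
\<close>

definition lin :: "(nat \<Rightarrow> 'r::real_vector) \<Rightarrow> ('v \<Rightarrow> real) \<Rightarrow> 'r" where
  "lin Y \<alpha> = (\<Sum>i<n. \<alpha> (b i) *\<^sub>R Y i)"

lemma covector_linear_lin [simp]: "covector_linear (lin Y)"
  by (simp add: covector_linear_def lin_def scaleR_add_left sum.distrib scaleR_sum_right)

lemma linear_covector_combination: "linear \<alpha> \<Longrightarrow> linear \<beta> \<Longrightarrow> linear (\<lambda>v. \<alpha> v + c * \<beta> v)"
  for \<alpha> \<beta> :: "'v \<Rightarrow> real"
  by (intro linear_compose_add linear_compose_scale_right[where 'b = real, unfolded real_scaleR_def])

lemma covector_expansion:
  assumes F: "covector_linear F" and \<alpha>: "linear \<alpha>"
  shows "F \<alpha> = lin (\<lambda>i. F (coord i)) \<alpha>"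
proof -
  have F0: "F (\<lambda>v. 0) = 0"
    using F[unfolded covector_linear_def, rule_format, of "\<lambda>v. 0" "\<lambda>v. 0" 1] by (simp add: linear_zero)
  have lin_sum: "linear (\<lambda>v. \<Sum>i<k. a i * coord i v)" for k a
    by (intro linear_compose_sum ballI linear_compose_scale_right[where 'b = real, unfolded real_scaleR_def]) simp
  have "F (\<lambda>v. \<Sum>i<k. a i * coord i v) = (\<Sum>i<k. a i *\<^sub>R F (coord i))" for k a
  proof (induction k)
    case (Suc k)
    then show ?case
      using F[unfolded covector_linear_def, rule_format, OF lin_sum[of a k] linear_coord[of k], of "a k"]
      by simp
  qed (simp add: F0)
  moreover have "(\<lambda>v. \<Sum>i<n. \<alpha> (b i) * coord i v) = \<alpha>"
  proof
    fix v
    have "\<alpha> v = \<alpha> (\<Sum>i<n. coord i v *\<^sub>R b i)" by (simp add: coord_expansion)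
    then show "(\<Sum>i<n. \<alpha> (b i) * coord i v) = \<alpha> v"
      by (simp add: linear_sum[OF \<alpha>] linear_scale[OF \<alpha>] mult.commute)
  qed
  ultimately show ?thesis unfolding lin_def by metis
qed

lemma covector_linear_eqI:
  assumes "covector_linear F" "covector_linear F'" "linear \<alpha>" "\<And>i. i < n \<Longrightarrow> F (coord i) = F' (coord i)"
  shows "F \<alpha> = F' \<alpha>"
  using assms(4) by (simp add: covector_expansion[OF assms(1,3)] covector_expansion[OF assms(2,3)] lin_def)

lemma lin_coord [simp]: "i < n \<Longrightarrow> lin Y (coord i) = Y i"
  by (simp add: lin_def coord_basis if_distrib[of "\<lambda>c. c *\<^sub>R _"] cong: if_cong)

lemma lin_cong: "(\<And>i. i < n \<Longrightarrow> Y i = Z i) \<Longrightarrow> lin Y \<alpha> = lin Z \<alpha>"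
  by (simp add: lin_def)

lemma fps_nth_lin: "fps_nth (lin Y \<alpha>) m = lin (\<lambda>i. fps_nth (Y i) m) \<alpha>"
  by (simp add: lin_def fps_sum_nth)

lemma covector_linear_cov: "covector_linear cov"
  unfolding covector_linear_def
  by (auto intro!: polyfun_eqI simp: linear_covector_combination)

lemma covector_linear_compose:
  "covector_linear F \<Longrightarrow> linear h \<Longrightarrow> covector_linear (\<lambda>\<alpha>. F (\<alpha> \<circ> h))"
  unfolding covector_linear_def o_def by (simp add: linear_compose[unfolded o_def])

lemma covector_linear_endo: "covector_linear F \<Longrightarrow> linear T \<Longrightarrow> covector_linear (\<lambda>\<alpha>. T (F \<alpha>))"
  unfolding covector_linear_def by (simp add: linear_add linear_scale)

end

section \<open>Deforming the coordinates order by order\<close>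

locale linear_group_action = coordinate_space b n + group G
  for b :: "nat \<Rightarrow> 'v::real_normed_vector" and n :: nat and G :: "('g, 'm) monoid_scheme" (structure) +
  fixes \<phi> :: "'g \<Rightarrow> 'v \<Rightarrow> 'v"
  assumes finite_carrier: "finite (carrier G)"
    and \<phi>_one: "\<phi> \<one> v = v"
    and \<phi>_mult: "g \<in> carrier G \<Longrightarrow> h \<in> carrier G \<Longrightarrow> \<phi> (g \<otimes> h) v = \<phi> g (\<phi> h v)"
    and \<phi>_linear: "g \<in> carrier G \<Longrightarrow> linear (\<phi> g)"
begin

lemma \<phi>_inv: "g \<in> carrier G \<Longrightarrow> \<phi> g (\<phi> (inv g) v) = v" "g \<in> carrier G \<Longrightarrow> \<phi> (inv g) (\<phi> g v) = v"
  using \<phi>_mult[of g "inv g" v] \<phi>_mult[of "inv g" g v] by (simp_all add: \<phi>_one)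

end

text \<open>
  The relations to be quantized say that the commutator of \<alpha> and \<beta> is the sum of all \<kappa> g \<alpha> \<beta> U g.
  Commuting \<gamma> past U g replaces it by its translate, so \<kappa>_Jacobi is the coefficient of U g in the Jacobi
  identity of three covectors.
\<close>

locale symplectic_reflection_data = linear_group_action b n G \<phi>
  for b :: "nat \<Rightarrow> 'v::real_normed_vector" and n :: nat and G :: "('g, 'm) monoid_scheme" (structure)
    and \<phi> :: "'g \<Rightarrow> 'v \<Rightarrow> 'v" +
  fixes \<kappa> :: "'g \<Rightarrow> ('v \<Rightarrow> real) \<Rightarrow> ('v \<Rightarrow> real) \<Rightarrow> real"
  assumes \<kappa>_linear: "g \<in> carrier G \<Longrightarrow> linear \<beta> \<Longrightarrow> covector_linear (\<lambda>\<alpha>. \<kappa> g \<alpha> \<beta>)"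
    and \<kappa>_antisym: "g \<in> carrier G \<Longrightarrow> linear \<alpha> \<Longrightarrow> linear \<beta> \<Longrightarrow> \<kappa> g \<beta> \<alpha> = - \<kappa> g \<alpha> \<beta>"
    and \<kappa>_invariant: "g \<in> carrier G \<Longrightarrow> h \<in> carrier G \<Longrightarrow> linear \<alpha> \<Longrightarrow> linear \<beta> \<Longrightarrow>
      \<kappa> (h \<otimes> g \<otimes> inv h) \<alpha> \<beta> = \<kappa> g (\<alpha> \<circ> \<phi> h) (\<beta> \<circ> \<phi> h)"
    and \<kappa>_Jacobi: "g \<in> carrier G \<Longrightarrow> linear \<alpha> \<Longrightarrow> linear \<beta> \<Longrightarrow> linear \<gamma> \<Longrightarrow>
      \<kappa> g \<beta> \<gamma> * (\<alpha> v - \<alpha> (\<phi> (inv g) v)) + \<kappa> g \<gamma> \<alpha> * (\<beta> v - \<beta> (\<phi> (inv g) v))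
      + \<kappa> g \<alpha> \<beta> * (\<gamma> v - \<gamma> (\<phi> (inv g) v)) = 0"
begin

lemma linear_comp_\<phi>: "g \<in> carrier G \<Longrightarrow> linear \<alpha> \<Longrightarrow> linear (\<alpha> \<circ> \<phi> g)" for \<alpha> :: "'v \<Rightarrow> real"
  using \<phi>_linear linear_compose by blast

lemma linear_comp_\<phi>': "g \<in> carrier G \<Longrightarrow> linear \<alpha> \<Longrightarrow> linear (\<lambda>v. \<alpha> (\<phi> g v))" for \<alpha> :: "'v \<Rightarrow> real"
  using linear_comp_\<phi>[of g \<alpha>] by (simp add: o_def)

lemma real_polynomial_\<phi>:
  assumes "g \<in> carrier G" "real_polynomial_function f"
  shows "real_polynomial_function (\<lambda>v. f (\<phi> g v))"
proof -
  have "polynomial_function (\<phi> g)"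
    unfolding polynomial_function_def
    using assms(1) by (auto intro!: linear_real_polynomial linear_comp_\<phi> simp: bounded_linear.linear)
  then show ?thesis
    using real_polynomial_function_compose[of "\<phi> g" f] assms(2) by (simp add: o_def)
qed

definition U :: "'g \<Rightarrow> 'v polyfun endo" where
  "U g = Endo (\<lambda>f. Polyfun (\<lambda>v. peval f (\<phi> (inv g) v)))"

lemma peval_U [simp]:
  assumes g: "g \<in> carrier G"
  shows "peval (app (U g) f) v = peval f (\<phi> (inv g) v)"
proof -
  let ?T = "\<lambda>f. Polyfun (\<lambda>v. peval f (\<phi> (inv g) v))"
  have T: "peval (?T f) v = peval f (\<phi> (inv g) v)" for f v
    using g by (subst peval_Polyfun) (auto intro: real_polynomial_\<phi>)
  have "linear ?T"
    by (rule linearI; rule polyfun_eqI; unfold T) (simp_all only: T peval_simps)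
  then show ?thesis by (simp add: U_def app_Endo T)
qed

lemma U_one [simp]: "U \<one> = 1"
  by (intro endo_eqI polyfun_eqI) (simp add: \<phi>_one)

lemma U_mult: "g \<in> carrier G \<Longrightarrow> h \<in> carrier G \<Longrightarrow> U g * U h = U (g \<otimes> h)"
  by (intro endo_eqI polyfun_eqI) (simp add: \<phi>_mult inv_mult_group)

lemma U_inv: "g \<in> carrier G \<Longrightarrow> U g * U (inv g) = 1" "g \<in> carrier G \<Longrightarrow> U (inv g) * U g = 1"
  by (simp_all add: U_mult)

lemma U_inv_left: "g \<in> carrier G \<Longrightarrow> U g * (U (inv g) * T) = T" "g \<in> carrier G \<Longrightarrow> U (inv g) * (U g * T) = T"
  by (simp_all add: U_inv flip: mult.assoc)

lemma U_mulop: "g \<in> carrier G \<Longrightarrow> U g * mulop f = mulop (app (U g) f) * U g"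
  by (intro endo_eqI polyfun_eqI) simp

lemma U_cov: "g \<in> carrier G \<Longrightarrow> linear \<alpha> \<Longrightarrow> app (U g) (cov \<alpha>) = cov (\<alpha> \<circ> \<phi> (inv g))"
  by (intro polyfun_eqI) (simp add: linear_comp_\<phi> linear_comp_\<phi>' o_def)

definition K :: "('v \<Rightarrow> real) \<Rightarrow> ('v \<Rightarrow> real) \<Rightarrow> 'v polyfun endo" where
  "K \<alpha> \<beta> = (\<Sum>g\<in>carrier G. \<kappa> g \<alpha> \<beta> *\<^sub>R U g)"

lemma K_linear: "linear \<beta> \<Longrightarrow> covector_linear (\<lambda>\<alpha>. K \<alpha> \<beta>)"
  using \<kappa>_linear unfolding covector_linear_def K_def
  by (simp add: sum.distrib scaleR_sum_right scaleR_add_left cong: sum.cong)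

lemma K_antisym:
  assumes "linear \<alpha>" "linear \<beta>" shows "K \<beta> \<alpha> = - K \<alpha> \<beta>"
proof -
  have "K \<beta> \<alpha> = (\<Sum>g\<in>carrier G. - (\<kappa> g \<alpha> \<beta> *\<^sub>R U g))"
    unfolding K_def by (intro sum.cong refl) (simp add: \<kappa>_antisym[OF _ assms])
  then show ?thesis by (simp add: K_def sum_negf)
qed

lemma K_equivariant:
  assumes g: "g \<in> carrier G" and \<alpha>: "linear \<alpha>" "linear \<beta>"
  shows "U g * K (\<alpha> \<circ> \<phi> g) (\<beta> \<circ> \<phi> g) = K \<alpha> \<beta> * U g"
proof -
  have "U g * K (\<alpha> \<circ> \<phi> g) (\<beta> \<circ> \<phi> g) = (\<Sum>h\<in>carrier G. \<kappa> h (\<alpha> \<circ> \<phi> g) (\<beta> \<circ> \<phi> g) *\<^sub>R (U g * U h))"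
    by (simp add: K_def sum_distrib_left)
  also have "\<dots> = (\<Sum>h\<in>carrier G. \<kappa> (g \<otimes> h \<otimes> inv g) \<alpha> \<beta> *\<^sub>R (U (g \<otimes> h \<otimes> inv g) * U g))"
  proof (intro sum.cong refl)
    fix h assume h: "h \<in> carrier G"
    then have "g \<otimes> h \<otimes> inv g \<otimes> g = g \<otimes> h" using g by (simp add: m_assoc)
    then show "\<kappa> h (\<alpha> \<circ> \<phi> g) (\<beta> \<circ> \<phi> g) *\<^sub>R (U g * U h) =
        \<kappa> (g \<otimes> h \<otimes> inv g) \<alpha> \<beta> *\<^sub>R (U (g \<otimes> h \<otimes> inv g) * U g)"
      using g h \<alpha> by (simp add: \<kappa>_invariant U_mult)
  qed
  also have "\<dots> = (\<Sum>h\<in>carrier G. \<kappa> h \<alpha> \<beta> *\<^sub>R (U h * U g))"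
  proof -
    have "g \<otimes> (inv g \<otimes> h) = h" "inv g \<otimes> (g \<otimes> h) = h" if "h \<in> carrier G" for h
      using g that by (simp_all flip: m_assoc)
    with g show ?thesis
      by (intro sum.reindex_bij_witness[where i = "\<lambda>h. inv g \<otimes> h \<otimes> g"
            and j = "\<lambda>h. g \<otimes> h \<otimes> inv g"]) (auto simp: m_assoc)
  qed
  finally show ?thesis by (simp add: K_def sum_distrib_right)
qed

abbreviation UU :: "'g \<Rightarrow> 'v polyfun endo fps" where "UU g \<equiv> fps_const (U g)"

definition defect :: "(nat \<Rightarrow> 'v polyfun endo fps) \<Rightarrow> ('v \<Rightarrow> real) \<Rightarrow> ('v \<Rightarrow> real) \<Rightarrow> 'v polyfun endo fps" where
  "defect Y \<alpha> \<beta> = comm (lin Y \<alpha>) (lin Y \<beta>) - fps_X * fps_const (K \<alpha> \<beta>)"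

definition equivariant :: "(nat \<Rightarrow> 'v polyfun endo fps) \<Rightarrow> bool" where
  "equivariant Y \<longleftrightarrow>
     (\<forall>g\<in>carrier G. \<forall>\<alpha>. linear \<alpha> \<longrightarrow> UU g * lin Y (\<alpha> \<circ> \<phi> g) = lin Y \<alpha> * UU g)"

lemma defect_linear: "linear \<beta> \<Longrightarrow> covector_linear (\<lambda>\<alpha>. defect Y \<alpha> \<beta>)"
proof -
  assume \<beta>: "linear \<beta>"
  have 1: "lin Y (\<lambda>v. \<alpha> v + c * \<alpha>' v) = lin Y \<alpha> + c *\<^sub>R lin Y \<alpha>'" if "linear \<alpha>" "linear \<alpha>'" for \<alpha> \<alpha>' c
    using covector_linear_lin that unfolding covector_linear_def by blast
  have 2: "K (\<lambda>v. \<alpha> v + c * \<alpha>' v) \<beta> = K \<alpha> \<beta> + c *\<^sub>R K \<alpha>' \<beta>" if "linear \<alpha>" "linear \<alpha>'" for \<alpha> \<alpha>' c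
    using K_linear[OF \<beta>] that unfolding covector_linear_def by blast
  show ?thesis
    unfolding covector_linear_def defect_def comm_def
    by (simp add: 1 2 fps_const_scaleR algebra_simps flip: fps_const_add)
qed

lemma defect_antisym: "linear \<alpha> \<Longrightarrow> linear \<beta> \<Longrightarrow> defect Y \<beta> \<alpha> = - defect Y \<alpha> \<beta>"
  unfolding defect_def comm_def using K_antisym[of \<alpha> \<beta>]
  by (simp flip: fps_const_neg)

lemma equivariant_defect:
  assumes Y: "equivariant Y" and g: "g \<in> carrier G" and \<alpha>: "linear \<alpha>" "linear \<beta>"
  shows "UU g * defect Y (\<alpha> \<circ> \<phi> g) (\<beta> \<circ> \<phi> g) = defect Y \<alpha> \<beta> * UU g"
proof -
  have 1: "UU g * lin Y (\<gamma> \<circ> \<phi> g) = lin Y \<gamma> * UU g" if "linear \<gamma>" for \<gamma>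
    using Y g that by (simp add: equivariant_def)
  have 2: "UU g * (lin Y (\<gamma> \<circ> \<phi> g) * F) = lin Y \<gamma> * (UU g * F)" if "linear \<gamma>" for \<gamma> F
    using 1[OF that] by (simp flip: mult.assoc)
  have 3: "UU g * (fps_X * F) = fps_X * (UU g * F)" for F
    using arg_cong[OF fps_mult_fps_X_commute[of "UU g"], of "\<lambda>Z. Z * F"] by (simp only: mult.assoc)
  show ?thesis
    using \<alpha> K_equivariant[OF g \<alpha>]
    by (simp add: defect_def comm_def right_diff_distrib left_diff_distrib mult.assoc 1 2 3)
qed

text \<open>
  The commutators satisfy the Jacobi identity in any ring; the correction terms K satisfy it because
  equivariance turns the commutator with U g into the difference of a generator and its translate,
  which is where \<kappa>_Jacobi enters.
\<close>

lemma defect_Jacobi: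
  assumes Y: "equivariant Y" and lin: "linear \<alpha>" "linear \<beta>" "linear \<gamma>"
  shows "comm (lin Y \<gamma>) (defect Y \<alpha> \<beta>) + comm (lin Y \<alpha>) (defect Y \<beta> \<gamma>) + comm (lin Y \<beta>) (defect Y \<gamma> \<alpha>) = 0"
proof -
  have K1: "comm (lin Y \<alpha>) (fps_const (K \<beta> \<gamma>)) =
      (\<Sum>g\<in>carrier G. lin Y (\<lambda>v. \<kappa> g \<beta> \<gamma> * (\<alpha> v - \<alpha> (\<phi> (inv g) v))) * UU g)"
    if \<alpha>: "linear \<alpha>" for \<alpha> \<beta> \<gamma>
  proof -
    have "lin Y \<alpha> * UU g - UU g * lin Y \<alpha> = lin Y (\<lambda>v. \<alpha> v - \<alpha> (\<phi> (inv g) v)) * UU g"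
      if g: "g \<in> carrier G" for g
    proof -
      have "\<alpha> \<circ> \<phi> (inv g) \<circ> \<phi> g = \<alpha>" using g by (auto simp: \<phi>_inv)
      then have "UU g * lin Y \<alpha> = lin Y (\<alpha> \<circ> \<phi> (inv g)) * UU g"
        using Y g \<alpha> linear_comp_\<phi>[of "inv g" \<alpha>]
        unfolding equivariant_def by (metis inv_closed)
      then show ?thesis
        by (simp add: lin_def scaleR_diff_left sum_subtractf left_diff_distrib)
    qed
    moreover have "lin Y (\<lambda>v. c * \<delta> v) = c *\<^sub>R lin Y \<delta>" for c \<delta>
      by (simp add: lin_def scaleR_sum_right)
    ultimately show ?thesis
      by (simp add: comm_def K_def fps_const_sum fps_const_scaleR sum_distrib_left sum_distrib_right
          flip: sum_subtractf scaleR_diff_right)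
  qed
  have X: "comm F (fps_X * H) = fps_X * comm F H" for F H :: "'v polyfun endo fps"
    by (simp add: comm_def right_diff_distrib fps_mult_fps_X_commute mult.assoc[symmetric])
       (simp add: fps_mult_fps_X_commute mult.assoc)
  have diff: "comm a (b - c) = comm a b - comm a c" for a b c :: "'v polyfun endo fps"
    by (simp add: comm_def algebra_simps)
  have add: "lin Y \<delta> + lin Y \<epsilon> = lin Y (\<lambda>v. \<delta> v + \<epsilon> v)" for \<delta> \<epsilon>
    by (simp add: lin_def scaleR_add_left sum.distrib)
  have "comm (lin Y \<alpha>) (fps_const (K \<beta> \<gamma>)) + comm (lin Y \<beta>) (fps_const (K \<gamma> \<alpha>))
      + comm (lin Y \<gamma>) (fps_const (K \<alpha> \<beta>)) =
      (\<Sum>g\<in>carrier G. lin Y (\<lambda>v. \<kappa> g \<beta> \<gamma> * (\<alpha> v - \<alpha> (\<phi> (inv g) v))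
        + \<kappa> g \<gamma> \<alpha> * (\<beta> v - \<beta> (\<phi> (inv g) v))
        + \<kappa> g \<alpha> \<beta> * (\<gamma> v - \<gamma> (\<phi> (inv g) v))) * UU g)"
    by (simp add: K1 lin add flip: sum.distrib distrib_right)
  also have "\<dots> = 0"
    by (intro sum.neutral ballI) (simp add: \<kappa>_Jacobi lin, simp add: lin_def)
  finally have "comm (lin Y \<alpha>) (fps_const (K \<beta> \<gamma>)) + comm (lin Y \<beta>) (fps_const (K \<gamma> \<alpha>))
      + comm (lin Y \<gamma>) (fps_const (K \<alpha> \<beta>)) = 0" .
  then have "fps_X * comm (lin Y \<alpha>) (fps_const (K \<beta> \<gamma>)) + fps_X * comm (lin Y \<beta>) (fps_const (K \<gamma> \<alpha>))
      + fps_X * comm (lin Y \<gamma>) (fps_const (K \<alpha> \<beta>)) = 0"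
    by (metis distrib_left mult_zero_right)
  moreover have "comm (lin Y \<gamma>) (defect Y \<alpha> \<beta>) + comm (lin Y \<alpha>) (defect Y \<beta> \<gamma>) + comm (lin Y \<beta>) (defect Y \<gamma> \<alpha>) =
      (comm (lin Y \<alpha>) (comm (lin Y \<beta>) (lin Y \<gamma>)) + comm (lin Y \<beta>) (comm (lin Y \<gamma>) (lin Y \<alpha>))
        + comm (lin Y \<gamma>) (comm (lin Y \<alpha>) (lin Y \<beta>)))
      - (fps_X * comm (lin Y \<alpha>) (fps_const (K \<beta> \<gamma>)) + fps_X * comm (lin Y \<beta>) (fps_const (K \<gamma> \<alpha>))
        + fps_X * comm (lin Y \<gamma>) (fps_const (K \<alpha> \<beta>)))"
    unfolding defect_def diff X by simp
  ultimately show ?thesis by (simp only: comm_Jacobi diff_self)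
qed

text \<open>
  The Koszul equation is linear and both sides are equivariant, so conjugating a solution by all group
  elements and averaging gives an equivariant solution.
\<close>

lemma average_over_group:
  assumes \<theta>: "\<forall>i<n. \<forall>j<n. comm (mulop (X i)) (\<theta> j) - comm (mulop (X j)) (\<theta> i) = \<Omega> (coord i) (coord j)"
    and \<Omega>_linear: "\<And>\<beta>. linear \<beta> \<Longrightarrow> covector_linear (\<lambda>\<alpha>. \<Omega> \<alpha> \<beta>)"
    and \<Omega>_antisym: "\<And>\<alpha> \<beta>. linear \<alpha> \<Longrightarrow> linear \<beta> \<Longrightarrow> \<Omega> \<beta> \<alpha> = - \<Omega> \<alpha> \<beta>"
    and \<Omega>_equivariant: "\<And>g \<alpha> \<beta>. g \<in> carrier G \<Longrightarrow> linear \<alpha> \<Longrightarrow> linear \<beta> \<Longrightarrow>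
      U g * \<Omega> (\<alpha> \<circ> \<phi> g) (\<beta> \<circ> \<phi> g) = \<Omega> \<alpha> \<beta> * U g"
  shows "\<exists>\<theta>. (\<forall>\<alpha> \<beta>. linear \<alpha> \<longrightarrow> linear \<beta> \<longrightarrow>
       comm (mulop (cov \<alpha>)) (lin \<theta> \<beta>) - comm (mulop (cov \<beta>)) (lin \<theta> \<alpha>) = \<Omega> \<alpha> \<beta>) \<and>
     (\<forall>g\<in>carrier G. \<forall>\<alpha>. linear \<alpha> \<longrightarrow> U g * lin \<theta> (\<alpha> \<circ> \<phi> g) = lin \<theta> \<alpha> * U g)"
proof -
  define D where "D \<theta> \<alpha> \<beta> = comm (mulop (cov \<alpha>)) (lin \<theta> \<beta>) - comm (mulop (cov \<beta>)) (lin \<theta> \<alpha>)"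
    for \<theta> and \<alpha> \<beta> :: "'v \<Rightarrow> real"
  have D_linear: "covector_linear (\<lambda>\<alpha>. D \<theta> \<alpha> \<beta>)" if "linear \<beta>" for \<beta> \<theta>
  proof -
    have 1: "lin \<theta> (\<lambda>v. \<alpha> v + c * \<alpha>' v) = lin \<theta> \<alpha> + c *\<^sub>R lin \<theta> \<alpha>'"
      "cov (\<lambda>v. \<alpha> v + c * \<alpha>' v) = cov \<alpha> + c *\<^sub>R cov \<alpha>'" if "linear \<alpha>" "linear \<alpha>'" for \<alpha> \<alpha>' c
      using covector_linear_lin[of \<theta>] covector_linear_cov that unfolding covector_linear_def by blast+
    show ?thesis
      unfolding D_def covector_linear_def comm_def
      by (simp add: 1 mulop_simps algebra_simps)
  qed
  have D_antisym: "D \<theta> \<beta> \<alpha> = - D \<theta> \<alpha> \<beta>" for \<theta> \<alpha> \<beta>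
    by (simp add: D_def)
  have 1: "D \<theta> \<alpha> (coord j) = \<Omega> \<alpha> (coord j)" if "linear \<alpha>" "j < n" for \<alpha> j
  proof (rule covector_linear_eqI[where F = "\<lambda>\<alpha>. D \<theta> \<alpha> (coord j)" and F' = "\<lambda>\<alpha>. \<Omega> \<alpha> (coord j)"])
    show "D \<theta> (coord i) (coord j) = \<Omega> (coord i) (coord j)" if "i < n" for i
      using that \<open>j < n\<close> \<theta>[rule_format, of i j] by (simp add: D_def X_def)
  qed (use that in \<open>simp_all add: D_linear \<Omega>_linear\<close>)
  have D: "D \<theta> \<alpha> \<beta> = \<Omega> \<alpha> \<beta>" if "linear \<alpha>" "linear \<beta>" for \<alpha> \<beta>
  proof -
    have "D \<theta> \<beta> \<alpha> = \<Omega> \<beta> \<alpha>"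
    proof (rule covector_linear_eqI[where F = "\<lambda>\<beta>. D \<theta> \<beta> \<alpha>" and F' = "\<lambda>\<beta>. \<Omega> \<beta> \<alpha>"])
      show "D \<theta> (coord i) \<alpha> = \<Omega> (coord i) \<alpha>" if "i < n" for i
        using 1[OF \<open>linear \<alpha>\<close> that] D_antisym[of \<theta> "coord i" \<alpha>] \<Omega>_antisym[OF \<open>linear \<alpha>\<close> linear_coord[of i]]
        by simp
    qed (use that in \<open>simp_all add: D_linear \<Omega>_linear\<close>)
    then show ?thesis using D_antisym[of \<theta> \<alpha> \<beta>] \<Omega>_antisym[OF that] by simp
  qed
  define \<theta>' where "\<theta>' i = (1 / card (carrier G)) *\<^sub>R
    (\<Sum>g\<in>carrier G. U g * lin \<theta> (coord i \<circ> \<phi> g) * U (inv g))" for i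
  have card: "card (carrier G) \<noteq> 0" using finite_carrier by auto
  have \<theta>': "lin \<theta>' \<alpha> = (1 / card (carrier G)) *\<^sub>R (\<Sum>g\<in>carrier G. U g * lin \<theta> (\<alpha> \<circ> \<phi> g) * U (inv g))"
    if \<alpha>: "linear \<alpha>" for \<alpha>
  proof (rule covector_linear_eqI[OF covector_linear_lin _ \<alpha>])
    have "lin \<theta> ((\<lambda>v. \<alpha> v + c * \<beta> v) \<circ> \<phi> g) = lin \<theta> (\<alpha> \<circ> \<phi> g) + c *\<^sub>R lin \<theta> (\<beta> \<circ> \<phi> g)"
      if "g \<in> carrier G" "linear \<alpha>" "linear \<beta>" for g \<alpha> \<beta> c
      using covector_linear_compose[OF covector_linear_lin[of \<theta>] \<phi>_linear[OF that(1)]] that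
      unfolding covector_linear_def by blast
    then show "covector_linear (\<lambda>\<alpha>. (1 / card (carrier G)) *\<^sub>R
        (\<Sum>g\<in>carrier G. U g * lin \<theta> (\<alpha> \<circ> \<phi> g) * U (inv g)))"
      unfolding covector_linear_def
      by (auto simp: distrib_left distrib_right sum.distrib scaleR_add_right scaleR_sum_right mult.commute cong: sum.cong)
  qed (simp add: \<theta>'_def o_def)
  have "D \<theta>' \<alpha> \<beta> = \<Omega> \<alpha> \<beta>" if \<alpha>: "linear \<alpha>" "linear \<beta>" for \<alpha> \<beta>
  proof -
    have comm_U: "comm (mulop (cov \<alpha>)) (U g * T * U (inv g)) = U g * comm (mulop (cov (\<alpha> \<circ> \<phi> g))) T * U (inv g)"
      if g: "g \<in> carrier G" and \<alpha>: "linear \<alpha>" for \<alpha> g T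
    proof -
      have "\<alpha> \<circ> \<phi> g \<circ> \<phi> (inv g) = \<alpha>" using g by (auto simp: \<phi>_inv)
      then have 1: "U g * mulop (cov (\<alpha> \<circ> \<phi> g)) = mulop (cov \<alpha>) * U g"
        using g \<alpha> by (simp add: U_mulop U_cov linear_comp_\<phi>)
      then have "U (inv g) * (U g * mulop (cov (\<alpha> \<circ> \<phi> g))) * U (inv g)
          = U (inv g) * (mulop (cov \<alpha>) * U g) * U (inv g)" by simp
      then have 2: "mulop (cov (\<alpha> \<circ> \<phi> g)) * U (inv g) = U (inv g) * mulop (cov \<alpha>)"
        using g by (simp add: U_inv U_inv_left mult.assoc)
      have "mulop (cov \<alpha>) * (U g * T * U (inv g)) = (U g * mulop (cov (\<alpha> \<circ> \<phi> g))) * T * U (inv g)"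
        unfolding 1 by (simp add: mult.assoc)
      moreover have "(U g * T * U (inv g)) * mulop (cov \<alpha>) = U g * T * (mulop (cov (\<alpha> \<circ> \<phi> g)) * U (inv g))"
        unfolding 2 by (simp add: mult.assoc)
      ultimately show ?thesis
        by (simp add: comm_def right_diff_distrib left_diff_distrib mult.assoc)
    qed
    have comm_sum: "comm a (c *\<^sub>R sum f A) = c *\<^sub>R (\<Sum>g\<in>A. comm a (f g))" for a :: "'v polyfun endo" and c f and A :: "'g set"
      by (simp add: comm_def sum_distrib_left sum_distrib_right sum_subtractf scaleR_diff_right)
    have "D \<theta>' \<alpha> \<beta> = (1 / card (carrier G)) *\<^sub>R
        (\<Sum>g\<in>carrier G. U g * D \<theta> (\<alpha> \<circ> \<phi> g) (\<beta> \<circ> \<phi> g) * U (inv g))"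
      by (simp add: D_def \<theta>' \<alpha> comm_sum comm_U right_diff_distrib left_diff_distrib sum_subtractf scaleR_diff_right
          cong: sum.cong)
    also have "\<dots> = (1 / card (carrier G)) *\<^sub>R (\<Sum>g\<in>carrier G. \<Omega> \<alpha> \<beta>)"
      using \<alpha> by (intro arg_cong[where f = "scaleR _"] sum.cong)
        (auto simp: D linear_comp_\<phi> \<Omega>_equivariant mult.assoc U_inv)
    also have "\<dots> = \<Omega> \<alpha> \<beta>" using card by (simp add: sum_constant_scaleR del: sum_constant)
    finally show ?thesis .
  qed
  moreover have "U g * lin \<theta>' (\<alpha> \<circ> \<phi> g) = lin \<theta>' \<alpha> * U g" if g: "g \<in> carrier G" and \<alpha>: "linear \<alpha>" for g \<alpha>
  proof -
    have "(\<Sum>h\<in>carrier G. U g * (U h * lin \<theta> (\<alpha> \<circ> \<phi> g \<circ> \<phi> h) * U (inv h))) =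
        (\<Sum>h\<in>carrier G. U h * lin \<theta> (\<alpha> \<circ> \<phi> h) * U (inv h) * U g)"
    proof (rule sum.reindex_bij_witness[where i = "\<lambda>h. inv g \<otimes> h" and j = "\<lambda>h. g \<otimes> h"])
      fix h assume h: "h \<in> carrier G"
      show "inv g \<otimes> (g \<otimes> h) = h" "g \<otimes> (inv g \<otimes> h) = h"
        using g h by (simp_all flip: m_assoc)
      have "\<alpha> \<circ> \<phi> g \<circ> \<phi> h = \<alpha> \<circ> \<phi> (g \<otimes> h)" using g h by (auto simp: \<phi>_mult)
      then show "U (g \<otimes> h) * lin \<theta> (\<alpha> \<circ> \<phi> (g \<otimes> h)) * U (inv (g \<otimes> h)) * U g =
          U g * (U h * lin \<theta> (\<alpha> \<circ> \<phi> g \<circ> \<phi> h) * U (inv h))"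
        using g h by (simp add: inv_mult_group mult.assoc U_inv flip: U_mult)
    qed (use g in auto)
    then show ?thesis
      using g \<alpha> by (simp add: \<theta>' linear_comp_\<phi> sum_distrib_left sum_distrib_right)
  qed
  ultimately show ?thesis unfolding D_def by blast
qed

lemma fps_mult_nth_zeros:
  fixes F Z :: "'r::ring_1 fps"
  assumes "\<And>m. m < N \<Longrightarrow> fps_nth Z m = 0"
  shows "fps_nth (F * Z) N = fps_nth F 0 * fps_nth Z N"
    and "fps_nth (Z * F) N = fps_nth Z N * fps_nth F 0"
proof -
  have "fps_nth (F * Z) N = (\<Sum>i\<in>{0..N}. if i = 0 then fps_nth F 0 * fps_nth Z N else 0)"
    unfolding fps_mult_nth using assms by (intro sum.cong) auto
  then show "fps_nth (F * Z) N = fps_nth F 0 * fps_nth Z N" by simp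
  have "fps_nth (Z * F) N = (\<Sum>i\<in>{0..N}. if i = N then fps_nth Z N * fps_nth F 0 else 0)"
    unfolding fps_mult_nth using assms by (intro sum.cong) auto
  then show "fps_nth (Z * F) N = fps_nth Z N * fps_nth F 0" by simp
qed

definition solves_up_to :: "nat \<Rightarrow> (nat \<Rightarrow> 'v polyfun endo fps) \<Rightarrow> bool" where
  "solves_up_to k Y \<longleftrightarrow> (\<forall>i<n. fps_nth (Y i) 0 = mulop (X i)) \<and> equivariant Y \<and>
     (\<forall>\<alpha> \<beta>. linear \<alpha> \<longrightarrow> linear \<beta> \<longrightarrow> (\<forall>m\<le>k. fps_nth (defect Y \<alpha> \<beta>) m = 0))"

lemma mulop_cov: "linear \<alpha> \<Longrightarrow> mulop (cov \<alpha>) = lin (\<lambda>i. mulop (X i)) \<alpha>"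
  unfolding X_def
  by (rule covector_expansion[OF covector_linear_endo[OF covector_linear_cov linear_mulop]])

lemma lin_nth_0:
  assumes "\<forall>i<n. fps_nth (Y i) 0 = mulop (X i)" "linear \<alpha>"
  shows "fps_nth (lin Y \<alpha>) 0 = mulop (cov \<alpha>)"
  using assms by (simp add: fps_nth_lin mulop_cov cong: lin_cong)

lemma solves_up_to_0: "solves_up_to 0 (\<lambda>i. fps_const (mulop (X i)))"
proof -
  have lin: "lin (\<lambda>i. fps_const (mulop (X i))) \<alpha> = fps_const (mulop (cov \<alpha>))" if "linear \<alpha>" for \<alpha>
    using that by (simp add: mulop_cov) (simp add: lin_def fps_const_sum fps_const_scaleR)
  have "U g * mulop (cov (\<alpha> \<circ> \<phi> g)) = mulop (cov \<alpha>) * U g" if "g \<in> carrier G" "linear \<alpha>" for g \<alpha>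
  proof -
    have "\<alpha> \<circ> \<phi> g \<circ> \<phi> (inv g) = \<alpha>" using that by (auto simp: \<phi>_inv)
    then show ?thesis using that by (simp add: U_mulop U_cov linear_comp_\<phi>)
  qed
  then show ?thesis
    by (auto simp: solves_up_to_def equivariant_def lin linear_comp_\<phi> defect_def comm_def fps_mult_fps_X_commute
        simp flip: mulop_simps(2) intro!: arg_cong[where f = fps_const] simp: mult.commute)
qed

text \<open>
  The lowest nonzero coefficient of the defect is the obstruction to the next order. Only the
  constant terms of the generators meet it in the Jacobi identity, which therefore says that it is
  Koszul closed; adding a potential in the next order removes it.
\<close>

lemma solves_up_to_Suc:
  assumes Y: "solves_up_to k Y"
  shows "\<exists>Y'. solves_up_to (Suc k) Y' \<and> (\<forall>i<n. \<forall>m\<le>k. fps_nth (Y' i) m = fps_nth (Y i) m)"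
proof -
  have Y0: "\<forall>i<n. fps_nth (Y i) 0 = mulop (X i)" and eqv: "equivariant Y"
    and zero: "\<And>\<alpha> \<beta> m. linear \<alpha> \<Longrightarrow> linear \<beta> \<Longrightarrow> m \<le> k \<Longrightarrow> fps_nth (defect Y \<alpha> \<beta>) m = 0"
    using Y by (auto simp: solves_up_to_def)
  define \<Omega> where "\<Omega> \<alpha> \<beta> = - fps_nth (defect Y \<alpha> \<beta>) (Suc k)" for \<alpha> \<beta>
  have lin0: "fps_nth (lin Y \<alpha>) 0 = mulop (cov \<alpha>)" if "linear \<alpha>" for \<alpha>
    using lin_nth_0[OF Y0 that] .
  have comm_nth: "fps_nth (comm (lin Y \<gamma>) (defect Y \<alpha> \<beta>)) (Suc k) = - comm (mulop (cov \<gamma>)) (\<Omega> \<alpha> \<beta>)"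
    if "linear \<alpha>" "linear \<beta>" "linear \<gamma>" for \<alpha> \<beta> \<gamma>
    using that zero by (simp add: comm_def fps_mult_nth_zeros lin0 \<Omega>_def)
  have closed: "comm (mulop (cov \<gamma>)) (\<Omega> \<alpha> \<beta>) + comm (mulop (cov \<alpha>)) (\<Omega> \<beta> \<gamma>) + comm (mulop (cov \<beta>)) (\<Omega> \<gamma> \<alpha>) = 0"
    if "linear \<alpha>" "linear \<beta>" "linear \<gamma>" for \<alpha> \<beta> \<gamma>
    using arg_cong[OF defect_Jacobi[OF eqv that], of "\<lambda>F. fps_nth F (Suc k)"]
    unfolding fps_add_nth comm_nth[OF that] comm_nth[OF that(2,3,1)] comm_nth[OF that(3,1,2)] fps_zero_nth
    unfolding minus_add_distrib[symmetric] neg_equal_0_iff_equal .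
  have \<Omega>_antisym: "\<Omega> \<beta> \<alpha> = - \<Omega> \<alpha> \<beta>" if "linear \<alpha>" "linear \<beta>" for \<alpha> \<beta>
    by (simp add: \<Omega>_def defect_antisym[OF that])
  have \<Omega>_linear: "covector_linear (\<lambda>\<alpha>. \<Omega> \<alpha> \<beta>)" if "linear \<beta>" for \<beta>
    using defect_linear[OF that, of Y] unfolding covector_linear_def \<Omega>_def by simp
  have \<Omega>_equivariant: "U g * \<Omega> (\<alpha> \<circ> \<phi> g) (\<beta> \<circ> \<phi> g) = \<Omega> \<alpha> \<beta> * U g"
    if "g \<in> carrier G" "linear \<alpha>" "linear \<beta>" for g \<alpha> \<beta>
    using arg_cong[OF equivariant_defect[OF eqv that], of "\<lambda>F. fps_nth F (Suc k)"] by (simp add: \<Omega>_def)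
  have "\<exists>\<theta>. \<forall>i<n. \<forall>j<n. comm (mulop (X i)) (\<theta> j) - comm (mulop (X j)) (\<theta> i) = \<Omega> (coord i) (coord j)"
  proof (rule poincare_endo)
    show "\<Omega> (coord j) (coord i) = - \<Omega> (coord i) (coord j)" for i j
      by (rule \<Omega>_antisym) simp_all
    show "comm (mulop (X l)) (\<Omega> (coord i) (coord j)) + comm (mulop (X i)) (\<Omega> (coord j) (coord l))
        + comm (mulop (X j)) (\<Omega> (coord l) (coord i)) = 0" for i j l
      unfolding X_def by (rule closed) simp_all
  qed
  then obtain \<theta>\<^sub>0 where "\<forall>i<n. \<forall>j<n. comm (mulop (X i)) (\<theta>\<^sub>0 j) - comm (mulop (X j)) (\<theta>\<^sub>0 i) = \<Omega> (coord i) (coord j)"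
    by blast
  from average_over_group[OF this \<Omega>_linear \<Omega>_antisym \<Omega>_equivariant]
  obtain \<theta> where \<theta>: "\<And>\<alpha> \<beta>. linear \<alpha> \<Longrightarrow> linear \<beta> \<Longrightarrow>
       comm (mulop (cov \<alpha>)) (lin \<theta> \<beta>) - comm (mulop (cov \<beta>)) (lin \<theta> \<alpha>) = \<Omega> \<alpha> \<beta>"
     "\<And>g \<alpha>. g \<in> carrier G \<Longrightarrow> linear \<alpha> \<Longrightarrow> U g * lin \<theta> (\<alpha> \<circ> \<phi> g) = lin \<theta> \<alpha> * U g"
    by blast
  define H where "H = (fps_X ^ Suc k :: 'v polyfun endo fps)"
  have H_comm: "F * H = H * F" for F
    unfolding H_def by (simp only: fps_mult_fps_X_power_commute)
  have H_left: "F * (H * F') = H * (F * F')" for F F'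
    using arg_cong[OF H_comm[of F], of "\<lambda>F. F * F'"] by (simp only: mult.assoc)
  have H_nth: "fps_nth (H * F) m = (if m < Suc k then 0 else fps_nth F (m - Suc k))" for F m
    unfolding H_def by (rule fps_X_power_mult_nth)
  have H_0: "fps_nth H 0 = 0" by (simp add: H_def)
  have H_expand: "comm (p + H * P) (q + H * Q) - R =
      comm p q - R + H * (comm p Q - comm q P + H * comm P Q)" for p P q Q R
    by (simp add: comm_def distrib_left distrib_right right_diff_distrib mult.assoc
        H_left[of p] H_left[of q] H_left[of P] H_left[of Q])
  define Y' where "Y' i = Y i + H * fps_const (\<theta> i)" for i
  have lin': "lin Y' \<alpha> = lin Y \<alpha> + H * fps_const (lin \<theta> \<alpha>)" for \<alpha>
    by (simp add: Y'_def lin_def scaleR_add_right sum.distrib fps_const_sum fps_const_scaleR sum_distrib_left)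
  have "equivariant Y'"
    using eqv \<theta>(2) by (simp add: equivariant_def lin' distrib_left distrib_right H_left mult.assoc)
  moreover have "\<forall>i<n. fps_nth (Y' i) 0 = mulop (X i)"
    using Y0 by (simp add: Y'_def H_0)
  moreover have "fps_nth (defect Y' \<alpha> \<beta>) m = 0" if lin: "linear \<alpha>" "linear \<beta>" and m: "m \<le> Suc k" for \<alpha> \<beta> m
  proof -
    have "defect Y' \<alpha> \<beta> = defect Y \<alpha> \<beta> + H * (comm (lin Y \<alpha>) (fps_const (lin \<theta> \<beta>))
        - comm (lin Y \<beta>) (fps_const (lin \<theta> \<alpha>)) + H * comm (fps_const (lin \<theta> \<alpha>)) (fps_const (lin \<theta> \<beta>)))"
      by (simp only: defect_def lin' H_expand)
    then have "fps_nth (defect Y' \<alpha> \<beta>) m = fps_nth (defect Y \<alpha> \<beta>) m + (if m = Suc k then \<Omega> \<alpha> \<beta> else 0)"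
      using m \<theta>(1)[OF lin] by (simp add: H_nth H_0 comm_def lin0 lin)
    then show ?thesis using zero[OF lin, of m] m by (cases "m = Suc k") (auto simp: \<Omega>_def)
  qed
  ultimately have "solves_up_to (Suc k) Y'" by (simp add: solves_up_to_def)
  moreover have "fps_nth (Y' i) m = fps_nth (Y i) m" if "m \<le> k" for i m
    using that by (auto simp: Y'_def H_def)
  ultimately show ?thesis by blast
qed

theorem deformed_coordinates_exist:
  "\<exists>Y. (\<forall>i<n. fps_nth (Y i) 0 = mulop (X i)) \<and> equivariant Y \<and>
     (\<forall>\<alpha> \<beta>. linear \<alpha> \<longrightarrow> linear \<beta> \<longrightarrow> comm (lin Y \<alpha>) (lin Y \<beta>) = fps_X * fps_const (K \<alpha> \<beta>))"
proof -
  obtain S where S: "\<And>k. solves_up_to k (S k)"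
    and agree: "\<And>k i m. i < n \<Longrightarrow> m \<le> k \<Longrightarrow> fps_nth (S (Suc k) i) m = fps_nth (S k i) m"
    using dependent_nat_choice[of solves_up_to "\<lambda>k Y Y'. \<forall>i<n. \<forall>m\<le>k. fps_nth (Y' i) m = fps_nth (Y i) m"]
      solves_up_to_0 solves_up_to_Suc by metis
  define Y where "Y i = Abs_fps (\<lambda>m. fps_nth (S m i) m)" for i
  have S_add: "fps_nth (S (m + d) i) m = fps_nth (S m i) m" if "i < n" for i m d
    by (induction d) (use that agree[of i m] in auto)
  have YS: "fps_nth (Y i) m = fps_nth (S k i) m" if "i < n" "m \<le> k" for i m k
    using S_add[OF that(1), of m "k - m"] that(2) by (simp add: Y_def)
  have lin: "fps_nth (lin Y \<alpha>) m = fps_nth (lin (S k) \<alpha>) m" if "m \<le> k" for \<alpha> m k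
    using that by (simp add: fps_nth_lin YS cong: lin_cong)
  have Y0: "\<forall>i<n. fps_nth (Y i) 0 = mulop (X i)"
    using S[of 0] by (auto simp: Y_def solves_up_to_def)
  have eqv: "equivariant Y"
    unfolding equivariant_def
  proof (intro ballI allI impI fps_ext)
    fix g m and \<alpha> :: "'v \<Rightarrow> real" assume "g \<in> carrier G" "linear \<alpha>"
    then have "UU g * lin (S m) (\<alpha> \<circ> \<phi> g) = lin (S m) \<alpha> * UU g"
      using S[of m] by (simp add: solves_up_to_def equivariant_def)
    then show "fps_nth (UU g * lin Y (\<alpha> \<circ> \<phi> g)) m = fps_nth (lin Y \<alpha> * UU g) m"
      by (auto simp: lin[of m m] dest!: arg_cong[where f = "\<lambda>F. fps_nth F m"])
  qed
  have "comm (lin Y \<alpha>) (lin Y \<beta>) = fps_X * fps_const (K \<alpha> \<beta>)" if "linear \<alpha>" "linear \<beta>" for \<alpha> \<beta>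
  proof (rule fps_ext)
    fix m
    have "fps_nth (defect (S m) \<alpha> \<beta>) m = 0" using S[of m] that by (simp add: solves_up_to_def)
    moreover have "fps_nth (lin Y \<alpha> * lin Y \<beta>) m = fps_nth (lin (S m) \<alpha> * lin (S m) \<beta>) m" for \<alpha> \<beta>
      unfolding fps_mult_nth by (intro sum.cong) (auto simp: lin[of _ m])
    ultimately show "fps_nth (comm (lin Y \<alpha>) (lin Y \<beta>)) m = fps_nth (fps_X * fps_const (K \<alpha> \<beta>)) m"
      by (simp add: defect_def comm_def)
  qed
  with Y0 eqv show ?thesis by blast
qed

end

section \<open>The crossed product acts faithfully on polynomials\<close>

text \<open>
  A nonzero linear functional is nonzero on a dense set.
\<close>

lemma continuous_zero_of_mult_linear:
  fixes c l :: "'v::real_normed_vector \<Rightarrow> real"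
  assumes c: "\<And>p. isCont c p" and l: "linear l" "l v \<noteq> 0" and zero: "\<And>p. c p * l p = 0"
  shows "c p = 0"
proof (cases "l p = 0")
  case True
  define s where "s k = p + (1 / real (Suc k)) *\<^sub>R v" for k
  have "l (s k) = l v / real (Suc k)" for k
    using True l(1) by (simp add: s_def linear_add linear_scale)
  then have "c (s k) = 0" for k using zero[of "s k"] l(2) by simp
  moreover have "s \<longlonglongrightarrow> p + 0 *\<^sub>R v"
    unfolding s_def by (intro tendsto_intros LIMSEQ_Suc lim_1_over_n)
  then have "(\<lambda>k. c (s k)) \<longlonglongrightarrow> c p"
    using isCont_tendsto_compose[OF c, of s p sequentially] by simp
  ultimately show ?thesis by (simp add: LIMSEQ_const_iff)
qed (use zero[of p] in auto)

lemma continuous_zero_of_mult_prod_linear: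
  fixes c :: "'v::real_normed_vector \<Rightarrow> real"
  assumes "finite S" and c: "\<And>p. isCont c p"
    and l: "\<And>s. s \<in> S \<Longrightarrow> linear (l s)" "\<And>s p. s \<in> S \<Longrightarrow> isCont (l s) p" "\<And>s. s \<in> S \<Longrightarrow> \<exists>v. l s v \<noteq> (0::real)"
    and zero: "\<And>p. c p * (\<Prod>s\<in>S. l s p) = 0"
  shows "c p = 0"
  using assms(1) l zero
proof (induction S rule: finite_induct)
  case (insert s S)
  obtain v where v: "l s v \<noteq> 0" using insert.prems(3) by blast
  show ?case
  proof (rule insert.IH)
    show "c p * (\<Prod>s\<in>S. l s p) = 0" for p
      by (rule continuous_zero_of_mult_linear[of "\<lambda>p. c p * (\<Prod>s\<in>S. l s p)" "l s" v])
        (use insert c v in \<open>auto intro!: continuous_intros simp: mult_ac\<close>)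
  qed (use insert.prems in auto)
qed auto

text \<open>
  The operators Y i generate, together with the group, the deformed algebra. Faithfulness of the action
  makes the undeformed algebra visible in the constant coefficients.
\<close>

locale deformed_coordinates = symplectic_reflection_data b n G \<phi> \<kappa>
  for b :: "nat \<Rightarrow> 'v::real_normed_vector" and n :: nat and G :: "('g, 'm) monoid_scheme" (structure)
    and \<phi> :: "'g \<Rightarrow> 'v \<Rightarrow> 'v" and \<kappa> :: "'g \<Rightarrow> ('v \<Rightarrow> real) \<Rightarrow> ('v \<Rightarrow> real) \<Rightarrow> real" +
  fixes Y :: "nat \<Rightarrow> 'v polyfun endo fps"
  assumes faithful: "g \<in> carrier G \<Longrightarrow> (\<And>v. \<phi> g v = v) \<Longrightarrow> g = \<one>"
    and Y_0: "i < n \<Longrightarrow> fps_nth (Y i) 0 = mulop (X i)"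
    and Y_equivariant: "equivariant Y"
    and Y_comm: "linear \<alpha> \<Longrightarrow> linear \<beta> \<Longrightarrow> comm (lin Y \<alpha>) (lin Y \<beta>) = fps_X * fps_const (K \<alpha> \<beta>)"
begin

abbreviation B :: "(real, 'g \<Rightarrow> 'v \<Rightarrow> real) module" where "B \<equiv> crossed_product G \<phi>"

lemma B_carrier: "a \<in> carrier B \<longleftrightarrow> (\<forall>g\<in>carrier G. real_polynomial_function (a g)) \<and> (\<forall>g. g \<notin> carrier G \<longrightarrow> a g = (\<lambda>x. 0))"
  by (simp add: crossed_product_def)

lemma B_ops:
  "\<zero>\<^bsub>B\<^esub> = (\<lambda>g x. 0)" "a \<oplus>\<^bsub>B\<^esub> a' = (\<lambda>g x. a g x + a' g x)" "c \<odot>\<^bsub>B\<^esub> a = (\<lambda>g x. c * a g x)"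
  "\<one>\<^bsub>B\<^esub> = cp_term (\<lambda>x. 1) \<one>"
  by (auto simp: crossed_product_def cp_term_def fun_eq_iff)

lemma B_mult:
  assumes "k \<in> carrier G"
  shows "(a \<otimes>\<^bsub>B\<^esub> a') k x = (\<Sum>g\<in>carrier G. a g x * a' (inv g \<otimes> k) (\<phi> (inv g) x))"
proof -
  have "inv g \<otimes> (g \<otimes> h) = h" "g \<otimes> (inv g \<otimes> h) = h" if "g \<in> carrier G" "h \<in> carrier G" for g h
    using that by (simp_all flip: m_assoc)
  then have "(\<Sum>(g, h)\<in>{(g, h) \<in> carrier G \<times> carrier G. g \<otimes> h = k}. a g x * a' h (\<phi> (inv g) x))
    = (\<Sum>g\<in>carrier G. a g x * a' (inv g \<otimes> k) (\<phi> (inv g) x))"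
    using assms
    by (intro sum.reindex_bij_witness[where i = "\<lambda>g. (g, inv g \<otimes> k)" and j = fst]) auto
  then show ?thesis by (simp add: crossed_product_def)
qed

lemma B_mult_outside: "k \<notin> carrier G \<Longrightarrow> (a \<otimes>\<^bsub>B\<^esub> a') k = (\<lambda>x. 0)"
  by (auto simp: crossed_product_def intro!: ext sum.neutral)

lemma B_closed:
  "\<zero>\<^bsub>B\<^esub> \<in> carrier B"
  "a \<in> carrier B \<Longrightarrow> a' \<in> carrier B \<Longrightarrow> a \<oplus>\<^bsub>B\<^esub> a' \<in> carrier B"
  "a \<in> carrier B \<Longrightarrow> a' \<in> carrier B \<Longrightarrow> a \<otimes>\<^bsub>B\<^esub> a' \<in> carrier B"
  "a \<in> carrier B \<Longrightarrow> c \<odot>\<^bsub>B\<^esub> a \<in> carrier B"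
  "real_polynomial_function f \<Longrightarrow> g \<in> carrier G \<Longrightarrow> cp_term f g \<in> carrier B"
proof -
  show "a \<otimes>\<^bsub>B\<^esub> a' \<in> carrier B" if "a \<in> carrier B" "a' \<in> carrier B"
    unfolding B_carrier
  proof (intro conjI ballI allI impI)
    fix k assume k: "k \<in> carrier G"
    then have eq: "(a \<otimes>\<^bsub>B\<^esub> a') k = (\<lambda>x. \<Sum>g\<in>carrier G. a g x * a' (inv g \<otimes> k) (\<phi> (inv g) x))"
      by (auto simp: B_mult)
    show "real_polynomial_function ((a \<otimes>\<^bsub>B\<^esub> a') k)"
      unfolding eq
      using that k finite_carrier unfolding B_carrier
      by (intro real_polynomial_function_sum real_polynomial_function.intros(4) real_polynomial_\<phi>) auto
  qed (rule B_mult_outside)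
  show "cp_term f g \<in> carrier B" if "real_polynomial_function f" "g \<in> carrier G"
    unfolding B_carrier
  proof (intro conjI ballI allI impI)
    fix h show "real_polynomial_function (cp_term f g h)"
      using that by (cases "h = g") (auto simp: cp_term_def)
  qed (use that in \<open>auto simp: cp_term_def\<close>)
qed (auto simp: B_carrier B_ops)

text \<open>
  The natural representation of the crossed product on polynomial functions.
\<close>

definition L :: "('g \<Rightarrow> 'v \<Rightarrow> real) \<Rightarrow> 'v polyfun endo" where
  "L a = (\<Sum>g\<in>carrier G. mulop (Polyfun (a g)) * U g)"

lemma peval_L:
  "a \<in> carrier B \<Longrightarrow> peval (app (L a) f) x = (\<Sum>g\<in>carrier G. a g x * peval f (\<phi> (inv g) x))"
  by (simp add: L_def B_carrier peval_Polyfun cong: sum.cong)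

lemma L_simps:
  "L \<zero>\<^bsub>B\<^esub> = 0"
  "a \<in> carrier B \<Longrightarrow> a' \<in> carrier B \<Longrightarrow> L (a \<oplus>\<^bsub>B\<^esub> a') = L a + L a'"
  "a \<in> carrier B \<Longrightarrow> L (c \<odot>\<^bsub>B\<^esub> a) = c *\<^sub>R L a"
  "a \<in> carrier B \<Longrightarrow> a' \<in> carrier B \<Longrightarrow> L (a \<otimes>\<^bsub>B\<^esub> a') = L a * L a'"
proof -
  show "L \<zero>\<^bsub>B\<^esub> = 0"
    by (intro endo_eqI polyfun_eqI) (simp only: peval_L[OF B_closed(1)], simp add: B_ops)
  show "L (a \<oplus>\<^bsub>B\<^esub> a') = L a + L a'" if "a \<in> carrier B" "a' \<in> carrier B"
    by (intro endo_eqI polyfun_eqI)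
      (simp only: peval_L[OF B_closed(2)[OF that]] app_simps peval_simps peval_L that, simp add: B_ops sum.distrib distrib_right)
  show "L (c \<odot>\<^bsub>B\<^esub> a) = c *\<^sub>R L a" if "a \<in> carrier B"
    by (intro endo_eqI polyfun_eqI)
      (simp only: peval_L[OF B_closed(4)[OF that]] app_simps peval_simps peval_L that, simp add: B_ops sum_distrib_left mult.assoc)
  show "L (a \<otimes>\<^bsub>B\<^esub> a') = L a * L a'" if a: "a \<in> carrier B" "a' \<in> carrier B"
  proof (intro endo_eqI polyfun_eqI)
    fix f x
    have "peval (app (L (a \<otimes>\<^bsub>B\<^esub> a')) f) x =
        (\<Sum>k\<in>carrier G. \<Sum>g\<in>carrier G. a g x * a' (inv g \<otimes> k) (\<phi> (inv g) x) * peval f (\<phi> (inv k) x))"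
      by (simp add: peval_L[OF B_closed(3)[OF a]] B_mult sum_distrib_right cong: sum.cong)
    also have "\<dots> = (\<Sum>g\<in>carrier G. \<Sum>k\<in>carrier G. a g x * a' (inv g \<otimes> k) (\<phi> (inv g) x) * peval f (\<phi> (inv k) x))"
      by (rule sum.swap)
    also have "\<dots> = (\<Sum>g\<in>carrier G. \<Sum>h\<in>carrier G. a g x * (a' h (\<phi> (inv g) x) * peval f (\<phi> (inv h) (\<phi> (inv g) x))))"
    proof (rule sum.cong[OF refl])
      fix g assume g: "g \<in> carrier G"
      have "inv g \<otimes> (g \<otimes> h) = h" "g \<otimes> (inv g \<otimes> h) = h" if "h \<in> carrier G" for h
        using that g by (simp_all flip: m_assoc)
      with g show "(\<Sum>k\<in>carrier G. a g x * a' (inv g \<otimes> k) (\<phi> (inv g) x) * peval f (\<phi> (inv k) x))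
        = (\<Sum>h\<in>carrier G. a g x * (a' h (\<phi> (inv g) x) * peval f (\<phi> (inv h) (\<phi> (inv g) x))))"
        by (intro sum.reindex_bij_witness[where i = "\<lambda>h. g \<otimes> h" and j = "\<lambda>k. inv g \<otimes> k"])
          (simp_all add: \<phi>_mult \<phi>_inv inv_mult_group mult.assoc)
    qed
    also have "\<dots> = peval (app (L a * L a') f) x"
      using a by (simp add: peval_L sum_distrib_left)
    finally show "peval (app (L (a \<otimes>\<^bsub>B\<^esub> a')) f) x = peval (app (L a * L a') f) x" .
  qed
qed

text \<open>
  Distinct group elements act by distinct maps, which differ in some coordinate. Testing the
  operator on a product of affine functions isolates the coefficient of one group element, multiplied
  by nonzero linear functionals.
\<close>

lemma L_eq_0:
  assumes a: "a \<in> carrier B" and zero: "L a = 0"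
  shows "a = \<zero>\<^bsub>B\<^esub>"
proof -
  have "a h p = 0" if h: "h \<in> carrier G" for h p
  proof -
    have "\<exists>i v. coord i (\<phi> (inv h) v) \<noteq> coord i (\<phi> (inv g) v)" if g: "g \<in> carrier G - {h}" for g
    proof (rule ccontr)
      assume "\<not> ?thesis"
      then have "(\<Sum>i<n. coord i (\<phi> (inv h) v) *\<^sub>R b i) = (\<Sum>i<n. coord i (\<phi> (inv g) v) *\<^sub>R b i)" for v
        by (intro sum.cong) auto
      then have "\<phi> (inv h) v = \<phi> (inv g) v" for v
        by (simp only: coord_expansion)
      from this[of "\<phi> h _"] have "\<phi> (inv g \<otimes> h) v = v" for v
        using g h by (simp add: \<phi>_mult \<phi>_inv)
      then have "inv g \<otimes> h = \<one>" using g h by (intro faithful) auto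
      then show False using g h inv_equality[of "inv g" h] by auto
    qed
    then obtain i where i: "\<And>g. g \<in> carrier G - {h} \<Longrightarrow>
        \<exists>v. coord (i g) (\<phi> (inv h) v) \<noteq> coord (i g) (\<phi> (inv g) v)" by metis
    define l where "l g v = coord (i g) (\<phi> (inv h) v) - coord (i g) (\<phi> (inv g) v)" for g v
    \<comment> \<open>A polynomial that vanishes at the inverse translates of p by all g other than h.\<close>
    define f where "f p = (\<Prod>g\<in>carrier G - {h}. X (i g) - coord (i g) (\<phi> (inv g) p) *\<^sub>R 1)" for p
    have f: "peval (f p) v = (\<Prod>g\<in>carrier G - {h}. coord (i g) v - coord (i g) (\<phi> (inv g) p))" for p v
    proof -
      have "peval (\<Prod>g\<in>S. F g) v = (\<Prod>g\<in>S. peval (F g) v)" for S and F :: "'g \<Rightarrow> 'v polyfun"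
        by (induction S rule: infinite_finite_induct) auto
      then show ?thesis by (simp add: f_def)
    qed
    have "a h p * (\<Prod>g\<in>carrier G - {h}. l g p) = 0" for p
    proof -
      have "0 = peval (app (L a) (f p)) p" by (simp add: zero)
      also have "\<dots> = (\<Sum>g\<in>carrier G. a g p * peval (f p) (\<phi> (inv g) p))" by (rule peval_L[OF a])
      also have "\<dots> = (\<Sum>g\<in>carrier G. if g = h then a h p * (\<Prod>g\<in>carrier G - {h}. l g p) else 0)"
        using finite_carrier by (intro sum.cong) (auto simp: f l_def intro!: prod_zero)
      also have "\<dots> = a h p * (\<Prod>g\<in>carrier G - {h}. l g p)" using h finite_carrier by simp
      finally show ?thesis by simp
    qed
    moreover have l_lin: "linear (l g)" if "g \<in> carrier G - {h}" for g
      unfolding l_def using that h by (intro linear_compose_sub linear_comp_\<phi>') auto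
    moreover have "isCont (l g) q" if "g \<in> carrier G - {h}" for g q
      using continuous_real_polymonial_function[OF linear_real_polynomial[OF l_lin[OF that]]] .
    moreover have "isCont (a h) q" for q
      using a h by (intro continuous_real_polymonial_function) (auto simp: B_carrier)
    moreover have "\<exists>v. l g v \<noteq> 0" if "g \<in> carrier G - {h}" for g
      using i[OF that] by (simp add: l_def)
    ultimately show ?thesis
      using continuous_zero_of_mult_prod_linear[of "carrier G - {h}" "a h" l p] finite_carrier by blast
  qed
  then have "a g x = \<zero>\<^bsub>B\<^esub> g x" for g x
    using a by (cases "g \<in> carrier G") (auto simp: B_ops B_carrier)
  then show ?thesis by blast
qed

lemma L_inject:
  assumes a: "a \<in> carrier B" "a' \<in> carrier B" and eq: "L a = L a'"
  shows "a = a'"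
proof -
  have "L (a \<oplus>\<^bsub>B\<^esub> (-1) \<odot>\<^bsub>B\<^esub> a') = 0"
    using a eq by (simp add: L_simps B_closed)
  then have "a \<oplus>\<^bsub>B\<^esub> (-1) \<odot>\<^bsub>B\<^esub> a' = \<zero>\<^bsub>B\<^esub>" using a by (intro L_eq_0) (simp_all add: B_closed)
  then show ?thesis by (simp add: B_ops fun_eq_iff)
qed

section \<open>Normal ordering and the star product\<close>

definition word :: "('v \<Rightarrow> real) list \<Rightarrow> 'v polyfun endo fps" where
  "word ws = prod_list (map (lin Y) ws)"

lemma word_simps [simp]: "word [] = 1" "word (\<alpha> # ws) = lin Y \<alpha> * word ws" "word (ws @ ws') = word ws * word ws'"
  by (simp_all add: word_def)

definition ordered :: "nat multiset \<Rightarrow> 'v polyfun endo fps" where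
  "ordered A = word (map coord (sorted_list_of_multiset A))"

text \<open>
  Normal ordering: a monomial goes to the product of its deformed generators in increasing order.
\<close>

definition q0 :: "'v polyfun \<Rightarrow> 'v polyfun endo fps" where
  "q0 = (SOME T. linear T \<and> (\<forall>A\<in>exps. T (mono A) = ordered A))"

lemma linear_q0 [simp]: "linear q0" and q0_mono: "A \<in> exps \<Longrightarrow> q0 (mono A) = ordered A"
proof -
  have "linear q0 \<and> (\<forall>A\<in>exps. q0 (mono A) = ordered A)"
    unfolding q0_def by (rule someI_ex[OF linear_on_monomials_exists[of ordered]])
  then show "linear q0" "A \<in> exps \<Longrightarrow> q0 (mono A) = ordered A" by auto
qed

lemma lin_Y_0: "linear \<alpha> \<Longrightarrow> fps_nth (lin Y \<alpha>) 0 = mulop (cov \<alpha>)"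
  using Y_0 by (intro lin_nth_0) auto

lemma q0_nth_0: "fps_nth (q0 f) 0 = mulop f"
proof -
  have "(\<lambda>f. fps_nth (q0 f) 0) = mulop"
  proof (rule linear_eq_on_monomials)
    show "linear (\<lambda>f. fps_nth (q0 f) 0)"
      by (rule linearI) (simp_all add: linear_add[OF linear_q0] linear_scale[OF linear_q0])
    show "linear mulop" by (rule linear_mulop)
    fix A assume A: "A \<in> exps"
    have "fps_nth (word (map coord is)) 0 = mulop (mono (mset is))" for "is"
      by (induction "is") (simp_all add: lin_Y_0 mulop_simps flip: X_def)
    from this[of "sorted_list_of_multiset A"] show "fps_nth (q0 (mono A)) 0 = mulop (mono A)"
      using A by (simp add: q0_mono ordered_def)
  qed
  then show ?thesis by metis
qed

lemma q0_const: "q0 (c *\<^sub>R 1) = c *\<^sub>R 1"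
  using q0_mono[of "{#}"] by (simp add: linear_scale[OF linear_q0] ordered_def)

lemma q0_cov: "linear \<alpha> \<Longrightarrow> q0 (cov \<alpha>) = lin Y \<alpha>"
proof (rule covector_linear_eqI[OF covector_linear_endo[OF covector_linear_cov linear_q0] covector_linear_lin])
  fix i assume i: "i < n"
  have "q0 (mono {#i#}) = ordered {#i#}" using i by (intro q0_mono) simp
  then show "q0 (cov (coord i)) = lin Y (coord i)"
    by (simp add: X_def ordered_def)
qed

definition q :: "('g \<Rightarrow> 'v \<Rightarrow> real) \<Rightarrow> 'v polyfun endo fps" where
  "q a = (\<Sum>g\<in>carrier G. q0 (Polyfun (a g)) * UU g)"

lemma q_nth_0: "fps_nth (q a) 0 = L a"
  by (simp add: q_def L_def fps_sum_nth q0_nth_0)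

lemma Polyfun_ops:
  "real_polynomial_function f \<Longrightarrow> real_polynomial_function f' \<Longrightarrow> Polyfun (\<lambda>x. f x + f' x) = Polyfun f + Polyfun f'"
  "real_polynomial_function f \<Longrightarrow> Polyfun (\<lambda>x. c * f x) = c *\<^sub>R Polyfun f"
  "Polyfun (\<lambda>x. c) = c *\<^sub>R 1"
  by (rule polyfun_eqI; simp add: peval_Polyfun real_polynomial_function.intros)+

lemma q_add: "a \<in> carrier B \<Longrightarrow> a' \<in> carrier B \<Longrightarrow> q (a \<oplus>\<^bsub>B\<^esub> a') = q a + q a'"
  by (simp add: q_def B_ops B_carrier Polyfun_ops linear_add[OF linear_q0] distrib_right sum.distrib cong: sum.cong)

lemma q_scale: "a \<in> carrier B \<Longrightarrow> q (c \<odot>\<^bsub>B\<^esub> a) = c *\<^sub>R q a"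
  by (simp add: q_def B_ops B_carrier Polyfun_ops linear_scale[OF linear_q0] scaleR_sum_right cong: sum.cong)

lemma q_term: "g \<in> carrier G \<Longrightarrow> q (cp_term f g) = q0 (Polyfun f) * UU g"
proof -
  assume g: "g \<in> carrier G"
  have "q0 (Polyfun (\<lambda>x. 0)) = 0"
    using q0_const[of 0] by (simp add: Polyfun_ops(3))
  then have "q (cp_term f g) = (\<Sum>h\<in>carrier G. if h = g then q0 (Polyfun f) * UU g else 0)"
    unfolding q_def by (intro sum.cong) (auto simp: cp_term_def)
  then show ?thesis using g finite_carrier by simp
qed

text \<open>
  The extension of q to formal series; N below is its image, the normally ordered series.
\<close>

definition Q :: "(nat \<Rightarrow> 'g \<Rightarrow> 'v \<Rightarrow> real) \<Rightarrow> 'v polyfun endo fps" where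
  "Q F = Abs_fps (\<lambda>m. \<Sum>i\<le>m. fps_nth (q (F i)) (m - i))"

abbreviation FS :: "(nat \<Rightarrow> 'g \<Rightarrow> 'v \<Rightarrow> real) set" where "FS \<equiv> formal_series B"

lemma FS_D: "F \<in> FS \<Longrightarrow> F i \<in> carrier B" by (simp add: formal_series_def)

lemma Q_add: "F \<in> FS \<Longrightarrow> H \<in> FS \<Longrightarrow> Q (fseries_add B F H) = Q F + Q H"
  by (rule fps_ext) (simp add: Q_def fseries_add_def FS_D q_add sum.distrib)

lemma Q_scale: "F \<in> FS \<Longrightarrow> Q (\<lambda>m. c \<odot>\<^bsub>B\<^esub> F m) = c *\<^sub>R Q F"
  by (rule fps_ext) (simp add: Q_def FS_D q_scale scaleR_sum_right)

lemma FS_add: "F \<in> FS \<Longrightarrow> H \<in> FS \<Longrightarrow> fseries_add B F H \<in> FS"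
  by (simp add: formal_series_def fseries_add_def B_closed)

lemma FS_scale: "F \<in> FS \<Longrightarrow> (\<lambda>m. c \<odot>\<^bsub>B\<^esub> F m) \<in> FS"
  by (simp add: formal_series_def B_closed)

lemma FS_const: "a \<in> carrier B \<Longrightarrow> fseries_const B a \<in> FS"
  by (simp add: formal_series_def fseries_const_def B_closed)

lemma q_zero: "q \<zero>\<^bsub>B\<^esub> = 0"
  using q_scale[OF B_closed(1), of 0] by (simp add: B_ops)

lemma Q_const: "Q (fseries_const B a) = q a"
proof (rule fps_ext)
  fix m
  have "(\<Sum>i\<le>m. fps_nth (q (fseries_const B a i)) (m - i)) = (\<Sum>i\<le>m. if i = 0 then fps_nth (q a) m else 0)"
    by (intro sum.cong) (auto simp: fseries_const_def q_zero)
  then show "fps_nth (Q (fseries_const B a)) m = fps_nth (q a) m" by (simp add: Q_def)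
qed

text \<open>
  The lowest coefficient of F is seen by the constant term of q, which is the faithful representation L.
\<close>

lemma Q_eq_0:
  assumes F: "F \<in> FS" and zero: "Q F = 0"
  shows "F m = \<zero>\<^bsub>B\<^esub>"
proof (induction m rule: less_induct)
  case (less m)
  have "0 = (\<Sum>i\<le>m. fps_nth (q (F i)) (m - i))"
    using arg_cong[OF zero, of "\<lambda>T. fps_nth T m"] by (simp add: Q_def)
  also have "\<dots> = (\<Sum>i\<le>m. if i = m then L (F m) else 0)"
    using less by (intro sum.cong) (auto simp: q_nth_0 q_zero)
  finally have "L (F m) = 0" by simp
  then show ?case using FS_D[OF F] by (intro L_eq_0)
qed

lemma Q_inject:
  assumes F: "F \<in> FS" "H \<in> FS" and eq: "Q F = Q H"
  shows "F = H"
proof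
  fix m
  let ?D = "fseries_add B F (\<lambda>m. (-1) \<odot>\<^bsub>B\<^esub> H m)"
  have "Q ?D = 0" using F eq by (simp add: Q_add Q_scale FS_scale)
  then have "?D m = \<zero>\<^bsub>B\<^esub>" using F by (intro Q_eq_0) (simp_all add: FS_add FS_scale)
  then show "F m = H m" by (simp add: fseries_add_def B_ops fun_eq_iff)
qed

lemma sum_triangle_swap: "(\<Sum>k\<le>m. \<Sum>i\<le>m - k. f k i) = (\<Sum>i\<le>m. \<Sum>k\<le>m - i. f k i)"
  for f :: "nat \<Rightarrow> nat \<Rightarrow> 'r::comm_monoid_add"
  unfolding sum.Sigma[OF finite_atMost ballI[OF finite_atMost]]
  by (intro sum.reindex_bij_witness[where i = "\<lambda>(i, k). (k, i)" and j = "\<lambda>(k, i). (i, k)"]) auto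

lemma sum_triangle_diagonal: "(\<Sum>k\<le>m. \<Sum>i\<le>k. f i (k - i)) = (\<Sum>i\<le>m. \<Sum>l\<le>m - i. f i l)"
  for f :: "nat \<Rightarrow> nat \<Rightarrow> 'r::comm_monoid_add"
  unfolding sum.Sigma[OF finite_atMost ballI[OF finite_atMost]]
  by (intro sum.reindex_bij_witness[where i = "\<lambda>(i, l). (i + l, i)" and j = "\<lambda>(k, i). (i, k - i)"]) auto

definition N :: "'v polyfun endo fps set" where "N = Q ` FS"

lemma N_I: "F \<in> FS \<Longrightarrow> Q F \<in> N" by (simp add: N_def)

lemma N_D: "T \<in> N \<Longrightarrow> \<exists>F. F \<in> FS \<and> T = Q F" by (auto simp: N_def)

lemma finsum_B:
  assumes "finite A" "\<And>i. i \<in> A \<Longrightarrow> f i \<in> carrier B"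
  shows "(\<lambda>g x. \<Sum>i\<in>A. f i g x) \<in> carrier B" "q (\<lambda>g x. \<Sum>i\<in>A. f i g x) = (\<Sum>i\<in>A. q (f i))"
proof -
  have "(\<lambda>g x. \<Sum>i\<in>A. f i g x) \<in> carrier B \<and> q (\<lambda>g x. \<Sum>i\<in>A. f i g x) = (\<Sum>i\<in>A. q (f i))"
    using assms
  proof (induction A rule: finite_induct)
    case empty
    then show ?case using B_closed(1) q_zero by (simp add: B_ops)
  next
    case (insert i A)
    have eq: "(\<lambda>g x. \<Sum>i\<in>insert i A. f i g x) = f i \<oplus>\<^bsub>B\<^esub> (\<lambda>g x. \<Sum>i\<in>A. f i g x)"
      using insert.hyps by (simp add: B_ops)
    show ?case unfolding eq using insert by (auto simp: q_add B_closed)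
  qed
  then show "(\<lambda>g x. \<Sum>i\<in>A. f i g x) \<in> carrier B" "q (\<lambda>g x. \<Sum>i\<in>A. f i g x) = (\<Sum>i\<in>A. q (f i))" by auto
qed

lemma Q_series:
  assumes c: "\<And>i. c i \<in> FS"
  shows "(\<lambda>k g x. \<Sum>i\<le>k. c i (k - i) g x) \<in> FS"
    and "Q (\<lambda>k g x. \<Sum>i\<le>k. c i (k - i) g x) = Abs_fps (\<lambda>m. \<Sum>i\<le>m. fps_nth (Q (c i)) (m - i))"
proof -
  define F where "F k = (\<lambda>g x. \<Sum>i\<le>k. c i (k - i) g x)" for k
  have F: "F k \<in> carrier B" "q (F k) = (\<Sum>i\<le>k. q (c i (k - i)))" for k
    unfolding F_def by (rule finsum_B; simp add: FS_D c)+
  then show "(\<lambda>k g x. \<Sum>i\<le>k. c i (k - i) g x) \<in> FS" by (simp add: formal_series_def F_def)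
  have "Q F = Abs_fps (\<lambda>m. \<Sum>i\<le>m. fps_nth (Q (c i)) (m - i))"
  proof (rule fps_ext)
    fix m
    have "fps_nth (Q F) m = (\<Sum>k\<le>m. \<Sum>i\<le>k. fps_nth (q (c i (k - i))) (m - i - (k - i)))"
      by (simp add: Q_def F fps_sum_nth)
    also have "\<dots> = (\<Sum>i\<le>m. \<Sum>l\<le>m - i. fps_nth (q (c i l)) (m - i - l))"
      by (rule sum_triangle_diagonal[of "\<lambda>i l. fps_nth (q (c i l)) (m - i - l)"])
    finally show "fps_nth (Q F) m = fps_nth (Abs_fps (\<lambda>m. \<Sum>i\<le>m. fps_nth (Q (c i)) (m - i))) m"
      by (simp add: Q_def)
  qed
  then show "Q (\<lambda>k g x. \<Sum>i\<le>k. c i (k - i) g x) = Abs_fps (\<lambda>m. \<Sum>i\<le>m. fps_nth (Q (c i)) (m - i))"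
    by (simp add: F_def[abs_def])
qed

text \<open>
  The formal sum of the T i times the i-th power of the parameter is again in N.
\<close>

lemma N_series:
  assumes "\<And>i. T i \<in> N"
  shows "Abs_fps (\<lambda>m. \<Sum>i\<le>m. fps_nth (T i) (m - i)) \<in> N"
proof -
  have "\<forall>i. \<exists>c. c \<in> FS \<and> T i = Q c" using N_D[OF assms] by blast
  from choice[OF this] obtain c where c: "\<And>i. c i \<in> FS" "\<And>i. T i = Q (c i)" by blast
  then show ?thesis using N_I[OF Q_series(1)[of c]] Q_series(2)[of c] by simp
qed

lemma mult_Q: "T * Q H = Abs_fps (\<lambda>m. \<Sum>i\<le>m. fps_nth (T * q (H i)) (m - i))"
proof (rule fps_ext)
  fix m
  have "fps_nth (T * Q H) m = (\<Sum>k\<le>m. \<Sum>i\<le>m - k. fps_nth T k * fps_nth (q (H i)) (m - k - i))"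
    by (simp add: fps_mult_nth Q_def sum_distrib_left atLeast0AtMost)
  also have "\<dots> = (\<Sum>i\<le>m. \<Sum>k\<le>m - i. fps_nth T k * fps_nth (q (H i)) (m - k - i))"
    by (rule sum_triangle_swap)
  also have "\<dots> = (\<Sum>i\<le>m. fps_nth (T * q (H i)) (m - i))"
    by (simp add: fps_mult_nth atLeast0AtMost add.commute)
  finally show "fps_nth (T * Q H) m = fps_nth (Abs_fps (\<lambda>m. \<Sum>i\<le>m. fps_nth (T * q (H i)) (m - i))) m"
    by simp
qed

lemma Q_mult: "Q H * T = Abs_fps (\<lambda>m. \<Sum>i\<le>m. fps_nth (q (H i) * T) (m - i))"
proof (rule fps_ext)
  fix m
  have "fps_nth (Q H * T) m = (\<Sum>k\<le>m. \<Sum>i\<le>k. fps_nth (q (H i)) (k - i) * fps_nth T (m - i - (k - i)))"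
    by (simp add: fps_mult_nth Q_def sum_distrib_right atLeast0AtMost)
  also have "\<dots> = (\<Sum>i\<le>m. \<Sum>l\<le>m - i. fps_nth (q (H i)) l * fps_nth T (m - i - l))"
    by (rule sum_triangle_diagonal[of "\<lambda>i l. fps_nth (q (H i)) l * fps_nth T (m - i - l)"])
  finally show "fps_nth (Q H * T) m = fps_nth (Abs_fps (\<lambda>m. \<Sum>i\<le>m. fps_nth (q (H i) * T) (m - i))) m"
    by (simp add: fps_mult_nth atLeast0AtMost)
qed

lemma N_add: "S \<in> N \<Longrightarrow> T \<in> N \<Longrightarrow> S + T \<in> N"
  by (auto dest!: N_D simp flip: Q_add intro!: N_I FS_add)

lemma N_scale: "T \<in> N \<Longrightarrow> c *\<^sub>R T \<in> N"
  by (auto dest!: N_D simp flip: Q_scale intro!: N_I FS_scale)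

lemma N_q: "a \<in> carrier B \<Longrightarrow> q a \<in> N"
  using N_I[OF FS_const] by (simp add: Q_const)

lemma N_zero: "0 \<in> N"
  using N_q[OF B_closed(1)] by (simp add: q_zero)

lemma N_sum: "(\<And>i. i \<in> A \<Longrightarrow> f i \<in> N) \<Longrightarrow> sum f A \<in> N"
  by (induction A rule: infinite_finite_induct) (auto simp: N_zero N_add)

lemma N_X: assumes "T \<in> N" shows "fps_X * T \<in> N"
proof -
  have "Abs_fps (\<lambda>m. \<Sum>i\<le>m. fps_nth ((\<lambda>i. if i = 1 then T else 0) i) (m - i)) \<in> N"
    by (rule N_series) (auto simp: assms N_zero)
  also have "Abs_fps (\<lambda>m. \<Sum>i\<le>m. fps_nth ((\<lambda>i. if i = 1 then T else 0) i) (m - i)) = fps_X * T"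
  proof (rule fps_ext)
    fix m
    have "(\<Sum>i\<le>m. fps_nth (if i = 1 then T else 0) (m - i)) = (\<Sum>i\<le>m. if i = 1 then fps_nth T (m - 1) else 0)"
      by (intro sum.cong) auto
    then show "fps_nth (Abs_fps (\<lambda>m. \<Sum>i\<le>m. fps_nth (if i = 1 then T else 0) (m - i))) m = fps_nth (fps_X * T) m"
      by auto
  qed
  finally show ?thesis .
qed

lemma N_U:
  assumes "T \<in> N" and g: "g \<in> carrier G"
  shows "T * UU g \<in> N"
proof -
  have UU: "UU h * UU g = UU (h \<otimes> g)" if "h \<in> carrier G" for h
    using that g by (simp add: U_mult)
  have "q a * UU g \<in> N" if a: "a \<in> carrier B" for a
  proof -
    have "q a * UU g = (\<Sum>h\<in>carrier G. q (cp_term (a h) (h \<otimes> g)))"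
      using g by (subst q_def) (simp add: q_term sum_distrib_right mult.assoc UU del: fps_const_mult cong: sum.cong)
    then show ?thesis using a g by (auto simp: B_carrier intro!: N_sum N_q B_closed(5))
  qed
  moreover obtain F where "F \<in> FS" "T = Q F" using assms(1) by (auto simp: N_def)
  ultimately show ?thesis unfolding \<open>T = Q F\<close> Q_mult by (intro N_series) (auto simp: FS_D)
qed

lemma UU_word: "g \<in> carrier G \<Longrightarrow> (\<forall>\<alpha>\<in>set ws. linear \<alpha>) \<Longrightarrow>
    UU g * word ws = word (map (\<lambda>\<alpha>. \<alpha> \<circ> \<phi> (inv g)) ws) * UU g"
proof (induction ws)
  case (Cons \<alpha> ws)
  have "\<alpha> \<circ> \<phi> (inv g) \<circ> \<phi> g = \<alpha>" using Cons.prems by (auto simp: \<phi>_inv)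
  then have 1: "UU g * lin Y \<alpha> = lin Y (\<alpha> \<circ> \<phi> (inv g)) * UU g"
    using Cons.prems Y_equivariant linear_comp_\<phi>[of "inv g" \<alpha>] unfolding equivariant_def
    by (metis inv_closed list.set_intros(1))
  have "UU g * word (\<alpha> # ws) = (UU g * lin Y \<alpha>) * word ws" by (simp add: mult.assoc)
  also have "\<dots> = lin Y (\<alpha> \<circ> \<phi> (inv g)) * (UU g * word ws)" by (simp add: 1 mult.assoc)
  also have "\<dots> = word (map (\<lambda>\<alpha>. \<alpha> \<circ> \<phi> (inv g)) (\<alpha> # ws)) * UU g"
    using Cons by (simp add: mult.assoc o_def)
  finally show ?case .
qed simp

text \<open>
  The correction terms are words that are two letters shorter, with the letters to the right of the swap
  translated by the group.
\<close>

lemma word_swap: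
  assumes "\<forall>\<alpha>\<in>set (u @ \<alpha> # \<beta> # v). linear \<alpha>"
  shows "word (u @ \<alpha> # \<beta> # v) - word (u @ \<beta> # \<alpha> # v) =
    fps_X * (\<Sum>g\<in>carrier G. \<kappa> g \<alpha> \<beta> *\<^sub>R (word (u @ map (\<lambda>\<alpha>. \<alpha> \<circ> \<phi> (inv g)) v) * UU g))"
proof -
  have "word (u @ \<alpha> # \<beta> # v) - word (u @ \<beta> # \<alpha> # v) = word u * (comm (lin Y \<alpha>) (lin Y \<beta>) * word v)"
    by (simp add: comm_def right_diff_distrib left_diff_distrib mult.assoc)
  also have "comm (lin Y \<alpha>) (lin Y \<beta>) * word v = fps_X * (\<Sum>g\<in>carrier G. \<kappa> g \<alpha> \<beta> *\<^sub>R (UU g * word v))"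
    using assms by (simp add: Y_comm K_def fps_const_sum fps_const_scaleR sum_distrib_right mult.assoc)
  also have "(\<Sum>g\<in>carrier G. \<kappa> g \<alpha> \<beta> *\<^sub>R (UU g * word v)) =
      (\<Sum>g\<in>carrier G. \<kappa> g \<alpha> \<beta> *\<^sub>R (word (map (\<lambda>\<alpha>. \<alpha> \<circ> \<phi> (inv g)) v) * UU g))"
    using assms by (intro sum.cong) (simp_all add: UU_word)
  finally have "word (u @ \<alpha> # \<beta> # v) - word (u @ \<beta> # \<alpha> # v) = word u * (fps_X *
      (\<Sum>g\<in>carrier G. \<kappa> g \<alpha> \<beta> *\<^sub>R (word (map (\<lambda>\<alpha>. \<alpha> \<circ> \<phi> (inv g)) v) * UU g)))" .
  also have "word u * (fps_X * S) = fps_X * (word u * S)" for S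
    using arg_cong[OF fps_mult_fps_X_commute[of "word u"], of "\<lambda>T. T * S"] by (simp only: mult.assoc)
  finally show ?thesis by (simp add: sum_distrib_left mult.assoc)
qed

text \<open>
  Spanning half of the Poincare-Birkhoff-Witt property. By induction on the length, words that differ
  by a swap agree modulo N, so that a word in the coordinates may be sorted; other words are linear
  combinations of these.
\<close>

lemma word_in_N: "\<forall>\<alpha>\<in>set ws. linear \<alpha> \<Longrightarrow> word ws \<in> N"
proof (induction "length ws" arbitrary: ws rule: less_induct)
  case less
  define R where "R v w \<longleftrightarrow> word v - word w \<in> N" for v w
  have R_refl: "R v v" for v by (simp add: R_def N_zero)
  have R_trans: "R u v \<Longrightarrow> R v w \<Longrightarrow> R u w" for u v w
    using N_add[of "word u - word v" "word v - word w"] by (simp add: R_def)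
  have R_swap: "R (u @ \<alpha> # \<beta> # v) (u @ \<beta> # \<alpha> # v)"
    if "length (u @ \<alpha> # \<beta> # v) = length ws" "\<forall>\<alpha>\<in>set (u @ \<alpha> # \<beta> # v). linear \<alpha>" for u v \<alpha> \<beta>
    unfolding R_def word_swap[OF that(2)] using that
    by (intro N_X N_sum N_scale N_U less.hyps) (auto intro: linear_comp_\<phi>)
  have R_insort: "R (u @ coord i # map coord v) (u @ map coord (insort i v))"
    if "length u + 1 + length v = length ws" "\<forall>\<alpha>\<in>set u. linear \<alpha>" for u v i
    using that
  proof (induction v arbitrary: u)
    case (Cons j v)
    show ?case
    proof (cases "i \<le> j")
      case False
      have "R (u @ coord i # coord j # map coord v) (u @ coord j # coord i # map coord v)"
        using Cons.prems by (intro R_swap) auto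
      moreover have "R ((u @ [coord j]) @ coord i # map coord v) ((u @ [coord j]) @ map coord (insort i v))"
        using Cons.prems by (intro Cons.IH) auto
      ultimately show ?thesis using False R_trans by fastforce
    qed (simp add: R_refl)
  qed (simp add: R_refl)
  have R_sort: "R (u @ map coord v) (u @ map coord (sort v))"
    if "length u + length v = length ws" "\<forall>\<alpha>\<in>set u. linear \<alpha>" for u v
    using that
  proof (induction v arbitrary: u)
    case (Cons i v)
    have "R ((u @ [coord i]) @ map coord v) ((u @ [coord i]) @ map coord (sort v))"
      using Cons.prems by (intro Cons.IH) auto
    moreover have "R (u @ coord i # map coord (sort v)) (u @ map coord (insort i (sort v)))"
      using Cons.prems by (intro R_insort) auto
    ultimately show ?case using R_trans by fastforce
  qed (simp add: R_refl)
  have basis: "word (map coord is) \<in> N" if "length is = length ws" "set is \<subseteq> {..<n}" for "is"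
  proof -
    have "mset is \<in> exps" using that(2) by (simp add: exps_def)
    then have "word (map coord (sort is)) = q0 (mono (mset is))"
      by (simp add: q0_mono ordered_def)
    also have "\<dots> = q (cp_term (peval (mono (mset is))) \<one>)"
      by (simp add: q_term peval_inverse)
    finally have "word (map coord (sort is)) \<in> N"
      by (simp add: N_q B_closed(5))
    with R_sort[of "[]" "is"] that(1) show ?thesis
      using N_add[of "word (map coord is) - word (map coord (sort is))" "word (map coord (sort is))"]
      by (simp add: R_def)
  qed
  \<comment> \<open>Expand the letters of a general word in coordinates, one after the other.\<close>
  have "word (map coord is @ v) \<in> N"
    if "length is + length v = length ws" "set is \<subseteq> {..<n}" "\<forall>\<alpha>\<in>set v. linear \<alpha>" for "is" v
    using that
  proof (induction v arbitrary: "is")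
    case Nil
    then show ?case using basis by simp
  next
    case (Cons \<alpha> v)
    have "word (map coord is @ \<alpha> # v) = (\<Sum>i<n. \<alpha> (b i) *\<^sub>R word (map coord (is @ [i]) @ v))"
    proof -
      have "lin Y \<alpha> = (\<Sum>i<n. \<alpha> (b i) *\<^sub>R lin Y (coord i))"
        by (subst lin_def) (intro sum.cong, auto)
      then show ?thesis by (simp add: sum_distrib_left sum_distrib_right mult.assoc)
    qed
    also have "\<dots> \<in> N"
      using Cons.prems by (intro N_sum N_scale Cons.IH) auto
    finally show ?case .
  qed
  from this[of "[]" ws] less.prems show ?case by simp
qed

lemma q_mult_in_N:
  assumes a: "a \<in> carrier B" "a' \<in> carrier B"
  shows "q a * q a' \<in> N"
proof -
  have "\<forall>f. q0 f * UU g * (q0 f' * UU h) \<in> N" if gh: "g \<in> carrier G" "h \<in> carrier G" for g h f'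
  proof -
    have 1: "ordered A * UU g * (ordered A' * UU h) \<in> N" if A: "A \<in> exps" "A' \<in> exps" for A A'
    proof -
      let ?w = "map coord (sorted_list_of_multiset A)" and ?w' = "map coord (sorted_list_of_multiset A')"
      have "ordered A * UU g * (ordered A' * UU h) = word ?w * (UU g * word ?w') * UU h"
        by (simp add: ordered_def mult.assoc)
      also have "\<dots> = word (?w @ map (\<lambda>\<alpha>. \<alpha> \<circ> \<phi> (inv g)) ?w') * UU g * UU h"
        using gh by (subst UU_word) (auto simp: mult.assoc)
      also have "\<dots> \<in> N" using gh by (intro N_U word_in_N) (auto intro: linear_comp_\<phi>)
      finally show ?thesis .
    qed
    have span: "f \<in> span (mono ` exps)" for f
      using monomials_span by (simp add: mono_def[abs_def] exps_def)
    have 2: "ordered A * UU g * (q0 f' * UU h) \<in> N" if A: "A \<in> exps" for A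
      using span[of f']
    proof (induction rule: span_induct_alt)
      case base
      then show ?case by (simp add: linear_0[OF linear_q0] N_zero)
    next
      case (step c m f')
      then show ?case using 1[OF A]
        by (auto simp: linear_add[OF linear_q0] linear_scale[OF linear_q0] q0_mono distrib_left distrib_right
            intro!: N_add N_scale)
    qed
    have "q0 f * UU g * (q0 f' * UU h) \<in> N" for f
      using span[of f]
    proof (induction rule: span_induct_alt)
      case base
      then show ?case by (simp add: linear_0[OF linear_q0] N_zero)
    next
      case (step c m f)
      then show ?case using 2
        by (auto simp: linear_add[OF linear_q0] linear_scale[OF linear_q0] q0_mono distrib_right
            intro!: N_add N_scale)
    qed
    then show ?thesis by blast
  qed
  then show ?thesis
    unfolding q_def sum_distrib_left sum_distrib_right by (intro N_sum) auto
qed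

lemma N_mult: assumes "S \<in> N" "T \<in> N" shows "S * T \<in> N"
proof -
  obtain F H where F: "F \<in> FS" "S = Q F" and H: "H \<in> FS" "T = Q H" using assms by (auto simp: N_def)
  have "q a * Q H \<in> N" if "a \<in> carrier B" for a
    unfolding mult_Q using that FS_D[OF H(1)] by (intro N_series q_mult_in_N) auto
  then show ?thesis
    unfolding F(2) H(2) Q_mult using F by (intro N_series) (auto simp: FS_D)
qed

text \<open>
  The product of operators, transported to the formal series over the crossed product. It exists
  because N is closed under products and is unique because Q is injective.
\<close>

definition star :: "(nat \<Rightarrow> 'g \<Rightarrow> 'v \<Rightarrow> real) \<Rightarrow> (nat \<Rightarrow> 'g \<Rightarrow> 'v \<Rightarrow> real) \<Rightarrow> nat \<Rightarrow> 'g \<Rightarrow> 'v \<Rightarrow> real" where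
  "star F H = inv_into FS Q (Q F * Q H)"

lemma star: assumes "F \<in> FS" "H \<in> FS" shows "star F H \<in> FS" "Q (star F H) = Q F * Q H"
proof -
  have "Q F * Q H \<in> Q ` FS" using N_mult[OF N_I N_I] assms by (simp add: N_def)
  then show "star F H \<in> FS" "Q (star F H) = Q F * Q H"
    unfolding star_def by (rule inv_into_into, rule f_inv_into_f)
qed

end

section \<open>Hochschild cochains of low degree\<close>

text \<open>
  The faithful linear representation L allows identities between elements of the carrier to be checked
  in a ring type.
\<close>

locale represented_algebra = abelian_group B
  for B :: "(real, 'b) module" (structure) +
  fixes L :: "'b \<Rightarrow> 'r::real_algebra_1"
  assumes mult_closed: "x \<in> carrier B \<Longrightarrow> y \<in> carrier B \<Longrightarrow> x \<otimes> y \<in> carrier B"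
    and smult_closed: "x \<in> carrier B \<Longrightarrow> c \<odot> x \<in> carrier B"
    and L_add: "x \<in> carrier B \<Longrightarrow> y \<in> carrier B \<Longrightarrow> L (x \<oplus> y) = L x + L y"
    and L_mult: "x \<in> carrier B \<Longrightarrow> y \<in> carrier B \<Longrightarrow> L (x \<otimes> y) = L x * L y"
    and L_smult: "x \<in> carrier B \<Longrightarrow> L (c \<odot> x) = c *\<^sub>R L x"
    and L_inj: "x \<in> carrier B \<Longrightarrow> y \<in> carrier B \<Longrightarrow> L x = L y \<Longrightarrow> x = y"
begin

lemma L_zero: "L \<zero> = 0"
  using L_add[of \<zero> \<zero>] by simp

lemma L_neg: "x \<in> carrier B \<Longrightarrow> L (\<ominus> x) = - L x"
  using L_add[of "\<ominus> x" x] by (simp add: l_neg L_zero eq_neg_iff_add_eq_0)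

lemma L_minus: "x \<in> carrier B \<Longrightarrow> y \<in> carrier B \<Longrightarrow> L (x \<ominus> y) = L x - L y"
  by (simp add: a_minus_def L_add L_neg)

lemma L_finsum: "finite A \<Longrightarrow> f \<in> A \<rightarrow> carrier B \<Longrightarrow> L (finsum B f A) = (\<Sum>i\<in>A. L (f i))"
  by (induction A rule: finite_induct) (auto simp: L_zero L_add)

lemmas L_hom = L_zero L_add L_mult L_smult L_neg L_minus
lemmas closed = mult_closed smult_closed minus_closed

lemma B_distrib:
  assumes "x \<in> carrier B" "y \<in> carrier B" "z \<in> carrier B"
  shows "(x \<oplus> y) \<otimes> z = x \<otimes> z \<oplus> y \<otimes> z" "z \<otimes> (x \<oplus> y) = z \<otimes> x \<oplus> z \<otimes> y"
    "(c \<odot> x) \<otimes> z = c \<odot> (x \<otimes> z)" "z \<otimes> (c \<odot> x) = c \<odot> (z \<otimes> x)"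
    "(x \<otimes> y) \<otimes> z = x \<otimes> (y \<otimes> z)"
  by (rule L_inj; use assms in \<open>simp add: L_hom closed algebra_simps\<close>)+

definition bilin :: "('b \<Rightarrow> 'b \<Rightarrow> 'b) \<Rightarrow> bool" where
  "bilin c \<longleftrightarrow> (\<forall>x\<in>carrier B. \<forall>y\<in>carrier B. \<forall>z\<in>carrier B. \<forall>r. c x z \<in> carrier B \<and>
     c (x \<oplus> y) z = c x z \<oplus> c y z \<and> c z (x \<oplus> y) = c z x \<oplus> c z y \<and>
     c (r \<odot> x) z = r \<odot> c x z \<and> c z (r \<odot> x) = r \<odot> c z x)"

lemma bilin_D:
  assumes "bilin c" "x \<in> carrier B" "y \<in> carrier B" "z \<in> carrier B"
  shows "c x y \<in> carrier B" "c (x \<oplus> y) z = c x z \<oplus> c y z" "c z (x \<oplus> y) = c z x \<oplus> c z y"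
    "c (r \<odot> x) z = r \<odot> c x z" "c z (r \<odot> x) = r \<odot> c z x"
  using assms unfolding bilin_def by blast+

lemma args_2: "as \<in> args B 2 \<longleftrightarrow> (\<exists>x\<in>carrier B. \<exists>y\<in>carrier B. as = [x, y])"
  by (auto simp: args_def numeral_2_eq_2 length_Suc_conv)

lemma args_3: "as \<in> args B 3 \<longleftrightarrow> (\<exists>x\<in>carrier B. \<exists>y\<in>carrier B. \<exists>z\<in>carrier B. as = [x, y, z])"
  by (auto simp: args_def numeral_3_eq_3 length_Suc_conv)

lemma bilin_cochain: "bilin c \<Longrightarrow> (\<lambda>as. c (as ! 0) (as ! 1)) \<in> cochains B 2"
  unfolding cochains_def using bilin_D by (auto simp: args_2 less_2_cases_iff)

lemma cochain_bilin:
  assumes "\<Psi> \<in> cochains B 2" shows "bilin (\<lambda>x y. \<Psi> [x, y])"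
proof -
  have \<Psi>: "\<Psi> as \<in> carrier B \<and> (\<forall>i<2. \<forall>x\<in>carrier B. \<forall>y\<in>carrier B. \<forall>c.
        \<Psi> (as[i := x \<oplus> y]) = \<Psi> (as[i := x]) \<oplus> \<Psi> (as[i := y]) \<and> \<Psi> (as[i := c \<odot> x]) = c \<odot> \<Psi> (as[i := x]))"
    if "as \<in> args B 2" for as using assms that unfolding cochains_def by blast
  show ?thesis
    unfolding bilin_def
  proof (intro ballI allI conjI)
    fix x y z r assume c: "x \<in> carrier B" "y \<in> carrier B" "z \<in> carrier B"
    then have xz: "[x, z] \<in> args B 2" "[z, x] \<in> args B 2" by (auto simp: args_2)
    show "\<Psi> [x, z] \<in> carrier B" using \<Psi>[OF xz(1)] by blast
    show "\<Psi> [x \<oplus> y, z] = \<Psi> [x, z] \<oplus> \<Psi> [y, z]" "\<Psi> [r \<odot> x, z] = r \<odot> \<Psi> [x, z]"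
      using \<Psi>[OF xz(1)] c by (auto dest!: spec[of _ 0])
    show "\<Psi> [z, x \<oplus> y] = \<Psi> [z, x] \<oplus> \<Psi> [z, y]" "\<Psi> [z, r \<odot> x] = r \<odot> \<Psi> [z, x]"
      using \<Psi>[OF xz(2)] c by (auto dest!: spec[of _ 1])
  qed
qed

lemma cochain_1_linear:
  assumes "\<eta> \<in> cochains B 1" "x \<in> carrier B" "y \<in> carrier B"
  shows "\<eta> [x] \<in> carrier B" "\<eta> [x \<oplus> y] = \<eta> [x] \<oplus> \<eta> [y]" "\<eta> [c \<odot> x] = c \<odot> \<eta> [x]"
proof -
  have "[x] \<in> args B 1" using assms by (simp add: args_def)
  then have \<eta>: "\<eta> [x] \<in> carrier B \<and> (\<forall>i<1. \<forall>x'\<in>carrier B. \<forall>y\<in>carrier B. \<forall>c.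
        \<eta> ([x][i := x' \<oplus> y]) = \<eta> ([x][i := x']) \<oplus> \<eta> ([x][i := y]) \<and> \<eta> ([x][i := c \<odot> x']) = c \<odot> \<eta> ([x][i := x']))"
    using assms(1) unfolding cochains_def by blast
  then show "\<eta> [x] \<in> carrier B" "\<eta> [x \<oplus> y] = \<eta> [x] \<oplus> \<eta> [y]" "\<eta> [c \<odot> x] = c \<odot> \<eta> [x]"
    using assms(2,3) by auto
qed

lemma hochschild_diff_1:
  assumes "\<eta> \<in> cochains B 1" "x \<in> carrier B" "y \<in> carrier B"
  shows "hochschild_diff B 1 \<eta> [x, y] \<in> carrier B"
    "L (hochschild_diff B 1 \<eta> [x, y]) = L x * L (\<eta> [y]) - L (\<eta> [x \<otimes> y]) + L (\<eta> [x]) * L y"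
proof -
  note c = cochain_1_linear(1)[OF assms(1)] assms(2,3)
  show "hochschild_diff B 1 \<eta> [x, y] \<in> carrier B"
    unfolding hochschild_diff_def by (auto intro!: add.m_closed finsum_closed closed c)
  show "L (hochschild_diff B 1 \<eta> [x, y]) = L x * L (\<eta> [y]) - L (\<eta> [x \<otimes> y]) + L (\<eta> [x]) * L y"
    unfolding hochschild_diff_def using c by (simp add: L_hom L_finsum closed)
qed

lemma hochschild_diff_2:
  assumes \<Psi>: "\<Psi> \<in> cochains B 2" and "x \<in> carrier B" "y \<in> carrier B" "z \<in> carrier B"
  shows "hochschild_diff B 2 \<Psi> [x, y, z] \<in> carrier B"
    "L (hochschild_diff B 2 \<Psi> [x, y, z]) =
      L x * L (\<Psi> [y, z]) - L (\<Psi> [x \<otimes> y, z]) + L (\<Psi> [x, y \<otimes> z]) - L (\<Psi> [x, y]) * L z"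
proof -
  note c = bilin_D(1)[OF cochain_bilin[OF \<Psi>]] assms(2-4)
  have two: "{..<2::nat} = {0, 1}" by auto
  show "hochschild_diff B 2 \<Psi> [x, y, z] \<in> carrier B"
    unfolding hochschild_diff_def two by (auto intro!: add.m_closed finsum_closed closed c)
  show "L (hochschild_diff B 2 \<Psi> [x, y, z]) =
      L x * L (\<Psi> [y, z]) - L (\<Psi> [x \<otimes> y, z]) + L (\<Psi> [x, y \<otimes> z]) - L (\<Psi> [x, y]) * L z"
    unfolding hochschild_diff_def two using c by (simp add: L_hom L_finsum closed)
qed

lemma bracket_2_2:
  assumes \<Psi>: "\<Psi> \<in> cochains B 2" and "x \<in> carrier B" "y \<in> carrier B" "z \<in> carrier B"
  shows "gerstenhaber_bracket B 2 2 \<Psi> \<Psi> [x, y, z] =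
    2 \<odot> (\<Psi> [\<Psi> [x, y], z] \<oplus> (-1) \<odot> \<Psi> [x, \<Psi> [y, z]])"
proof -
  note c = bilin_D(1)[OF cochain_bilin[OF \<Psi>]] assms(2-4)
  have two: "{..<2::nat} = {0, 1}" by auto
  have circ: "gerstenhaber_circ B 2 2 \<Psi> \<Psi> [x, y, z] = \<Psi> [\<Psi> [x, y], z] \<oplus> (-1) \<odot> \<Psi> [x, \<Psi> [y, z]]"
  proof (rule L_inj)
    show "gerstenhaber_circ B 2 2 \<Psi> \<Psi> [x, y, z] \<in> carrier B"
      unfolding gerstenhaber_circ_def two by (auto intro!: finsum_closed closed c)
    show "L (gerstenhaber_circ B 2 2 \<Psi> \<Psi> [x, y, z]) = L (\<Psi> [\<Psi> [x, y], z] \<oplus> (-1) \<odot> \<Psi> [x, \<Psi> [y, z]])"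
      unfolding gerstenhaber_circ_def two using c by (simp add: L_hom L_finsum closed)
  qed (use c in \<open>auto intro!: add.m_closed closed\<close>)
  show ?thesis
    unfolding gerstenhaber_bracket_def circ
    by (rule L_inj) (use c in \<open>simp_all add: L_hom closed scaleR_2\<close>)
qed

text \<open>
  Associativity in the second order says that the bracket of c1 with itself is twice the differential
  of c2. Another representative of the class of c1 is obtained by subtracting the coboundary of some e;
  it is the first order part of the deformation transported along the linear automorphism
  1 - t e of formal series in t, whose second order part again gives a primitive of the bracket.
\<close>

lemma second_order_deformation:
  assumes c1: "bilin c1" and c2: "bilin c2"
    and assoc1: "\<And>x y z. x \<in> carrier B \<Longrightarrow> y \<in> carrier B \<Longrightarrow> z \<in> carrier B \<Longrightarrow>
      c1 (x \<otimes> y) z \<oplus> c1 x y \<otimes> z = c1 x (y \<otimes> z) \<oplus> x \<otimes> c1 y z"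
    and assoc2: "\<And>x y z. x \<in> carrier B \<Longrightarrow> y \<in> carrier B \<Longrightarrow> z \<in> carrier B \<Longrightarrow>
      c2 (x \<otimes> y) z \<oplus> c1 (c1 x y) z \<oplus> c2 x y \<otimes> z = c2 x (y \<otimes> z) \<oplus> c1 x (c1 y z) \<oplus> x \<otimes> c2 y z"
  shows "(\<lambda>as. c1 (as ! 0) (as ! 1)) \<in> cocycles B 2"
    and "noncommutative_poisson B (cohomologous B 2 `` {\<lambda>as. c1 (as ! 0) (as ! 1)})"
proof -
  let ?\<Psi>0 = "\<lambda>as. c1 (as ! 0) (as ! 1)"
  note c1_D = bilin_D[OF c1] and c2_D = bilin_D[OF c2]
  show cocycle: "?\<Psi>0 \<in> cocycles B 2"
  proof -
    have "hochschild_diff B 2 ?\<Psi>0 as = \<zero>" if as3: "as \<in> args B 3" for as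
    proof -
      obtain x y z where as: "as = [x, y, z]" and c: "x \<in> carrier B" "y \<in> carrier B" "z \<in> carrier B"
        using as3 by (auto simp: args_3)
      show ?thesis
        unfolding as
      proof (rule L_inj)
        have "L (c1 (x \<otimes> y) z) = L (c1 x (y \<otimes> z)) + L x * L (c1 y z) - L (c1 x y) * L z"
          using arg_cong[OF assoc1[OF c], of L] c by (simp add: L_hom c1_D closed eq_diff_eq)
        then show "L (hochschild_diff B 2 ?\<Psi>0 [x, y, z]) = L \<zero>"
          using hochschild_diff_2(2)[OF bilin_cochain[OF c1] c] by (simp add: L_zero)
      qed (use hochschild_diff_2(1)[OF bilin_cochain[OF c1] c] in simp_all)
    qed
    then show ?thesis using bilin_cochain[OF c1] by (simp add: cocycles_def numeral_3_eq_3)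
  qed
  show "noncommutative_poisson B (cohomologous B 2 `` {?\<Psi>0})"
    unfolding noncommutative_poisson_def
  proof (intro conjI ballI)
    show "cohomologous B 2 `` {?\<Psi>0} \<in> HH B 2"
      unfolding HH_def by (rule quotientI) (rule cocycle)
    fix \<Psi> assume "\<Psi> \<in> cohomologous B 2 `` {?\<Psi>0}"
    then obtain \<eta> where \<Psi>: "\<Psi> \<in> cochains B 2" and \<eta>: "\<eta> \<in> cochains B 1"
      and diff: "\<And>as. as \<in> args B 2 \<Longrightarrow> ?\<Psi>0 as \<ominus> \<Psi> as = hochschild_diff B 1 \<eta> as"
      by (auto simp: cohomologous_def coboundaries_def cocycles_def numeral_2_eq_2)
    define e where "e x = \<eta> [x]" for x
    note e_D = cochain_1_linear[OF \<eta>, folded e_def]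
    note \<Psi>_D = bilin_D[OF cochain_bilin[OF \<Psi>]]
    have \<Psi>_eq: "\<Psi> [x, y] = c1 x y \<oplus> (-1) \<odot> (x \<otimes> e y) \<oplus> e (x \<otimes> y) \<oplus> (-1) \<odot> (e x \<otimes> y)"
      if c: "x \<in> carrier B" "y \<in> carrier B" for x y
    proof (rule L_inj)
      have "L (c1 x y \<ominus> \<Psi> [x, y]) = L (hochschild_diff B 1 \<eta> [x, y])"
        using diff[of "[x, y]"] c by (simp add: args_2)
      then show "L (\<Psi> [x, y]) = L (c1 x y \<oplus> (-1) \<odot> (x \<otimes> e y) \<oplus> e (x \<otimes> y) \<oplus> (-1) \<odot> (e x \<otimes> y))"
        using c hochschild_diff_1(2)[OF \<eta> c]
        by (simp add: L_hom closed c1_D \<Psi>_D e_D algebra_simps flip: e_def)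
    qed (use c in \<open>simp_all add: closed c1_D \<Psi>_D e_D\<close>)
    \<comment> \<open>Twice the second order part of the transported product.\<close>
    define d where "d x y = 2 \<odot> (c2 x y \<oplus> (-1) \<odot> c1 (e x) y \<oplus> (-1) \<odot> c1 x (e y) \<oplus> e x \<otimes> e y
      \<oplus> e (c1 x y) \<oplus> (-1) \<odot> e (e x \<otimes> y) \<oplus> (-1) \<odot> e (x \<otimes> e y) \<oplus> e (e (x \<otimes> y)))" for x y
    have d: "bilin d"
      unfolding bilin_def
    proof (intro ballI allI conjI)
      fix x y z r assume c: "x \<in> carrier B" "y \<in> carrier B" "z \<in> carrier B"
      show "d x z \<in> carrier B" using c by (simp add: d_def closed c1_D c2_D e_D)
      show "d (x \<oplus> y) z = d x z \<oplus> d y z" "d z (x \<oplus> y) = d z x \<oplus> d z y"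
         "d (r \<odot> x) z = r \<odot> d x z" "d z (r \<odot> x) = r \<odot> d z x"
        by (rule L_inj; use c in \<open>simp add: d_def closed c1_D c2_D e_D B_distrib L_hom algebra_simps\<close>)+
    qed
    let ?d = "\<lambda>as. d (as ! 0) (as ! 1)"
    have d_cochain: "?d \<in> cochains B 2" by (rule bilin_cochain[OF d])
    have bracket: "gerstenhaber_bracket B 2 2 \<Psi> \<Psi> [x, y, z] = hochschild_diff B 2 ?d [x, y, z]"
      if c: "x \<in> carrier B" "y \<in> carrier B" "z \<in> carrier B" for x y z
    proof (rule L_inj)
      \<comment> \<open>The associators of the given deformation in the orders 1 and 2.\<close>
      define A1 where "A1 x y z = c1 (x \<otimes> y) z \<oplus> c1 x y \<otimes> z \<oplus> (-1) \<odot> (c1 x (y \<otimes> z) \<oplus> x \<otimes> c1 y z)" for x y z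
      define A2 where "A2 = c2 (x \<otimes> y) z \<oplus> c1 (c1 x y) z \<oplus> c2 x y \<otimes> z
        \<oplus> (-1) \<odot> (c2 x (y \<otimes> z) \<oplus> c1 x (c1 y z) \<oplus> x \<otimes> c2 y z)"
      have A1: "A1 x y z = \<zero>" if "x \<in> carrier B" "y \<in> carrier B" "z \<in> carrier B" for x y z
        unfolding A1_def assoc1[OF that]
        by (rule L_inj) (use that in \<open>simp_all add: closed c1_D L_hom\<close>)
      have A2: "A2 = \<zero>"
        unfolding A2_def assoc2[OF c]
        by (rule L_inj) (use c in \<open>simp_all add: closed c1_D c2_D L_hom\<close>)
      have e0: "e \<zero> = \<zero>"
      proof (rule L_inj)
        have "L (e (\<zero> \<oplus> \<zero>)) = L (e \<zero>) + L (e \<zero>)"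
          by (simp only: e_D(2)[OF zero_closed zero_closed] L_add e_D(1)[OF zero_closed zero_closed])
        then show "L (e \<zero>) = L \<zero>" by (simp add: L_zero)
      qed (simp_all add: e_D(1)[OF zero_closed zero_closed])
      have "L (gerstenhaber_bracket B 2 2 \<Psi> \<Psi> [x, y, z]) - L (hochschild_diff B 2 ?d [x, y, z])
        = 2 *\<^sub>R (L A2 - L (A1 (e x) y z) - L (A1 x (e y) z) - L (A1 x y (e z)) + L (e (A1 x y z)))"
        unfolding bracket_2_2[OF \<Psi> c] hochschild_diff_2(2)[OF d_cochain c] A1_def A2_def
        using c
        by (simp add: \<Psi>_eq d_def closed c1_D c2_D e_D B_distrib L_hom)
           (simp add: algebra_simps scaleR_2)
      then show "L (gerstenhaber_bracket B 2 2 \<Psi> \<Psi> [x, y, z]) = L (hochschild_diff B 2 ?d [x, y, z])"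
        using c by (simp add: A1 A2 e0 e_D L_hom)
    qed (use c hochschild_diff_2(1)[OF d_cochain c] in \<open>simp_all add: bracket_2_2[OF \<Psi>] closed \<Psi>_D\<close>)
    have "gerstenhaber_bracket B 2 2 \<Psi> \<Psi> \<in> cochains B 3"
    proof -
      let ?g = "gerstenhaber_bracket B 2 2 \<Psi> \<Psi>"
      have three: "(\<forall>i<3. P i) \<longleftrightarrow> P 0 \<and> P 1 \<and> P (2::nat)" for P
        by (auto simp: less_Suc_eq numeral_3_eq_3 numeral_2_eq_2)
      have "?g [x, y, z] \<in> carrier B \<and>
        (\<forall>i<3. \<forall>u\<in>carrier B. \<forall>v\<in>carrier B. \<forall>r. ?g ([x, y, z][i := u \<oplus> v]) = ?g ([x, y, z][i := u]) \<oplus> ?g ([x, y, z][i := v]) \<and>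
           ?g ([x, y, z][i := r \<odot> u]) = r \<odot> ?g ([x, y, z][i := u]))"
        if c: "x \<in> carrier B" "y \<in> carrier B" "z \<in> carrier B" for x y z
        unfolding three
      proof (intro conjI ballI allI)
        fix u v r assume uv: "u \<in> carrier B" "v \<in> carrier B"
        show "?g ([x, y, z][0 := u \<oplus> v]) = ?g ([x, y, z][0 := u]) \<oplus> ?g ([x, y, z][0 := v])"
          "?g ([x, y, z][0 := r \<odot> u]) = r \<odot> ?g ([x, y, z][0 := u])"
          "?g ([x, y, z][1 := u \<oplus> v]) = ?g ([x, y, z][1 := u]) \<oplus> ?g ([x, y, z][1 := v])"
          "?g ([x, y, z][1 := r \<odot> u]) = r \<odot> ?g ([x, y, z][1 := u])"
          "?g ([x, y, z][2 := u \<oplus> v]) = ?g ([x, y, z][2 := u]) \<oplus> ?g ([x, y, z][2 := v])"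
          "?g ([x, y, z][2 := r \<odot> u]) = r \<odot> ?g ([x, y, z][2 := u])"
          by (rule L_inj; use c uv in \<open>simp add: bracket_2_2[OF \<Psi>] closed \<Psi>_D L_hom algebra_simps\<close>)+
      qed (use c in \<open>simp add: bracket_2_2[OF \<Psi>] closed \<Psi>_D\<close>)
      then show ?thesis unfolding cochains_def by (auto simp: args_3)
    qed
    then show "gerstenhaber_bracket B 2 2 \<Psi> \<Psi> \<in> coboundaries B 3"
      using d_cochain bracket by (auto simp: coboundaries_def numeral_3_eq_3 args_3[unfolded numeral_3_eq_3] numeral_2_eq_2
          intro!: bexI[of _ ?d])
  qed
qed

end

lemma sum_permutes_2:
  "(\<Sum>\<sigma> | \<sigma> permutes {..<2::nat}. F \<sigma>) = F id + F (Transposition.transpose 0 1)"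
proof -
  have "{..<2::nat} = {0, 1}" by auto
  then have "{\<sigma>. \<sigma> permutes {..<2::nat}} = {id, Transposition.transpose 0 1}"
    by (auto simp: permutes_doubleton_iff)
  moreover have "(id :: nat \<Rightarrow> nat) \<noteq> Transposition.transpose 0 1"
    by (metis id_apply transpose_apply_first zero_neq_one)
  ultimately show ?thesis by simp
qed

section \<open>The star product is a deformation quantization\<close>

context deformed_coordinates
begin

sublocale B: represented_algebra B L
proof -
  have "abelian_group B"
  proof (rule abelian_groupI)
    fix x assume x: "x \<in> carrier B"
    show "\<exists>y\<in>carrier B. y \<oplus>\<^bsub>B\<^esub> x = \<zero>\<^bsub>B\<^esub>"
      by (rule bexI[of _ "(-1) \<odot>\<^bsub>B\<^esub> x"]) (simp_all add: B_closed(4) x, simp add: B_ops)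
  qed (simp_all add: B_closed, simp_all add: B_ops add_ac)
  then interpret abelian_group B .
  show "represented_algebra B L"
    by unfold_locales (simp_all add: B_closed L_simps L_inject)
qed

lemma finsum_pointwise:
  "finite A \<Longrightarrow> f \<in> A \<rightarrow> carrier B \<Longrightarrow> finsum B f A = (\<lambda>g x. \<Sum>i\<in>A. f i g x)"
proof (induction A rule: finite_induct)
  case (insert i A)
  then have "finsum B f (insert i A) = f i \<oplus>\<^bsub>B\<^esub> finsum B f A" by (intro B.finsum_insert) auto
  with insert show ?case by (simp add: B_ops)
qed (simp add: B_ops)

text \<open>
  Formal power series with real coefficients as central operator series.
\<close>

definition scalar_series :: "real fps \<Rightarrow> 'v polyfun endo fps" where
  "scalar_series c = Abs_fps (\<lambda>n. fps_nth c n *\<^sub>R 1)"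

lemma scalar_series_central: "T * scalar_series c = scalar_series c * T"
  unfolding scalar_series_def
proof (rule fps_ext)
  fix m
  have "(\<Sum>i\<le>m. fps_nth c (m - i) *\<^sub>R fps_nth T i) = (\<Sum>i\<le>m. fps_nth c i *\<^sub>R fps_nth T (m - i))"
    by (rule sum.reindex_bij_witness[of _ "\<lambda>i. m - i" "\<lambda>i. m - i"]) auto
  then show "fps_nth (T * Abs_fps (\<lambda>n. fps_nth c n *\<^sub>R 1)) m = fps_nth (Abs_fps (\<lambda>n. fps_nth c n *\<^sub>R 1) * T) m"
    by (simp add: fps_mult_nth atLeast0AtMost)
qed

lemma smult_FS:
  assumes F: "F \<in> FS"
  shows "fseries_smult B c F \<in> FS" "Q (fseries_smult B c F) = scalar_series c * Q F"
proof -
  let ?T = "\<lambda>i. \<lambda>m. fps_nth c i \<odot>\<^bsub>B\<^esub> F m"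
  have T: "?T i \<in> FS" for i using F by (rule FS_scale)
  have eq: "fseries_smult B c F = (\<lambda>k g x. \<Sum>i\<le>k. ?T i (k - i) g x)"
    unfolding fseries_smult_def by (rule ext) (simp add: finsum_pointwise B_closed FS_D[OF F])
  show "fseries_smult B c F \<in> FS"
    unfolding eq by (rule Q_series(1)[OF T])
  show "Q (fseries_smult B c F) = scalar_series c * Q F"
    unfolding eq Q_series(2)[OF T] Q_scale[OF F]
    by (rule fps_ext) (simp add: scalar_series_def fps_mult_nth atLeast0AtMost)
qed

lemma formal_product_star: "formal_product B star"
  unfolding formal_product_def
proof (intro conjI ballI allI)
  fix F F' H K c assume F: "F \<in> FS" and F': "F' \<in> FS" and H: "H \<in> FS" and K: "K \<in> FS"
  show "star F H \<in> FS" using F H by (rule star)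
  note rules = FS_add Q_add star smult_FS F F' H K
  show "star (fseries_add B F F') H = fseries_add B (star F H) (star F' H)"
    by (rule Q_inject) (simp_all add: rules distrib_right)
  show "star H (fseries_add B F F') = fseries_add B (star H F) (star H F')"
    by (rule Q_inject) (simp_all add: rules distrib_left)
  show "star (fseries_smult B c F) H = fseries_smult B c (star F H)"
    by (rule Q_inject) (simp_all add: rules mult.assoc)
  show "star F (fseries_smult B c H) = fseries_smult B c (star F H)"
  proof (rule Q_inject)
    have "Q F * (scalar_series c * Q H) = scalar_series c * (Q F * Q H)"
      using arg_cong[OF scalar_series_central[of "Q F" c], of "\<lambda>T. T * Q H"] by (simp only: mult.assoc)
    then show "Q (star F (fseries_smult B c H)) = Q (fseries_smult B c (star F H))"
      by (simp add: rules)
  qed (simp_all add: rules)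
  show "star (star F H) K = star F (star H K)"
    by (rule Q_inject) (simp_all add: rules mult.assoc)
qed

definition C :: "nat \<Rightarrow> ('g \<Rightarrow> 'v \<Rightarrow> real) \<Rightarrow> ('g \<Rightarrow> 'v \<Rightarrow> real) \<Rightarrow> 'g \<Rightarrow> 'v \<Rightarrow> real" where
  "C k x y = star (fseries_const B x) (fseries_const B y) k"

lemma star_coeff_C: "star_coeff B star k = (\<lambda>as. C k (as ! 0) (as ! 1))"
  by (simp add: star_coeff_def C_def fun_eq_iff)

lemma C_closed: "x \<in> carrier B \<Longrightarrow> y \<in> carrier B \<Longrightarrow> C k x y \<in> carrier B"
  unfolding C_def by (rule FS_D[OF star(1)[OF FS_const FS_const]])

lemma C_bilin: "B.bilin (C k)"
  unfolding B.bilin_def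
proof (intro ballI allI conjI)
  fix x y z r assume c: "x \<in> carrier B" "y \<in> carrier B" "z \<in> carrier B"
  show "C k x z \<in> carrier B" using c by (simp add: C_closed)
  note rules = Q_add Q_scale FS_add FS_scale star FS_const Q_const B_closed q_add q_scale c
  have "star (fseries_const B (x \<oplus>\<^bsub>B\<^esub> y)) (fseries_const B z) =
      fseries_add B (star (fseries_const B x) (fseries_const B z)) (star (fseries_const B y) (fseries_const B z))"
    by (rule Q_inject) (simp_all add: rules distrib_right)
  then show "C k (x \<oplus>\<^bsub>B\<^esub> y) z = C k x z \<oplus>\<^bsub>B\<^esub> C k y z" by (simp add: C_def fseries_add_def)
  have "star (fseries_const B z) (fseries_const B (x \<oplus>\<^bsub>B\<^esub> y)) =
      fseries_add B (star (fseries_const B z) (fseries_const B x)) (star (fseries_const B z) (fseries_const B y))"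
    by (rule Q_inject) (simp_all add: rules distrib_left)
  then show "C k z (x \<oplus>\<^bsub>B\<^esub> y) = C k z x \<oplus>\<^bsub>B\<^esub> C k z y" by (simp add: C_def fseries_add_def)
  have "star (fseries_const B (r \<odot>\<^bsub>B\<^esub> x)) (fseries_const B z) = (\<lambda>m. r \<odot>\<^bsub>B\<^esub> star (fseries_const B x) (fseries_const B z) m)"
    by (rule Q_inject) (simp_all add: rules)
  then show "C k (r \<odot>\<^bsub>B\<^esub> x) z = r \<odot>\<^bsub>B\<^esub> C k x z" by (simp add: C_def)
  have "star (fseries_const B z) (fseries_const B (r \<odot>\<^bsub>B\<^esub> x)) = (\<lambda>m. r \<odot>\<^bsub>B\<^esub> star (fseries_const B z) (fseries_const B x) m)"
    by (rule Q_inject) (simp_all add: rules)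
  then show "C k z (r \<odot>\<^bsub>B\<^esub> x) = r \<odot>\<^bsub>B\<^esub> C k z x" by (simp add: C_def)
qed

lemma C_0: assumes "x \<in> carrier B" "y \<in> carrier B" shows "C 0 x y = x \<otimes>\<^bsub>B\<^esub> y"
proof (rule L_inject)
  have "fps_nth (Q (star (fseries_const B x) (fseries_const B y))) 0 = L x * L y"
    using assms by (simp add: star FS_const Q_const q_nth_0)
  then show "L (C 0 x y) = L (x \<otimes>\<^bsub>B\<^esub> y)"
    using assms by (simp add: C_def Q_def q_nth_0 L_simps)
qed (use assms in \<open>simp_all add: C_closed B_closed\<close>)

text \<open>
  The product is determined by its values on constant series.
\<close>

lemma star_const_right:
  assumes F: "F \<in> FS" and z: "z \<in> carrier B"
  shows "star F (fseries_const B z) = (\<lambda>m g x. \<Sum>i\<le>m. C (m - i) (F i) z g x)"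
proof -
  let ?c = "\<lambda>i. star (fseries_const B (F i)) (fseries_const B z)"
  have c: "?c i \<in> FS" for i using F z by (intro star FS_const) (auto simp: FS_D)
  have "star F (fseries_const B z) = (\<lambda>m g x. \<Sum>i\<le>m. ?c i (m - i) g x)"
    using F z by (intro Q_inject Q_series(1)[OF c] star FS_const, unfold Q_series(2)[OF c])
      (simp_all add: star FS_const FS_D Q_const Q_mult)
  then show ?thesis by (simp add: C_def)
qed

lemma star_const_left:
  assumes F: "F \<in> FS" and z: "z \<in> carrier B"
  shows "star (fseries_const B z) F = (\<lambda>m g x. \<Sum>i\<le>m. C (m - i) z (F i) g x)"
proof -
  let ?c = "\<lambda>i. star (fseries_const B z) (fseries_const B (F i))"
  have c: "?c i \<in> FS" for i using F z by (intro star FS_const) (auto simp: FS_D)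
  have "star (fseries_const B z) F = (\<lambda>m g x. \<Sum>i\<le>m. ?c i (m - i) g x)"
    using F z by (intro Q_inject Q_series(1)[OF c] star FS_const, unfold Q_series(2)[OF c])
      (simp_all add: star FS_const FS_D Q_const mult_Q)
  then show ?thesis by (simp add: C_def)
qed

lemma C_assoc:
  assumes "x \<in> carrier B" "y \<in> carrier B" "z \<in> carrier B"
  shows "(\<Sum>i\<le>m. C (m - i) (C i x y) z g v) = (\<Sum>i\<le>m. C (m - i) x (C i y z) g v)"
proof -
  let ?k = "fseries_const B"
  have "star (star (?k x) (?k y)) (?k z) = star (?k x) (star (?k y) (?k z))"
    by (rule Q_inject) (use assms in \<open>simp_all add: star FS_const mult.assoc\<close>)
  then have "star (star (?k x) (?k y)) (?k z) m g v = star (?k x) (star (?k y) (?k z)) m g v" by simp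
  then show ?thesis
    unfolding star_const_right[OF star(1)[OF FS_const[OF assms(1)] FS_const[OF assms(2)]] assms(3)]
      star_const_left[OF star(1)[OF FS_const[OF assms(2)] FS_const[OF assms(3)]] assms(1)]
    by (simp only: C_def)
qed

definition \<P> :: "(('g \<Rightarrow> 'v \<Rightarrow> real) list \<Rightarrow> 'g \<Rightarrow> 'v \<Rightarrow> real) set" where
  "\<P> = cohomologous B 2 `` {star_coeff B star 1}"

lemma cocycle_C_1: "star_coeff B star 1 \<in> cocycles B 2"
  and noncommutative_poisson_\<P>: "noncommutative_poisson B \<P>"
proof -
  have 1: "C 1 (x \<otimes>\<^bsub>B\<^esub> y) z \<oplus>\<^bsub>B\<^esub> C 1 x y \<otimes>\<^bsub>B\<^esub> z = C 1 x (y \<otimes>\<^bsub>B\<^esub> z) \<oplus>\<^bsub>B\<^esub> x \<otimes>\<^bsub>B\<^esub> C 1 y z"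
    if c: "x \<in> carrier B" "y \<in> carrier B" "z \<in> carrier B" for x y z
  proof (intro ext)
    fix g v
    show "(C 1 (x \<otimes>\<^bsub>B\<^esub> y) z \<oplus>\<^bsub>B\<^esub> C 1 x y \<otimes>\<^bsub>B\<^esub> z) g v = (C 1 x (y \<otimes>\<^bsub>B\<^esub> z) \<oplus>\<^bsub>B\<^esub> x \<otimes>\<^bsub>B\<^esub> C 1 y z) g v"
      using C_assoc[OF c, of 1 g v] c by (simp add: B_ops(2) C_0 C_closed)
  qed
  have 2: "C 2 (x \<otimes>\<^bsub>B\<^esub> y) z \<oplus>\<^bsub>B\<^esub> C 1 (C 1 x y) z \<oplus>\<^bsub>B\<^esub> C 2 x y \<otimes>\<^bsub>B\<^esub> z
      = C 2 x (y \<otimes>\<^bsub>B\<^esub> z) \<oplus>\<^bsub>B\<^esub> C 1 x (C 1 y z) \<oplus>\<^bsub>B\<^esub> x \<otimes>\<^bsub>B\<^esub> C 2 y z"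
    if c: "x \<in> carrier B" "y \<in> carrier B" "z \<in> carrier B" for x y z
  proof (intro ext)
    fix g v
    have "{..2::nat} = {0, 1, 2}" by auto
    then show "(C 2 (x \<otimes>\<^bsub>B\<^esub> y) z \<oplus>\<^bsub>B\<^esub> C 1 (C 1 x y) z \<oplus>\<^bsub>B\<^esub> C 2 x y \<otimes>\<^bsub>B\<^esub> z) g v
      = (C 2 x (y \<otimes>\<^bsub>B\<^esub> z) \<oplus>\<^bsub>B\<^esub> C 1 x (C 1 y z) \<oplus>\<^bsub>B\<^esub> x \<otimes>\<^bsub>B\<^esub> C 2 y z) g v"
      using C_assoc[OF c, of 2 g v] c by (simp add: B_ops(2) C_0 C_closed)
  qed
  show "star_coeff B star 1 \<in> cocycles B 2"
    unfolding star_coeff_C by (rule B.second_order_deformation(1)[OF C_bilin C_bilin 1 2])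
  show "noncommutative_poisson B \<P>"
    unfolding star_coeff_C \<P>_def by (rule B.second_order_deformation(2)[OF C_bilin C_bilin 1 2])
qed

lemma deformation_quantization_star: "deformation_quantization B \<P> star"
  unfolding deformation_quantization_def
  using formal_product_star cocycle_C_1 by (simp add: star_coeff_C C_0 \<P>_def)

section \<open>The class of the star product\<close>

lemma real_polynomial_affine: "linear \<alpha> \<Longrightarrow> real_polynomial_function (\<lambda>v. \<alpha> v - c)" for \<alpha> :: "'v \<Rightarrow> real"
  by (intro real_polynomial_function_diff linear_real_polynomial real_polynomial_function.intros(2))

abbreviation aff :: "('v \<Rightarrow> real) \<Rightarrow> real \<Rightarrow> 'g \<Rightarrow> 'v \<Rightarrow> real" where
  "aff \<alpha> c \<equiv> cp_term (\<lambda>v. \<alpha> v - c) \<one>"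

lemma q_affine: assumes "linear \<alpha>" shows "q (aff \<alpha> c) = lin Y \<alpha> - c *\<^sub>R 1"
proof -
  have "Polyfun (\<lambda>v. \<alpha> v - c) = cov \<alpha> - c *\<^sub>R 1"
    by (rule polyfun_eqI) (simp add: peval_Polyfun real_polynomial_affine assms)
  then show ?thesis
    by (simp add: q_term linear_diff[OF linear_q0] q0_cov[OF assms] q0_const)
qed

text \<open>
  Normal ordering fixes affine functions up to replacing coordinates by their deformations, so the
  relation between the generators is inherited exactly, without terms of higher order.
\<close>

lemma commutator_affine:
  assumes lin: "linear \<alpha>" "linear \<beta>" and g: "g \<in> carrier G"
  shows "C 1 (aff \<alpha> c) (aff \<beta> d) g v - C 1 (aff \<beta> d) (aff \<alpha> c) g v = \<kappa> g \<alpha> \<beta>"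
proof -
  define k where "k = (\<lambda>g (v::'v). if g \<in> carrier G then \<kappa> g \<alpha> \<beta> else 0)"
  have k: "k \<in> carrier B"
    by (auto simp: k_def B_carrier real_polynomial_function.intros)
  have "q k = fps_const (K \<alpha> \<beta>)"
    by (simp add: q_def k_def Polyfun_ops(3) q0_const K_def fps_const_sum fps_const_scaleR)
  moreover define S where "S = (\<lambda>m::nat. if m = 1 then k else \<zero>\<^bsub>B\<^esub>)"
  have "Q S = fps_X * q k"
  proof (rule fps_ext)
    fix m
    have "(\<Sum>i\<le>m. fps_nth (q (S i)) (m - i)) = (\<Sum>i\<le>m. if i = 1 then fps_nth (q k) (m - 1) else 0)"
      by (intro sum.cong) (auto simp: S_def q_zero)
    then show "fps_nth (Q S) m = fps_nth (fps_X * q k) m" by (auto simp: Q_def)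
  qed
  moreover have S: "S \<in> FS" using k B_closed(1) by (simp add: S_def formal_series_def)
  have "comm (lin Y \<alpha> - c *\<^sub>R 1) (lin Y \<beta> - d *\<^sub>R 1) = comm (lin Y \<alpha>) (lin Y \<beta>)"
    by (simp add: comm_def algebra_simps)
  ultimately have "q (aff \<alpha> c) * q (aff \<beta> d) = Q S + q (aff \<beta> d) * q (aff \<alpha> c)"
    using Y_comm[OF lin] by (simp add: q_affine lin comm_def diff_eq_eq)
  moreover have carr: "aff \<alpha> c \<in> carrier B" "aff \<beta> d \<in> carrier B"
    using lin by (simp_all add: B_closed(5) real_polynomial_affine)
  ultimately have "star (fseries_const B (aff \<alpha> c)) (fseries_const B (aff \<beta> d)) =
      fseries_add B S (star (fseries_const B (aff \<beta> d)) (fseries_const B (aff \<alpha> c)))"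
    by (intro Q_inject) (simp_all add: star FS_const FS_add Q_add Q_const S)
  then show ?thesis
    using g by (simp add: C_def fseries_add_def B_ops S_def k_def)
qed

lemma mult_term_left: "g \<in> carrier G \<Longrightarrow> h \<in> carrier G \<Longrightarrow>
    (cp_term f h \<otimes>\<^bsub>B\<^esub> a) g p = f p * a (inv h \<otimes> g) (\<phi> (inv h) p)"
proof -
  assume gh: "g \<in> carrier G" "h \<in> carrier G"
  have "(cp_term f h \<otimes>\<^bsub>B\<^esub> a) g p =
      (\<Sum>k\<in>carrier G. if k = h then f p * a (inv h \<otimes> g) (\<phi> (inv h) p) else 0)"
    unfolding B_mult[OF gh(1)] by (intro sum.cong) (auto simp: cp_term_def)
  then show ?thesis using gh finite_carrier by simp
qed

lemma mult_term_right: "g \<in> carrier G \<Longrightarrow> h \<in> carrier G \<Longrightarrow>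
    (a \<otimes>\<^bsub>B\<^esub> cp_term f h) g p = a (g \<otimes> inv h) p * f (\<phi> (inv (g \<otimes> inv h)) p)"
proof -
  assume gh: "g \<in> carrier G" "h \<in> carrier G"
  have "inv k \<otimes> g = h \<longleftrightarrow> k = g \<otimes> inv h" if "k \<in> carrier G" for k
    using that gh by (metis inv_closed inv_solve_left inv_solve_right m_closed)
  then have "(a \<otimes>\<^bsub>B\<^esub> cp_term f h) g p = (\<Sum>k\<in>carrier G. if k = g \<otimes> inv h
      then a (g \<otimes> inv h) p * f (\<phi> (inv (g \<otimes> inv h)) p) else 0)"
    unfolding B_mult[OF gh(1)] by (intro sum.cong) (auto simp: cp_term_def)
  then show ?thesis using gh finite_carrier by simp
qed

text \<open>
  Passing to another representative adds the coboundary of a 1-cochain \<eta>. Its product terms vanish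
  because the affine functions vanish at p and at the preimage of p under g, which is p; the remaining
  term is symmetric and drops out of the commutator.
\<close>

lemma commutator_of_representative:
  assumes \<Psi>: "\<Psi> \<in> \<P>" and lin: "linear \<alpha>" "linear \<beta>" and g: "g \<in> carrier G" and p: "\<phi> g p = p"
  shows "\<Psi> [aff \<alpha> (\<alpha> p), aff \<beta> (\<beta> p)] g p - \<Psi> [aff \<beta> (\<beta> p), aff \<alpha> (\<alpha> p)] g p = \<kappa> g \<alpha> \<beta>"
proof -
  from \<Psi> obtain \<eta> where \<Psi>_cochain: "\<Psi> \<in> cochains B 2" and \<eta>: "\<eta> \<in> cochains B 1"
    and diff: "\<And>as. as \<in> args B 2 \<Longrightarrow> star_coeff B star 1 as \<ominus>\<^bsub>B\<^esub> \<Psi> as = hochschild_diff B 1 \<eta> as"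
    by (auto simp: \<P>_def cohomologous_def coboundaries_def cocycles_def numeral_2_eq_2)
  have p': "\<phi> (inv g) p = p" using \<phi>_inv(2)[OF g, of p] p by simp
  have carr: "aff \<alpha> c \<in> carrier B" if "linear \<alpha>" for \<alpha> c
    using that by (simp add: B_closed(5) real_polynomial_affine)
  have minus: "(x \<ominus>\<^bsub>B\<^esub> y) g p = x g p - y g p" if "x \<in> carrier B" "y \<in> carrier B" for x y
  proof -
    have "x \<ominus>\<^bsub>B\<^esub> y = x \<oplus>\<^bsub>B\<^esub> (-1) \<odot>\<^bsub>B\<^esub> y"
      by (rule L_inject) (use that in \<open>simp_all add: B.L_hom B_closed\<close>)
    then show ?thesis by (simp add: B_ops)
  qed
  have eq: "C 1 (aff \<alpha> (\<alpha> p)) (aff \<beta> (\<beta> p)) g p - \<Psi> [aff \<alpha> (\<alpha> p), aff \<beta> (\<beta> p)] g p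
      = - \<eta> [aff \<alpha> (\<alpha> p) \<otimes>\<^bsub>B\<^esub> aff \<beta> (\<beta> p)] g p"
    if lin: "linear \<alpha>" "linear \<beta>" for \<alpha> \<beta>
  proof -
    let ?x = "aff \<alpha> (\<alpha> p)" and ?y = "aff \<beta> (\<beta> p)"
    note c = carr[OF lin(1)] carr[OF lin(2)]
    have "(C 1 ?x ?y \<ominus>\<^bsub>B\<^esub> \<Psi> [?x, ?y]) g p = hochschild_diff B 1 \<eta> [?x, ?y] g p"
      using diff[of "[?x, ?y]"] c by (simp add: star_coeff_C B.args_2)
    also have "(C 1 ?x ?y \<ominus>\<^bsub>B\<^esub> \<Psi> [?x, ?y]) g p = C 1 ?x ?y g p - \<Psi> [?x, ?y] g p"
      using c by (intro minus C_closed B.bilin_D(1)[OF B.cochain_bilin[OF \<Psi>_cochain]]) auto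
    also have "hochschild_diff B 1 \<eta> [?x, ?y] g p = - \<eta> [?x \<otimes>\<^bsub>B\<^esub> ?y] g p"
    proof -
      have "(?x \<otimes>\<^bsub>B\<^esub> \<eta> [?y]) g p = 0"
        using g by (simp add: mult_term_left)
      moreover have "(\<eta> [?x] \<otimes>\<^bsub>B\<^esub> ?y) g p = 0"
        using g p' by (simp add: mult_term_right)
      moreover have "\<eta> [?x \<otimes>\<^bsub>B\<^esub> ?y] \<in> carrier B"
        using B.cochain_1_linear(1)[OF \<eta>] B_closed(3) c by blast
      ultimately show ?thesis
        by (simp add: hochschild_diff_def finsum_pointwise B_closed(4)) (simp add: B_ops(2,3))
    qed
    finally show ?thesis .
  qed
  have "aff \<alpha> (\<alpha> p) \<otimes>\<^bsub>B\<^esub> aff \<beta> (\<beta> p) = aff \<beta> (\<beta> p) \<otimes>\<^bsub>B\<^esub> aff \<alpha> (\<alpha> p)"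
  proof (intro ext)
    fix h v
    show "(aff \<alpha> (\<alpha> p) \<otimes>\<^bsub>B\<^esub> aff \<beta> (\<beta> p)) h v = (aff \<beta> (\<beta> p) \<otimes>\<^bsub>B\<^esub> aff \<alpha> (\<alpha> p)) h v"
      by (cases "h \<in> carrier G") (simp_all add: mult_term_left B_mult_outside \<phi>_one, simp add: cp_term_def)
  qed
  then show ?thesis
    using eq[OF lin] eq[OF lin(2,1)] commutator_affine[OF lin g, of "\<alpha> p" "\<beta> p" p] by simp
qed

lemma restrict_average_value:
  assumes closed: "\<And>h. h \<in> carrier G \<Longrightarrow>
      \<Psi> (map (\<lambda>f. cp_term (poly_act G \<phi> (inv h) f) \<one>) fs) \<in> carrier B" and g: "g \<in> carrier G"
  shows "restrict_average G \<phi> \<Psi> fs g p = (1 / card (carrier G)) * (\<Sum>h\<in>carrier G.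
      \<Psi> (map (\<lambda>f. cp_term (f \<circ> \<phi> h) \<one>) fs) (inv h \<otimes> g \<otimes> h) (\<phi> (inv h) p))"
proof -
  let ?U = "cp_term (\<lambda>x. 1)"
  have act: "poly_act G \<phi> (inv h) f = f \<circ> \<phi> h" if "h \<in> carrier G" for h and f :: "'v \<Rightarrow> real"
    using that by (auto simp: poly_act_def)
  have "(?U h \<otimes>\<^bsub>B\<^esub> a \<otimes>\<^bsub>B\<^esub> ?U (inv h)) g p = a (inv h \<otimes> g \<otimes> h) (\<phi> (inv h) p)"
    if "h \<in> carrier G" for h a
    using g that by (simp add: mult_term_left mult_term_right m_assoc)
  moreover have "(?U h \<otimes>\<^bsub>B\<^esub> a \<otimes>\<^bsub>B\<^esub> ?U (inv h)) \<in> carrier B" if "h \<in> carrier G" "a \<in> carrier B" for h a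
    using that by (intro B_closed) (auto intro: real_polynomial_function.intros)
  ultimately show ?thesis
    unfolding restrict_average_def Let_def
    using closed finite_carrier by (simp add: finsum_pointwise B_ops(3) act cong: sum.cong)
qed

text \<open>
  Conjugation by h moves the evaluation from (g, p) to a conjugate of g and one of its fixed points;
  by invariance of \<kappa> all summands of the average agree.
\<close>

lemma averaged_commutator:
  assumes \<Psi>: "\<Psi> \<in> \<P>" and lin: "linear \<alpha>" "linear \<beta>" and g: "g \<in> carrier G" and p: "\<phi> g p = p"
  shows "restrict_average G \<phi> \<Psi> [\<lambda>v. \<alpha> v - \<alpha> p, \<lambda>v. \<beta> v - \<beta> p] g p
    - restrict_average G \<phi> \<Psi> [\<lambda>v. \<beta> v - \<beta> p, \<lambda>v. \<alpha> v - \<alpha> p] g p = \<kappa> g \<alpha> \<beta>"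
proof -
  have \<Psi>_closed: "\<Psi> [x, y] \<in> carrier B" if "x \<in> carrier B" "y \<in> carrier B" for x y
    using \<Psi> that B.bilin_D(1)[OF B.cochain_bilin[of \<Psi>]]
    by (auto simp: \<P>_def cohomologous_def cocycles_def)
  have avg: "restrict_average G \<phi> \<Psi> [\<lambda>v. \<alpha> v - \<alpha> p, \<lambda>v. \<beta> v - \<beta> p] g p = (1 / card (carrier G)) * (\<Sum>h\<in>carrier G.
      \<Psi> [aff (\<alpha> \<circ> \<phi> h) ((\<alpha> \<circ> \<phi> h) (\<phi> (inv h) p)), aff (\<beta> \<circ> \<phi> h) ((\<beta> \<circ> \<phi> h) (\<phi> (inv h) p))]
        (inv h \<otimes> g \<otimes> h) (\<phi> (inv h) p))" if lin: "linear \<alpha>" "linear \<beta>" for \<alpha> \<beta>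
  proof (subst restrict_average_value[OF _ g])
    fix h assume h: "h \<in> carrier G"
    show "\<Psi> (map (\<lambda>f. cp_term (poly_act G \<phi> (inv h) f) \<one>) [\<lambda>v. \<alpha> v - \<alpha> p, \<lambda>v. \<beta> v - \<beta> p]) \<in> carrier B"
      using h lin by (auto simp: poly_act_def intro!: \<Psi>_closed B_closed(5) real_polynomial_affine linear_comp_\<phi>')
  qed (simp add: \<phi>_inv o_def)
  have "\<Psi> [aff (\<alpha> \<circ> \<phi> h) ((\<alpha> \<circ> \<phi> h) (\<phi> (inv h) p)), aff (\<beta> \<circ> \<phi> h) ((\<beta> \<circ> \<phi> h) (\<phi> (inv h) p))]
        (inv h \<otimes> g \<otimes> h) (\<phi> (inv h) p)
      - \<Psi> [aff (\<beta> \<circ> \<phi> h) ((\<beta> \<circ> \<phi> h) (\<phi> (inv h) p)), aff (\<alpha> \<circ> \<phi> h) ((\<alpha> \<circ> \<phi> h) (\<phi> (inv h) p))]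
        (inv h \<otimes> g \<otimes> h) (\<phi> (inv h) p) = \<kappa> g \<alpha> \<beta>" if h: "h \<in> carrier G" for h
  proof -
    have "\<phi> (inv h \<otimes> g \<otimes> h) (\<phi> (inv h) p) = \<phi> (inv h) p"
      using h g p by (simp add: \<phi>_mult \<phi>_inv)
    from commutator_of_representative[OF \<Psi> _ _ _ this, of "\<alpha> \<circ> \<phi> h" "\<beta> \<circ> \<phi> h"]
    have "\<Psi> [aff (\<alpha> \<circ> \<phi> h) ((\<alpha> \<circ> \<phi> h) (\<phi> (inv h) p)), aff (\<beta> \<circ> \<phi> h) ((\<beta> \<circ> \<phi> h) (\<phi> (inv h) p))]
        (inv h \<otimes> g \<otimes> h) (\<phi> (inv h) p)
      - \<Psi> [aff (\<beta> \<circ> \<phi> h) ((\<beta> \<circ> \<phi> h) (\<phi> (inv h) p)), aff (\<alpha> \<circ> \<phi> h) ((\<alpha> \<circ> \<phi> h) (\<phi> (inv h) p))]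
        (inv h \<otimes> g \<otimes> h) (\<phi> (inv h) p)
      = \<kappa> (inv h \<otimes> g \<otimes> h) (\<alpha> \<circ> \<phi> h) (\<beta> \<circ> \<phi> h)"
      using h g lin linear_comp_\<phi> by blast
    also have "\<dots> = \<kappa> (h \<otimes> (inv h \<otimes> g \<otimes> h) \<otimes> inv h) \<alpha> \<beta>"
      using h g lin by (intro \<kappa>_invariant[symmetric]) auto
    also have "h \<otimes> (inv h \<otimes> g \<otimes> h) \<otimes> inv h = g"
    proof -
      have "h \<otimes> (inv h \<otimes> g \<otimes> h) \<otimes> inv h = (h \<otimes> inv h) \<otimes> g \<otimes> (h \<otimes> inv h)"
        using h g by (simp only: m_assoc inv_closed m_closed)
      then show ?thesis using h g by simp
    qed
    finally show ?thesis .
  qed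
  moreover have "card (carrier G) \<noteq> 0" using finite_carrier by auto
  ultimately show ?thesis
    unfolding avg[OF lin] avg[OF lin(2,1)]
    by (simp flip: right_diff_distrib sum_subtractf diff_divide_distrib)
qed

lemma cocycle_to_multivector_value:
  assumes \<Psi>: "\<Psi> \<in> \<P>" and g: "g \<in> carrier G" and p: "\<phi> g p = p"
  shows "cocycle_to_multivector G \<phi> (b ` {..<n}) 2 \<Psi> g p \<alpha>s =
    (\<Sum>i<n. \<Sum>j<n. \<kappa> g (coord i) (coord j) / 2 * wedge_component G \<phi> g [b i, b j] \<alpha>s)"
proof -
  let ?E = "b ` {..<n}"
  let ?x = "\<lambda>e v. representation ?E v e - representation ?E p e"
  have lists: "{es. length es = 2 \<and> set es \<subseteq> ?E} = (\<lambda>(i, j). [b i, b j]) ` ({..<n} \<times> {..<n})"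
    by (auto simp: numeral_2_eq_2 length_Suc_conv)
  have inj: "inj_on (\<lambda>(i, j). [b i, b j]) ({..<n} \<times> {..<n})"
    using b_inj by (auto simp: inj_on_def)
  have alt: "(\<Sum>\<sigma> | \<sigma> permutes {..<2}. of_int (sign \<sigma>) *
        restrict_average G \<phi> \<Psi> (map (\<lambda>j v. representation ?E v ([b i, b j'] ! \<sigma> j) - representation ?E p ([b i, b j'] ! \<sigma> j)) [0..<2]) g p)
      = \<kappa> g (coord i) (coord j')" for i j'
    using averaged_commutator[OF \<Psi> linear_coord linear_coord g p, of i j']
    unfolding sum_permutes_2 by (simp add: upt_rec numeral_2_eq_2 sign_swap_id coord_def)
  have "cocycle_to_multivector G \<phi> ?E 2 \<Psi> g p \<alpha>s =
      (\<Sum>(i, j)\<in>{..<n} \<times> {..<n}. (1 / fact 2) * \<kappa> g (coord i) (coord j) * wedge_component G \<phi> g [b i, b j] \<alpha>s)"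
    unfolding cocycle_to_multivector_def lists sum.reindex[OF inj] o_def
    by (intro sum.cong) (simp_all add: alt split: prod.splits)
  then show ?thesis by (simp add: sum.cartesian_product fact_numeral)
qed

end

section \<open>Fixed and moving subspaces\<close>

context linear_group_action
begin

interpretation V: finite_dimensional_vector_space "scaleR :: real \<Rightarrow> 'v \<Rightarrow> 'v" "b ` {..<n}"
  rewrites "module.dependent (scaleR :: real \<Rightarrow> 'v \<Rightarrow> 'v) = dependent"
    and "module.subspace (scaleR :: real \<Rightarrow> 'v \<Rightarrow> 'v) = subspace"
    and "module.span (scaleR :: real \<Rightarrow> 'v \<Rightarrow> 'v) = span"
    and "vector_space.dim (scaleR :: real \<Rightarrow> 'v \<Rightarrow> 'v) = dim"
proof -
  have "vector_space (scaleR :: real \<Rightarrow> 'v \<Rightarrow> 'v)" by unfold_locales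
  show "module.dependent (scaleR :: real \<Rightarrow> 'v \<Rightarrow> 'v) = dependent"
    "module.subspace (scaleR :: real \<Rightarrow> 'v \<Rightarrow> 'v) = subspace"
    "module.span (scaleR :: real \<Rightarrow> 'v \<Rightarrow> 'v) = span"
    "vector_space.dim (scaleR :: real \<Rightarrow> 'v \<Rightarrow> 'v) = dim"
    by (simp_all add: dependent_raw_def subspace_raw_def span_raw_def dim_raw_def)
  show "finite_dimensional_vector_space (scaleR :: real \<Rightarrow> 'v \<Rightarrow> 'v) (b ` {..<n})"
    by unfold_locales (use b_independent b_span in \<open>simp_all add: dependent_raw_def span_raw_def\<close>)
qed

lemmas subspace_dim_equal = V.subspace_dim_equal

lemma linear_injective_surjective: "linear f \<Longrightarrow> inj f \<Longrightarrow> surj f" for f :: "'v \<Rightarrow> 'v"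
proof -
  interpret P: finite_dimensional_vector_space_pair "scaleR :: real \<Rightarrow> 'v \<Rightarrow> 'v" "b ` {..<n}"
    "scaleR :: real \<Rightarrow> 'v \<Rightarrow> 'v" "b ` {..<n}" ..
  show "linear f \<Longrightarrow> inj f \<Longrightarrow> surj f" using P.linear_injective_imp_surjective by (simp add: linear_def)
qed

lemma dim_image_\<phi>: "h \<in> carrier G \<Longrightarrow> dim (\<phi> h ` W) = dim W"
proof -
  assume h: "h \<in> carrier G"
  interpret P: finite_dimensional_vector_space_pair_1 "scaleR :: real \<Rightarrow> 'v \<Rightarrow> 'v" "b ` {..<n}"
    "scaleR :: real \<Rightarrow> 'v \<Rightarrow> 'v" ..
  have "inj (\<phi> h)" using inj_on_inverseI[of UNIV "\<phi> (inv h)" "\<phi> h"] \<phi>_inv(2)[OF h] by blast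
  then show ?thesis
    using P.dim_image_eq[of "\<phi> h" W] \<phi>_linear[OF h] inj_on_subset
    by (auto simp: linear_def dim_raw_def span_raw_def)
qed

end

locale cyclic_action = linear_group_action b n G \<phi>
  for b :: "nat \<Rightarrow> 'v::real_normed_vector" and n :: nat and G :: "('g, 'm) monoid_scheme" (structure)
    and \<phi> :: "'g \<Rightarrow> 'v \<Rightarrow> 'v" +
  fixes g :: 'g
  assumes g: "g \<in> carrier G"
begin

definition H :: "'g set" where "H = generate G {g}"

lemma H: "subgroup H G" "g \<in> H" "finite H" "H \<subseteq> carrier G"
proof -
  show "subgroup H G" unfolding H_def using g by (intro generate_is_subgroup) simp
  then show "H \<subseteq> carrier G" by (rule subgroup.subset)
  then show "finite H" using finite_carrier finite_subset by blast
  show "g \<in> H" by (simp add: H_def generate.incl)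
qed

lemma H_closed: "h \<in> H \<Longrightarrow> h \<in> carrier G" "h \<in> H \<Longrightarrow> k \<in> H \<Longrightarrow> h \<otimes> k \<in> H" "h \<in> H \<Longrightarrow> inv h \<in> H"
  using H(1,4) by (auto intro: subgroup.m_closed subgroup.m_inv_closed)

lemma card_H: "card H \<noteq> 0" using H by auto

lemma H_translate:
  assumes k: "k \<in> H"
  shows "(\<Sum>h\<in>H. F (k \<otimes> h)) = (\<Sum>h\<in>H. F h)" "(\<Sum>h\<in>H. F (h \<otimes> k)) = (\<Sum>h\<in>H. F h)"
proof -
  have 1: "inv k \<otimes> (k \<otimes> h) = h" "k \<otimes> (inv k \<otimes> h) = h"
    "h \<otimes> k \<otimes> inv k = h" "h \<otimes> inv k \<otimes> k = h" if "h \<in> H" for h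
    using H_closed(1)[OF that] H_closed(1)[OF k] by (simp_all add: m_assoc) (simp_all flip: m_assoc)
  show "(\<Sum>h\<in>H. F (k \<otimes> h)) = (\<Sum>h\<in>H. F h)"
    by (rule sum.reindex_bij_witness[where i = "\<lambda>h. inv k \<otimes> h" and j = "\<lambda>h. k \<otimes> h"])
      (use k in \<open>auto simp: 1 H_closed\<close>)
  show "(\<Sum>h\<in>H. F (h \<otimes> k)) = (\<Sum>h\<in>H. F h)"
    by (rule sum.reindex_bij_witness[where i = "\<lambda>h. h \<otimes> inv k" and j = "\<lambda>h. h \<otimes> k"])
      (use k in \<open>auto simp: 1 H_closed\<close>)
qed

text \<open>
  The projection onto the fixed space along the moving space.
\<close>

definition e :: "'v \<Rightarrow> 'v" where "e v = (1 / card H) *\<^sub>R (\<Sum>h\<in>H. \<phi> h v)"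

lemma linear_e: "linear e"
  unfolding e_def using H_closed(1) \<phi>_linear
  by (intro linear_compose_scale_right linear_compose_sum) auto

lemma \<phi>_e: "k \<in> H \<Longrightarrow> \<phi> k (e v) = e v" and e_\<phi>: "k \<in> H \<Longrightarrow> e (\<phi> k v) = e v"
proof -
  assume k: "k \<in> H"
  have "\<phi> k (e v) = (1 / card H) *\<^sub>R (\<Sum>h\<in>H. \<phi> (k \<otimes> h) v)"
    using \<phi>_linear[OF H_closed(1)[OF k]] k
    by (simp add: e_def linear_scale linear_sum \<phi>_mult H_closed(1) cong: sum.cong)
  then show "\<phi> k (e v) = e v" by (simp only: H_translate(1)[OF k, of "\<lambda>h. \<phi> h v"] e_def)
  have "e (\<phi> k v) = (1 / card H) *\<^sub>R (\<Sum>h\<in>H. \<phi> (h \<otimes> k) v)"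
    using k by (simp add: e_def \<phi>_mult H_closed(1) cong: sum.cong)
  then show "e (\<phi> k v) = e v" by (simp only: H_translate(2)[OF k, of "\<lambda>h. \<phi> h v"] e_def)
qed

lemma e_of_fixed: "(\<And>h. h \<in> H \<Longrightarrow> \<phi> h v = v) \<Longrightarrow> e v = v"
  using card_H by (simp add: e_def sum_constant_scaleR del: sum_constant)

lemma fixed_by_H: assumes "\<phi> g v = v" "h \<in> H" shows "\<phi> h v = v"
  using assms(2) unfolding H_def
proof (induction rule: generate.induct)
  case one then show ?case by (simp add: \<phi>_one)
next
  case (incl h) then show ?case using assms(1) by simp
next
  case (inv h) then show ?case using assms(1) \<phi>_inv(2)[OF g, of v] by simp
next
  case (eng h k)
  then show ?case using H_closed(1) by (simp add: \<phi>_mult H_def)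
qed

lemma fixed_space_iff: "v \<in> fixed_space \<phi> g \<longleftrightarrow> e v = v"
  using \<phi>_e[OF H(2), of v] e_of_fixed[OF fixed_by_H] by (auto simp: invariants_def)

lemma e_e: "e (e v) = e v"
  by (rule e_of_fixed) (rule \<phi>_e)

lemma subrep_iff: "subrepresentation G \<phi> g W \<longleftrightarrow> subspace W \<and> (\<forall>h\<in>H. \<forall>w\<in>W. \<phi> h w \<in> W)"
  by (simp add: subrepresentation_def H_def)

lemma e_in_subrep: "subrepresentation G \<phi> g W \<Longrightarrow> w \<in> W \<Longrightarrow> e w \<in> W"
  unfolding subrep_iff e_def by (auto intro: subspace_scale subspace_sum)

definition nontrivial_irreducible :: "'v set \<Rightarrow> bool" where
  "nontrivial_irreducible W \<longleftrightarrow> irreducible_subrep G \<phi> g W \<and> (\<exists>h\<in>H. \<exists>w\<in>W. \<phi> h w \<noteq> w)"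

lemma moving_space_eq: "moving_space G \<phi> g = span (\<Union>{W. nontrivial_irreducible W})"
  by (simp add: moving_space_def nontrivial_irreducible_def H_def)

lemma subspace_kernel_e: "subspace {v. e v = 0}"
  using linear_e by (auto simp: subspace_def linear_0 linear_add linear_scale)

text \<open>
  The invariant vectors of an irreducible subrepresentation form a subrepresentation, which is zero if
  the action is not trivial; but e maps the subrepresentation to invariant vectors.
\<close>

lemma e_moving: "v \<in> moving_space G \<phi> g \<Longrightarrow> e v = 0"
proof -
  have "w \<in> {v. e v = 0}" if W: "nontrivial_irreducible W" and w: "w \<in> W" for W w
  proof -
    have irr: "irreducible_subrep G \<phi> g W" and sub: "subrepresentation G \<phi> g W"
      using W by (auto simp: nontrivial_irreducible_def irreducible_subrep_def)
    let ?U = "{x \<in> W. \<forall>k\<in>H. \<phi> k x = x}"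
    have "subrepresentation G \<phi> g ?U"
      using sub \<phi>_linear[OF H_closed(1)] unfolding subrep_iff
      by (auto simp: subspace_def linear_0 linear_add linear_scale)
    then have "?U = {0} \<or> ?U = W" using irr by (auto simp: irreducible_subrep_def)
    moreover have "?U \<noteq> W" using W by (auto simp: nontrivial_irreducible_def)
    moreover have "e w \<in> ?U" using e_in_subrep[OF sub w] \<phi>_e by auto
    ultimately show ?thesis by auto
  qed
  then have "span (\<Union>{W. nontrivial_irreducible W}) \<subseteq> {v. e v = 0}"
    by (intro span_minimal subspace_kernel_e) auto
  then show "v \<in> moving_space G \<phi> g \<Longrightarrow> e v = 0" by (auto simp: moving_space_eq)
qed

lemma subrep_moving: "subrepresentation G \<phi> g (moving_space G \<phi> g)"
  unfolding subrep_iff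
proof (intro conjI ballI)
  show "subspace (moving_space G \<phi> g)" by (simp add: moving_space_eq)
  fix h w assume h: "h \<in> H" and "w \<in> moving_space G \<phi> g"
  then have "w \<in> span (\<Union>{W. nontrivial_irreducible W})" by (simp add: moving_space_eq)
  then have "\<phi> h w \<in> span (\<Union>{W. nontrivial_irreducible W})"
  proof (induction rule: span_induct_alt)
    case base
    then show ?case using linear_0[OF \<phi>_linear[OF H_closed(1)[OF h]]] by (simp add: span_zero)
  next
    case (step c x y)
    then obtain W where W: "nontrivial_irreducible W" "x \<in> W" by blast
    then have "\<phi> h x \<in> W"
      using h by (auto simp: nontrivial_irreducible_def irreducible_subrep_def subrep_iff)
    then have "\<phi> h x \<in> span (\<Union>{W. nontrivial_irreducible W})" using W(1) by (intro span_base) auto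
    then show ?case
      using step \<phi>_linear[OF H_closed(1)[OF h]] by (simp add: linear_add linear_scale span_add span_scale)
  qed
  then show "\<phi> h w \<in> moving_space G \<phi> g" by (simp add: moving_space_eq)
qed

text \<open>
  Averaging a projection onto the moving space over the cyclic group gives an equivariant projection P
  (Maschke). If the kernel of e were larger than the moving space, it would contain nonzero
  subrepresentations killed by P; one of minimal dimension is irreducible and not trivial, hence lies
  in the moving space, where P is the identity.
\<close>

lemma kernel_e_moving: assumes v: "e v = 0" shows "v \<in> moving_space G \<phi> g"
proof (rule ccontr)
  let ?N = "moving_space G \<phi> g"
  assume not: "v \<notin> ?N"
  have N: "subspace ?N" "\<And>h w. h \<in> H \<Longrightarrow> w \<in> ?N \<Longrightarrow> \<phi> h w \<in> ?N"
    using subrep_moving by (auto simp: subrep_iff)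
  obtain D where D: "D \<subseteq> ?N" "independent D" "?N \<subseteq> span D"
    using basis_exists[of ?N] by metis
  obtain p where p: "linear p" "\<forall>x\<in>D. p x = id x" "range p = span (id ` D)"
    using real_vector.linear_independent_extend_subspace[OF D(2), of id] by blast
  have span_D: "span D = ?N" using D N(1) span_minimal by blast
  have p_N: "p w \<in> ?N" for w using p(3) span_D by auto
  have p_id: "p w = w" if "w \<in> ?N" for w
    using linear_eq_on[OF p(1) linear_id, of w D] that D(3) p(2) by auto
  define P where "P w = (1 / card H) *\<^sub>R (\<Sum>h\<in>H. \<phi> h (p (\<phi> (inv h) w)))" for w
  have P_linear: "linear P"
    unfolding P_def
  proof (intro linear_compose_scale_right linear_compose_sum ballI)
    fix h assume h: "h \<in> H"
    have "linear (\<phi> h \<circ> (p \<circ> \<phi> (inv h)))"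
      using h by (intro linear_compose \<phi>_linear p(1)) (auto simp: H_closed)
    then show "linear (\<lambda>w. \<phi> h (p (\<phi> (inv h) w)))" by (simp add: o_def)
  qed
  have P_N: "P w \<in> ?N" for w
    unfolding P_def using N p_N by (intro subspace_scale subspace_sum) auto
  have P_id: "P w = w" if "w \<in> ?N" for w
  proof -
    have "(\<Sum>h\<in>H. \<phi> h (p (\<phi> (inv h) w))) = (\<Sum>h\<in>H. w)"
      using N(2) that by (intro sum.cong) (auto simp: p_id H_closed \<phi>_inv)
    then show ?thesis using card_H by (simp add: P_def sum_constant_scaleR del: sum_constant)
  qed
  have P_\<phi>: "P (\<phi> k w) = \<phi> k (P w)" if k: "k \<in> H" for k w
  proof -
    have kG: "k \<in> carrier G" using k by (rule H_closed)
    have eq: "\<phi> (inv (k \<otimes> h)) (\<phi> k w) = \<phi> (inv h) w" if "h \<in> H" for h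
      using kG H_closed(1)[OF that] by (simp add: inv_mult_group \<phi>_mult \<phi>_inv)
    have "P (\<phi> k w) = (1 / card H) *\<^sub>R (\<Sum>h\<in>H. \<phi> (k \<otimes> h) (p (\<phi> (inv (k \<otimes> h)) (\<phi> k w))))"
      unfolding P_def by (simp only: H_translate(1)[OF k, of "\<lambda>h. \<phi> h (p (\<phi> (inv h) (\<phi> k w)))"])
    also have "\<dots> = (1 / card H) *\<^sub>R (\<Sum>h\<in>H. \<phi> k (\<phi> h (p (\<phi> (inv h) w))))"
      using kG by (simp add: eq \<phi>_mult H_closed(1) cong: sum.cong)
    also have "\<dots> = \<phi> k (P w)"
      using \<phi>_linear[OF kG] by (simp add: P_def linear_scale linear_sum)
    finally show ?thesis .
  qed
  define sub where "sub W \<longleftrightarrow> subrepresentation G \<phi> g W \<and> W \<noteq> {0} \<and> (\<forall>w\<in>W. P w = 0 \<and> e w = 0)" for W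
  have "sub {w. P w = 0 \<and> e w = 0}"
    unfolding sub_def subrep_iff
  proof (intro conjI ballI)
    show "subspace {w. P w = 0 \<and> e w = 0}"
      using P_linear linear_e by (auto simp: subspace_def linear_0 linear_add linear_scale)
    have "P (v - P v) = 0" using P_id[OF P_N] P_linear by (simp add: linear_diff)
    moreover have "e (v - P v) = 0" using v e_moving[OF P_N] linear_e by (simp add: linear_diff)
    moreover have "v - P v \<noteq> 0" using P_N[of v] not by auto
    ultimately show "{w. P w = 0 \<and> e w = 0} \<noteq> {0}" by blast
  qed (use \<phi>_linear[OF H_closed(1)] in \<open>auto simp: P_\<phi> e_\<phi> linear_0\<close>)
  then obtain W where W: "sub W" and least: "\<And>W'. sub W' \<Longrightarrow> dim W \<le> dim W'"
    using ex_has_least_nat[of sub _ dim] by metis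
  have "nontrivial_irreducible W"
    unfolding nontrivial_irreducible_def irreducible_subrep_def
  proof (intro conjI allI impI)
    show "subrepresentation G \<phi> g W" "W \<noteq> {0}" using W by (auto simp: sub_def)
    fix U assume U: "subrepresentation G \<phi> g U \<and> U \<subseteq> W"
    show "U = {0} \<or> U = W"
    proof (cases "U = {0}")
      case False
      then have "dim W \<le> dim U" using U W by (intro least) (auto simp: sub_def)
      then show ?thesis using U W subspace_dim_equal[of U W] by (auto simp: sub_def subrep_iff)
    qed simp
  next
    have "0 \<in> W" using W by (auto simp: sub_def subrep_iff subspace_0)
    then obtain w where w: "w \<in> W" "w \<noteq> 0" using W by (auto simp: sub_def)
    then show "\<exists>h\<in>H. \<exists>w\<in>W. \<phi> h w \<noteq> w"
      using e_of_fixed[of w] W by (auto simp: sub_def)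
  qed
  then have "W \<subseteq> ?N" unfolding moving_space_eq by (intro order_trans[OF _ span_superset]) auto
  then have "w = 0" if "w \<in> W" for w
    using P_id[of w] W that by (auto simp: sub_def)
  then have "W \<subseteq> {0}" by blast
  moreover have "0 \<in> W" using W by (auto simp: sub_def subrep_iff subspace_0)
  ultimately show False using W by (auto simp: sub_def)
qed

lemma moving_space_kernel: "moving_space G \<phi> g = {v. e v = 0}"
  using e_moving kernel_e_moving by blast

lemma moving_part_eq: "moving_part G \<phi> g v = v - e v"
  unfolding moving_part_def
proof (rule the_equality)
  show "v - e v \<in> moving_space G \<phi> g \<and> v - (v - e v) \<in> fixed_space \<phi> g"
    using linear_e e_e by (simp add: moving_space_kernel fixed_space_iff linear_diff)
  fix m assume m: "m \<in> moving_space G \<phi> g \<and> v - m \<in> fixed_space \<phi> g"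
  then have "e (v - m) = v - m" "e m = 0" by (auto simp: moving_space_kernel fixed_space_iff)
  then show "m = v - e v" using linear_e by (simp add: linear_diff)
qed

lemma fixed_part_eq: "fixed_part G \<phi> g v = e v"
  by (simp add: fixed_part_def moving_part_eq)

text \<open>
  For v in the kernel of e, v is the average of all v - h v, and each of these telescopes into terms
  w - g w since h is a product of powers of g.
\<close>

lemma moving_space_range: "moving_space G \<phi> g = range (\<lambda>v. v - \<phi> g v)"
proof
  have sub: "subspace (range (\<lambda>v. v - \<phi> g v))"
    using linear_compose_sub[OF linear_ident \<phi>_linear[OF g]] by (rule linear_subspace_image[OF _ subspace_UNIV])
  have H_range: "v - \<phi> h v \<in> range (\<lambda>v. v - \<phi> g v)" if "h \<in> H" for h v
    using that unfolding H_def
  proof (induction arbitrary: v rule: generate.induct)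
    case one then show ?case using subspace_0[OF sub] by (simp add: \<phi>_one)
  next
    case (incl h) then show ?case by simp
  next
    case (inv h)
    have "\<phi> (inv g) v - \<phi> g (\<phi> (inv g) v) \<in> range (\<lambda>v. v - \<phi> g v)" by blast
    from subspace_neg[OF sub this] show ?case using inv g by (simp add: \<phi>_inv)
  next
    case (eng h k)
    have "h \<in> carrier G" "k \<in> carrier G" using eng.hyps H_closed(1) by (auto simp: H_def)
    then show ?case
      using subspace_add[OF sub eng.IH(2)[of v] eng.IH(1)[of "\<phi> k v"]] by (simp add: \<phi>_mult)
  qed
  show "moving_space G \<phi> g \<subseteq> range (\<lambda>v. v - \<phi> g v)"
  proof
    fix v assume "v \<in> moving_space G \<phi> g"
    then have "(1 / card H) *\<^sub>R (\<Sum>h\<in>H. \<phi> h v) = 0" by (simp add: moving_space_kernel e_def)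
    then have "v = (1 / card H) *\<^sub>R (\<Sum>h\<in>H. v - \<phi> h v)"
      using card_H by (simp add: sum_subtractf scaleR_diff_right sum_constant_scaleR del: sum_constant)
    also have "\<dots> \<in> range (\<lambda>v. v - \<phi> g v)"
      using H_range by (intro subspace_scale[OF sub] subspace_sum[OF sub])
    finally show "v \<in> range (\<lambda>v. v - \<phi> g v)" .
  qed
  show "range (\<lambda>v. v - \<phi> g v) \<subseteq> moving_space G \<phi> g"
    using e_\<phi>[OF H(2)] linear_e by (auto simp: moving_space_kernel linear_diff)
qed

lemma inv_moving: "v - \<phi> (inv g) v \<in> moving_space G \<phi> g"
  using e_\<phi>[OF H_closed(3)[OF H(2)]] linear_e by (auto simp: moving_space_kernel linear_diff)

end

context linear_group_action
begin

lemma cyclic_actionI: "g \<in> carrier G \<Longrightarrow> cyclic_action b n G \<phi> g"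
  by unfold_locales

lemma moving_space_conj:
  assumes g: "g \<in> carrier G" and h: "h \<in> carrier G"
  shows "moving_space G \<phi> (h \<otimes> g \<otimes> inv h) = \<phi> h ` moving_space G \<phi> g"
proof -
  let ?k = "h \<otimes> g \<otimes> inv h"
  have k: "?k \<in> carrier G" using g h by simp
  have "\<phi> h v - \<phi> ?k (\<phi> h v) = \<phi> h (v - \<phi> g v)" for v
    using g h by (simp add: \<phi>_mult \<phi>_inv linear_diff[OF \<phi>_linear])
  then have "(\<lambda>v. v - \<phi> ?k v) ` range (\<phi> h) = \<phi> h ` range (\<lambda>v. v - \<phi> g v)"
    by (simp add: image_image)
  moreover have "range (\<phi> h) = UNIV" using surjI[of "\<phi> h" "\<phi> (inv h)"] \<phi>_inv(1)[OF h] by blast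
  ultimately show ?thesis
    using cyclic_action.moving_space_range[OF cyclic_actionI] g k by simp
qed

lemma codim_fixed_conj:
  "g \<in> carrier G \<Longrightarrow> h \<in> carrier G \<Longrightarrow> codim_fixed G \<phi> (h \<otimes> g \<otimes> inv h) = codim_fixed G \<phi> g"
  by (simp add: codim_fixed_def moving_space_conj dim_image_\<phi>)

lemma moving_space_one: "moving_space G \<phi> \<one> = {0}" "codim_fixed G \<phi> \<one> = 0"
proof -
  have "moving_space G \<phi> \<one> = range (\<lambda>v. v - \<phi> \<one> v)"
    by (rule cyclic_action.moving_space_range[OF cyclic_actionI[OF one_closed]])
  then show one: "moving_space G \<phi> \<one> = {0}" unfolding \<phi>_one by simp
  have "dim {0 :: 'v} = card ({} :: 'v set)"
    by (rule dim_eq_card) (simp_all add: independent_empty)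
  then show "codim_fixed G \<phi> \<one> = 0" by (simp add: codim_fixed_def one)
qed

end

section \<open>Bivectors\<close>

lemma wedge_pair:
  "wedge [u, w] \<alpha>s = (if length \<alpha>s = 2 \<and> (\<forall>\<alpha>\<in>set \<alpha>s. linear \<alpha>)
     then (\<alpha>s ! 0) u * (\<alpha>s ! 1) w - (\<alpha>s ! 0) w * (\<alpha>s ! 1) u else 0)"
proof -
  have "wedge [u, w] \<alpha>s = (if length \<alpha>s = 2 \<and> (\<forall>\<alpha>\<in>set \<alpha>s. linear \<alpha>)
      then \<Sum>\<sigma> | \<sigma> permutes {..<2}. of_int (sign \<sigma>) * (\<Prod>j<2. (\<alpha>s ! j) ([u, w] ! \<sigma> j)) else 0)"
    by (simp add: wedge_def numeral_2_eq_2)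
  then show ?thesis
    unfolding sum_permutes_2 by (simp add: sign_swap_id numeral_2_eq_2 lessThan_Suc)
qed

lemma exterior_2_pair:
  assumes "T \<in> exterior_power 2 W"
  shows "\<exists>I c. finite I \<and> I \<subseteq> W \<times> W \<and> (\<forall>\<alpha>s. T \<alpha>s = (if length \<alpha>s = 2 \<and> (\<forall>\<alpha>\<in>set \<alpha>s. linear \<alpha>)
      then \<Sum>(u, w)\<in>I. c (u, w) * ((\<alpha>s ! 0) u * (\<alpha>s ! 1) w - (\<alpha>s ! 0) w * (\<alpha>s ! 1) u) else 0))"
proof -
  obtain I c where I: "finite I" "I \<subseteq> {ws. length ws = 2 \<and> set ws \<subseteq> W}"
    and T: "T = (\<lambda>\<alpha>s. \<Sum>ws\<in>I. c ws * wedge ws \<alpha>s)"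
    using assms unfolding exterior_power_def by auto
  let ?p = "\<lambda>ws. (ws ! 0, ws ! 1)"
  have ws: "ws = [ws ! 0, ws ! 1]" "ws ! 0 \<in> W" "ws ! 1 \<in> W" if "ws \<in> I" for ws
  proof -
    have "length ws = 2" "set ws \<subseteq> W" using I(2) that by auto
    then show "ws = [ws ! 0, ws ! 1]" "ws ! 0 \<in> W" "ws ! 1 \<in> W"
      by (auto simp: numeral_2_eq_2 length_Suc_conv)
  qed
  have inj: "inj_on ?p I"
  proof (rule inj_onI)
    fix x y assume "x \<in> I" "y \<in> I" "?p x = ?p y"
    then show "x = y" using ws(1)[of x] ws(1)[of y] by simp
  qed
  have "T \<alpha>s = (if length \<alpha>s = 2 \<and> (\<forall>\<alpha>\<in>set \<alpha>s. linear \<alpha>)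
      then \<Sum>(u, w)\<in>?p ` I. c [u, w] * ((\<alpha>s ! 0) u * (\<alpha>s ! 1) w - (\<alpha>s ! 0) w * (\<alpha>s ! 1) u) else 0)" for \<alpha>s
  proof -
    have "T \<alpha>s = (\<Sum>ws\<in>I. c [ws ! 0, ws ! 1] * wedge [ws ! 0, ws ! 1] \<alpha>s)"
      unfolding T using ws(1) by (intro sum.cong) auto
    also have "\<dots> = (\<Sum>(u, w)\<in>?p ` I. c [u, w] * wedge [u, w] \<alpha>s)"
      by (subst sum.reindex[OF inj]) (simp add: o_def)
    finally show ?thesis by (auto simp: wedge_pair intro!: sum.neutral)
  qed
  then show ?thesis
    using I(1) ws(2,3) by (intro exI[of _ "?p ` I"] exI[of _ "\<lambda>(u, w). c [u, w]"]) auto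
qed

context coordinate_space
begin

text \<open>
  The last identity is the vanishing of the alternating 3-form that a bivector in W and a vector of W
  define on the dual of W: a two-dimensional space has no nonzero alternating 3-form.
\<close>

lemma exterior_2_properties:
  assumes T: "T \<in> exterior_power 2 W"
  shows "linear \<beta> \<Longrightarrow> covector_linear (\<lambda>\<alpha>. T [\<alpha>, \<beta>])"
    and "linear \<alpha> \<Longrightarrow> linear \<beta> \<Longrightarrow> T [\<beta>, \<alpha>] = - T [\<alpha>, \<beta>]"
    and "linear \<alpha> \<Longrightarrow> linear \<beta> \<Longrightarrow> linear P \<Longrightarrow> (\<And>w. w \<in> W \<Longrightarrow> P w = w) \<Longrightarrow> T [\<alpha> \<circ> P, \<beta> \<circ> P] = T [\<alpha>, \<beta>]"
    and "\<not> (length \<alpha>s = 2 \<and> (\<forall>\<alpha>\<in>set \<alpha>s. linear \<alpha>)) \<Longrightarrow> T \<alpha>s = 0"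
    and "linear \<alpha> \<Longrightarrow> linear \<beta> \<Longrightarrow> linear \<gamma> \<Longrightarrow> dim W = 2 \<Longrightarrow> x \<in> W \<Longrightarrow>
      T [\<beta>, \<gamma>] * \<alpha> x + T [\<gamma>, \<alpha>] * \<beta> x + T [\<alpha>, \<beta>] * \<gamma> x = 0"
proof -
  obtain I c where I: "finite I" "I \<subseteq> W \<times> W"
    and T: "\<And>\<alpha>s. T \<alpha>s = (if length \<alpha>s = 2 \<and> (\<forall>\<alpha>\<in>set \<alpha>s. linear \<alpha>)
      then \<Sum>(u, w)\<in>I. c (u, w) * ((\<alpha>s ! 0) u * (\<alpha>s ! 1) w - (\<alpha>s ! 0) w * (\<alpha>s ! 1) u) else 0)"
    using exterior_2_pair[OF T] by blast
  have T2: "T [\<alpha>, \<beta>] = (\<Sum>(u, w)\<in>I. c (u, w) * (\<alpha> u * \<beta> w - \<alpha> w * \<beta> u))" if "linear \<alpha>" "linear \<beta>" for \<alpha> \<beta>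
    using that by (simp add: T)
  show "covector_linear (\<lambda>\<alpha>. T [\<alpha>, \<beta>])" if "linear \<beta>"
    unfolding covector_linear_def
    using that by (auto simp: T2 linear_covector_combination sum_distrib_left algebra_simps case_prod_unfold
        simp flip: sum.distrib)
  show "T [\<beta>, \<alpha>] = - T [\<alpha>, \<beta>]" if "linear \<alpha>" "linear \<beta>"
    using that by (simp add: T2 case_prod_unfold algebra_simps flip: sum_negf)
  show "T [\<alpha> \<circ> P, \<beta> \<circ> P] = T [\<alpha>, \<beta>]" if "linear \<alpha>" "linear \<beta>" "linear P" "\<And>w. w \<in> W \<Longrightarrow> P w = w"
  proof -
    have "linear (\<alpha> \<circ> P)" "linear (\<beta> \<circ> P)" using that linear_compose by blast+
    then show ?thesis
      using that I(2) by (auto simp: T2 intro!: sum.cong)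
  qed
  show "\<not> (length \<alpha>s = 2 \<and> (\<forall>\<alpha>\<in>set \<alpha>s. linear \<alpha>)) \<Longrightarrow> T \<alpha>s = 0"
    by (subst T) auto
  show "T [\<beta>, \<gamma>] * \<alpha> x + T [\<gamma>, \<alpha>] * \<beta> x + T [\<alpha>, \<beta>] * \<gamma> x = 0"
    if lin: "linear \<alpha>" "linear \<beta>" "linear \<gamma>" and dim: "dim W = 2" and x: "x \<in> W"
  proof -
    obtain D where D: "W \<subseteq> span D" "card D = 2"
      using basis_exists[of W] dim by metis
    then obtain u1 u2 where "D = {u1, u2}" by (meson card_2_iff)
    then have W: "\<exists>r s. y = r *\<^sub>R u1 + s *\<^sub>R u2" if "y \<in> W" for y
      using D(1) that by (force simp: span_insert span_singleton algebra_simps)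
    obtain r s where x: "x = r *\<^sub>R u1 + s *\<^sub>R u2" using W x by blast
    have "c p * (\<beta> (fst p) * \<gamma> (snd p) - \<beta> (snd p) * \<gamma> (fst p)) * \<alpha> x
        + c p * (\<gamma> (fst p) * \<alpha> (snd p) - \<gamma> (snd p) * \<alpha> (fst p)) * \<beta> x
        + c p * (\<alpha> (fst p) * \<beta> (snd p) - \<alpha> (snd p) * \<beta> (fst p)) * \<gamma> x = 0" if p: "p \<in> I" for p
    proof -
      have pW: "fst p \<in> W" "snd p \<in> W" using I(2) p by (auto simp: mem_Times_iff dest: subsetD)
      obtain r1 s1 where u: "fst p = r1 *\<^sub>R u1 + s1 *\<^sub>R u2" using W[OF pW(1)] by blast
      obtain r2 s2 where w: "snd p = r2 *\<^sub>R u1 + s2 *\<^sub>R u2" using W[OF pW(2)] by blast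
      show ?thesis
        unfolding x u w using lin by (simp add: linear_add linear_scale algebra_simps)
    qed
    then show ?thesis
      using lin by (simp add: T2 case_prod_unfold sum_distrib_right flip: sum.distrib)
  qed
qed

text \<open>
  An antisymmetric form k on covectors is recovered from its values on the coordinates; the factor 1/2
  compensates for summing over ordered pairs.
\<close>

lemma bivector_expansion:
  fixes k :: "('v \<Rightarrow> real) \<Rightarrow> ('v \<Rightarrow> real) \<Rightarrow> real"
  assumes k: "\<And>\<beta>. linear \<beta> \<Longrightarrow> covector_linear (\<lambda>\<alpha>. k \<alpha> \<beta>)"
    and antisym: "\<And>\<alpha> \<beta>. linear \<alpha> \<Longrightarrow> linear \<beta> \<Longrightarrow> k \<beta> \<alpha> = - k \<alpha> \<beta>"
    and P: "linear P"
  shows "(\<Sum>i<n. \<Sum>j<n. k (coord i) (coord j) / 2 * wedge [P (b i), P (b j)] \<alpha>s) =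
    (if length \<alpha>s = 2 \<and> (\<forall>\<alpha>\<in>set \<alpha>s. linear \<alpha>) then k (\<alpha>s ! 0 \<circ> P) (\<alpha>s ! 1 \<circ> P) else 0)"
proof (cases "length \<alpha>s = 2 \<and> (\<forall>\<alpha>\<in>set \<alpha>s. linear \<alpha>)")
  case True
  define \<alpha> \<beta> where "\<alpha> = \<alpha>s ! 0" and "\<beta> = \<alpha>s ! 1"
  have lin: "linear \<alpha>" "linear \<beta>" using True by (auto simp: \<alpha>_def \<beta>_def)
  have linP: "linear (\<alpha> \<circ> P)" "linear (\<beta> \<circ> P)" using lin P linear_compose by blast+
  let ?k = "\<lambda>i j. k (coord i) (coord j)" and ?a = "\<lambda>i. \<alpha> (P (b i))" and ?b = "\<lambda>i. \<beta> (P (b i))"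
  have inner: "k (coord i) (\<beta> \<circ> P) = (\<Sum>j<n. ?k i j * ?b j)" for i
  proof -
    have "k (coord i) (\<beta> \<circ> P) = - k (\<beta> \<circ> P) (coord i)"
      by (rule antisym[OF linP(2) linear_coord])
    also have "k (\<beta> \<circ> P) (coord i) = (\<Sum>j<n. ?b j * ?k j i)"
      using covector_expansion[OF k[OF linear_coord[of i]] linP(2)] by (simp add: lin_def)
    also have "- (\<Sum>j<n. ?b j * ?k j i) = (\<Sum>j<n. ?k i j * ?b j)"
      unfolding sum_negf[symmetric] using antisym[OF linear_coord linear_coord]
      by (intro sum.cong) (metis mult.commute mult_minus_left)+
    finally show ?thesis .
  qed
  have exp: "k (\<alpha> \<circ> P) (\<beta> \<circ> P) = (\<Sum>i<n. \<Sum>j<n. ?k i j * ?a i * ?b j)"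
    using covector_expansion[OF k[OF linP(2)] linP(1)]
    by (simp add: lin_def inner sum_distrib_left algebra_simps)
  have "(\<Sum>i<n. \<Sum>j<n. ?k i j * ?a j * ?b i) = (\<Sum>j<n. \<Sum>i<n. ?k i j * ?a j * ?b i)"
    by (rule sum.swap)
  also have "\<dots> = (\<Sum>i<n. \<Sum>j<n. - (?k i j * ?a i * ?b j))"
    using antisym[OF linear_coord linear_coord] by (intro sum.cong refl) (metis mult_minus_left)
  also have "\<dots> = - (\<Sum>i<n. \<Sum>j<n. ?k i j * ?a i * ?b j)" by (simp add: sum_negf)
  finally have swap: "(\<Sum>i<n. \<Sum>j<n. ?k i j * ?a j * ?b i) = - (\<Sum>i<n. \<Sum>j<n. ?k i j * ?a i * ?b j)" .
  have "(\<Sum>i<n. \<Sum>j<n. ?k i j / 2 * wedge [P (b i), P (b j)] \<alpha>s) =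
      (\<Sum>i<n. \<Sum>j<n. ?k i j * ?a i * ?b j / 2 - ?k i j * ?a j * ?b i / 2)"
    using True by (intro sum.cong refl) (simp add: wedge_pair \<alpha>_def \<beta>_def field_simps)
  also have "\<dots> = (\<Sum>i<n. \<Sum>j<n. ?k i j * ?a i * ?b j) / 2 - (\<Sum>i<n. \<Sum>j<n. ?k i j * ?a j * ?b i) / 2"
    by (simp add: sum_subtractf sum_divide_distrib)
  also have "\<dots> = k (\<alpha> \<circ> P) (\<beta> \<circ> P)" unfolding swap exp by simp
  finally show ?thesis using True by (simp add: \<alpha>_def \<beta>_def)
qed (auto simp: wedge_pair intro!: sum.neutral)

end

section \<open>The symplectic form\<close>

locale symplectic_group_action = linear_group_action b n G \<phi>
  for b :: "nat \<Rightarrow> 'v::real_normed_vector" and n :: nat and G :: "('g, 'm) monoid_scheme" (structure)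
    and \<phi> :: "'g \<Rightarrow> 'v \<Rightarrow> 'v" +
  fixes \<omega> :: "'v \<Rightarrow> 'v \<Rightarrow> real" and \<Lambda> :: "'g \<Rightarrow> 'v \<Rightarrow> 'v multivector"
  assumes symplectic: "symplectic_form \<omega>"
    and symplectic_action: "g \<in> carrier G \<Longrightarrow> \<omega> (\<phi> g v) (\<phi> g w) = \<omega> v w"
    and \<Lambda>_bivector: "g \<in> symplectic_reflections G \<phi> \<Longrightarrow> p \<in> fixed_space \<phi> g \<Longrightarrow>
      \<Lambda> g p \<in> exterior_power 2 (moving_space G \<phi> g)"
    and \<Lambda>_invariant: "g \<in> symplectic_reflections G \<phi> \<Longrightarrow> h \<in> carrier G \<Longrightarrow> p \<in> fixed_space \<phi> g \<Longrightarrow>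
      \<Lambda> (h \<otimes> g \<otimes> inv h) (\<phi> h p) = pushforward (\<phi> h) (\<Lambda> g p)"
    and \<Lambda>_constant: "g \<in> symplectic_reflections G \<phi> \<Longrightarrow> p \<in> fixed_space \<phi> g \<Longrightarrow> p' \<in> fixed_space \<phi> g \<Longrightarrow>
      \<Lambda> g p = \<Lambda> g p'"
begin

lemma \<omega>_simps:
  "linear (\<omega> v)" "\<omega> (v + w) u = \<omega> v u + \<omega> w u" "\<omega> (c *\<^sub>R v) u = c * \<omega> v u" "\<omega> w v = - \<omega> v w"
proof -
  have lin: "\<And>v. linear (\<omega> v)" "\<And>u. linear (\<lambda>v. \<omega> v u)" and alt: "\<And>v. \<omega> v v = 0"
    using symplectic unfolding symplectic_form_def by blast+
  show "linear (\<omega> v)" by (rule lin)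
  show add: "\<omega> (v + w) u = \<omega> v u + \<omega> w u" for v w u using linear_add[OF lin(2)] .
  show "\<omega> (c *\<^sub>R v) u = c * \<omega> v u" using linear_scale[OF lin(2)[of u], of c v] by simp
  have "\<omega> (v + w) (v + w) = (\<omega> v v + \<omega> v w) + (\<omega> w v + \<omega> w w)"
    by (simp only: add linear_add[OF lin(1)])
  then show "\<omega> w v = - \<omega> v w" using alt[of v] alt[of w] alt[of "v + w"] by linarith
qed

lemma \<omega>_inj: "(\<And>u. \<omega> v u = \<omega> w u) \<Longrightarrow> v = w"
proof -
  assume "\<And>u. \<omega> v u = \<omega> w u"
  then have "\<omega> (v + (-1) *\<^sub>R w) u = 0" for u unfolding \<omega>_simps(2,3) by simp
  then have "v + (-1) *\<^sub>R w = 0" using symplectic unfolding symplectic_form_def by blast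
  then show ?thesis by simp
qed

abbreviation hv :: "('v \<Rightarrow> real) \<Rightarrow> 'v" where "hv \<equiv> hamiltonian_vector \<omega>"

lemma hamiltonian_vector_eqI: "(\<And>w. \<omega> v w = \<alpha> w) \<Longrightarrow> hv \<alpha> = v"
  unfolding hamiltonian_vector_def by (rule the_equality) (auto intro: \<omega>_inj)

text \<open>
  A nondegenerate form identifies the space with its dual by dimension; the dual is replaced by the
  space itself, using the values on a basis as coordinates.
\<close>

lemma hamiltonian_vector:
  assumes \<alpha>: "linear \<alpha>" shows "\<omega> (hv \<alpha>) w = \<alpha> w"
proof -
  define T where "T v = (\<Sum>i<n. \<omega> v (b i) *\<^sub>R b i)" for v
  have "linear T"
    by (rule linearI) (simp_all add: T_def \<omega>_simps(2,3) scaleR_add_left sum.distrib scaleR_sum_right)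
  have coord_T: "coord i (\<Sum>i<n. f i *\<^sub>R b i) = f i" if "i < n" for i f
    using that by (simp add: linear_sum[OF linear_coord] linear_scale[OF linear_coord] coord_basis if_distrib cong: if_cong)
  have ext: "\<alpha> w = \<beta> w" if "linear \<alpha>" "linear \<beta>" "\<And>i. i < n \<Longrightarrow> \<alpha> (b i) = \<beta> (b i)" for \<alpha> \<beta> :: "'v \<Rightarrow> real" and w
    using linear_eq_on[OF that(1,2), of w "b ` {..<n}"] that(3) b_span by auto
  have "inj T"
  proof (rule injI)
    fix v w assume "T v = T w"
    then have "\<omega> v (b i) = \<omega> w (b i)" if "i < n" for i
      using coord_T[OF that, of "\<lambda>i. \<omega> v (b i)"] coord_T[OF that, of "\<lambda>i. \<omega> w (b i)"] by (simp add: T_def)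
    then show "v = w" by (rule \<omega>_inj[OF ext[OF \<omega>_simps(1) \<omega>_simps(1)]])
  qed
  then have "surj T" by (rule linear_injective_surjective[OF \<open>linear T\<close>])
  then obtain v where v: "T v = (\<Sum>i<n. \<alpha> (b i) *\<^sub>R b i)" by (metis surjD)
  have "\<omega> v (b i) = \<alpha> (b i)" if "i < n" for i
    using coord_T[OF that, of "\<lambda>i. \<omega> v (b i)"] coord_T[OF that, of "\<lambda>i. \<alpha> (b i)"] v by (simp add: T_def)
  then have "\<omega> v w = \<alpha> w" for w by (rule ext[OF \<omega>_simps(1) \<alpha>])
  then show ?thesis using hamiltonian_vector_eqI[of v \<alpha>] by simp
qed

definition \<pi> :: "('v \<Rightarrow> real) \<Rightarrow> ('v \<Rightarrow> real) \<Rightarrow> real" where "\<pi> \<alpha> \<beta> = poisson_bivector \<omega> [\<alpha>, \<beta>]"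

lemma \<pi>: "linear \<alpha> \<Longrightarrow> linear \<beta> \<Longrightarrow> \<pi> \<alpha> \<beta> = \<alpha> (hv \<beta>)"
  by (simp add: \<pi>_def poisson_bivector_def hamiltonian_vector)

lemma \<pi>_linear: "linear \<beta> \<Longrightarrow> covector_linear (\<lambda>\<alpha>. \<pi> \<alpha> \<beta>)"
  by (auto simp: covector_linear_def \<pi> linear_covector_combination)

lemma \<pi>_antisym: "linear \<alpha> \<Longrightarrow> linear \<beta> \<Longrightarrow> \<pi> \<beta> \<alpha> = - \<pi> \<alpha> \<beta>"
  using \<omega>_simps(4)[of "hv \<alpha>" "hv \<beta>"] by (simp add: \<pi>_def poisson_bivector_def)

lemma \<pi>_invariant:
  assumes h: "h \<in> carrier G" and lin: "linear \<alpha>" "linear \<beta>"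
  shows "\<pi> (\<alpha> \<circ> \<phi> h) (\<beta> \<circ> \<phi> h) = \<pi> \<alpha> \<beta>"
proof -
  have comp: "linear (\<gamma> \<circ> \<phi> h)" if "linear \<gamma>" for \<gamma> :: "'v \<Rightarrow> real"
    using that \<phi>_linear[OF h] linear_compose by blast
  have "\<omega> (\<phi> (inv h) (hv \<beta>)) w = (\<beta> \<circ> \<phi> h) w" for w
    using symplectic_action[OF h, of "\<phi> (inv h) (hv \<beta>)" w] hamiltonian_vector[OF lin(2)] h
    by (simp add: \<phi>_inv)
  then have "hv (\<beta> \<circ> \<phi> h) = \<phi> (inv h) (hv \<beta>)" by (rule hamiltonian_vector_eqI)
  then show ?thesis using h lin comp by (simp add: \<pi> \<phi>_inv)
qed

abbreviation S :: "'g set" where "S \<equiv> symplectic_reflections G \<phi>"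

lemma S: "g \<in> S \<Longrightarrow> g \<in> carrier G" "g \<in> S \<Longrightarrow> dim (moving_space G \<phi> g) = 2" "\<one> \<notin> S"
  using moving_space_one(2) by (auto simp: symplectic_reflections_def codim_fixed_def)

lemma S_conj: "g \<in> carrier G \<Longrightarrow> h \<in> carrier G \<Longrightarrow> h \<otimes> g \<otimes> inv h \<in> S \<longleftrightarrow> g \<in> S"
  by (simp add: symplectic_reflections_def codim_fixed_conj)

lemma zero_fixed: "g \<in> carrier G \<Longrightarrow> 0 \<in> fixed_space \<phi> g"
  using linear_0[OF \<phi>_linear] by (simp add: invariants_def)

lemma \<Lambda>_0: "g \<in> S \<Longrightarrow> \<Lambda> g 0 \<in> exterior_power 2 (moving_space G \<phi> g)"
  using \<Lambda>_bivector zero_fixed S(1) by blast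

definition \<kappa> :: "'g \<Rightarrow> ('v \<Rightarrow> real) \<Rightarrow> ('v \<Rightarrow> real) \<Rightarrow> real" where
  "\<kappa> g \<alpha> \<beta> = (if g = \<one> then \<pi> \<alpha> \<beta> else if g \<in> S then \<Lambda> g 0 [\<alpha>, \<beta>] else 0)"

lemma conj_one: "g \<in> carrier G \<Longrightarrow> h \<in> carrier G \<Longrightarrow> h \<otimes> g \<otimes> inv h = \<one> \<longleftrightarrow> g = \<one>"
  using inv_solve_right'[of "\<one>" "h \<otimes> g" h] by (auto simp: r_cancel_one)

text \<open>
  The Jacobi identity is trivial for the unit, which moves nothing. For g in S the differences
  \<alpha> v - \<alpha> (\<phi> (inv g) v) evaluate \<alpha> on the two-dimensional moving space, which also carries the bivector.
\<close>

sublocale symplectic_reflection_data b n G \<phi> \<kappa>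
proof unfold_locales
  fix g h v and \<alpha> \<beta> \<gamma> :: "'v \<Rightarrow> real"
  assume g: "g \<in> carrier G"
  show "covector_linear (\<lambda>\<alpha>. \<kappa> g \<alpha> \<beta>)" if \<beta>: "linear \<beta>"
  proof -
    have "covector_linear (\<lambda>\<alpha>. 0::real)" by (simp add: covector_linear_def)
    then show ?thesis
      using \<pi>_linear[OF \<beta>] exterior_2_properties(1)[OF \<Lambda>_0 \<beta>]
      by (cases "g = \<one>"; cases "g \<in> S") (simp_all add: \<kappa>_def)
  qed
  assume \<alpha>: "linear \<alpha>" and \<beta>: "linear \<beta>"
  show "\<kappa> g \<beta> \<alpha> = - \<kappa> g \<alpha> \<beta>"
    using \<pi>_antisym[OF \<alpha> \<beta>] exterior_2_properties(2)[OF \<Lambda>_0 \<alpha> \<beta>] by (simp add: \<kappa>_def)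
  show "\<kappa> (h \<otimes> g \<otimes> inv h) \<alpha> \<beta> = \<kappa> g (\<alpha> \<circ> \<phi> h) (\<beta> \<circ> \<phi> h)" if h: "h \<in> carrier G"
  proof -
    have "\<Lambda> (h \<otimes> g \<otimes> inv h) 0 [\<alpha>, \<beta>] = \<Lambda> g 0 [\<alpha> \<circ> \<phi> h, \<beta> \<circ> \<phi> h]" if "g \<in> S"
      using \<Lambda>_invariant[OF that h zero_fixed[OF g]] linear_0[OF \<phi>_linear[OF h]] by (simp add: pushforward_def)
    then show ?thesis
      using \<pi>_invariant[OF h \<alpha> \<beta>] by (simp add: \<kappa>_def conj_one[OF g h] S_conj[OF g h])
  qed
  assume \<gamma>: "linear \<gamma>"
  show "\<kappa> g \<beta> \<gamma> * (\<alpha> v - \<alpha> (\<phi> (inv g) v)) + \<kappa> g \<gamma> \<alpha> * (\<beta> v - \<beta> (\<phi> (inv g) v))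
      + \<kappa> g \<alpha> \<beta> * (\<gamma> v - \<gamma> (\<phi> (inv g) v)) = 0"
  proof (cases "g \<in> S")
    case True
    have "v - \<phi> (inv g) v \<in> moving_space G \<phi> g"
      by (rule cyclic_action.inv_moving[OF cyclic_actionI[OF g]])
    from exterior_2_properties(5)[OF \<Lambda>_0[OF True] \<alpha> \<beta> \<gamma> S(2)[OF True] this]
    show ?thesis using True S(3) by (auto simp: \<kappa>_def linear_diff[OF \<alpha>] linear_diff[OF \<beta>] linear_diff[OF \<gamma>])
  qed (simp add: \<kappa>_def \<phi>_one)
qed

lemma wedge_component_one: "wedge_component G \<phi> \<one> [u, w] \<alpha>s = wedge [u, w] \<alpha>s"
proof -
  have "moving_part G \<phi> \<one> v \<in> moving_space G \<phi> \<one>" for v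
    using cyclic_action.moving_part_eq[OF cyclic_actionI[OF one_closed], of v]
      cyclic_action.moving_space_kernel[OF cyclic_actionI[OF one_closed]]
      cyclic_action.linear_e[OF cyclic_actionI[OF one_closed]] cyclic_action.e_e[OF cyclic_actionI[OF one_closed]]
    by (simp add: linear_diff)
  then have "fixed_part G \<phi> \<one> v = v" for v
    by (simp add: fixed_part_def moving_space_one)
  moreover have "{A. A \<subseteq> {..<length [u, w]} \<and> card A = codim_fixed G \<phi> \<one>} = {{}}"
    by (auto simp: moving_space_one dest: finite_subset)
  ultimately show ?thesis by (simp add: wedge_component_def upt_rec numeral_2_eq_2)
qed

lemma wedge_component_S:
  assumes "g \<in> S"
  shows "wedge_component G \<phi> g [u, w] \<alpha>s = wedge [moving_part G \<phi> g u, moving_part G \<phi> g w] \<alpha>s"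
proof -
  have codim: "codim_fixed G \<phi> g = 2" using assms by (simp add: symplectic_reflections_def)
  have "{A. A \<subseteq> {..<length [u, w]} \<and> card A = codim_fixed G \<phi> g} = {{..<2}}"
  proof -
    have "A = {..<2}" if "A \<subseteq> {..<2::nat}" "card A = 2" for A
      using card_subset_eq[of "{..<2}" A] that by simp
    then show ?thesis by (auto simp: codim numeral_2_eq_2)
  qed
  then show ?thesis by (simp add: wedge_component_def upt_rec numeral_2_eq_2)
qed

lemma multivector_eq:
  assumes g: "g \<in> carrier G" and p: "p \<in> fixed_space \<phi> g"
  shows "(\<Sum>i<n. \<Sum>j<n. \<kappa> g (coord i) (coord j) / 2 * wedge_component G \<phi> g [b i, b j] \<alpha>s)
    = poisson_plus_reflections G \<phi> \<omega> \<Lambda> g p \<alpha>s"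
proof -
  let ?lin = "length \<alpha>s = 2 \<and> (\<forall>\<alpha>\<in>set \<alpha>s. linear \<alpha>)"
  have pair: "\<alpha>s = [\<alpha>s ! 0, \<alpha>s ! 1]" "linear (\<alpha>s ! 0)" "linear (\<alpha>s ! 1)" if ?lin
    using that by (auto simp: numeral_2_eq_2 length_Suc_conv)
  consider "g = \<one>" | "g \<in> S" "g \<noteq> \<one>" | "g \<notin> S" "g \<noteq> \<one>" by blast
  then show ?thesis
  proof cases
    case 1
    have "(\<Sum>i<n. \<Sum>j<n. \<kappa> g (coord i) (coord j) / 2 * wedge_component G \<phi> g [b i, b j] \<alpha>s)
      = (\<Sum>i<n. \<Sum>j<n. \<kappa> g (coord i) (coord j) / 2 * wedge [id (b i), id (b j)] \<alpha>s)"
      by (simp add: 1 wedge_component_one)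
    also have "\<dots> = (if ?lin then \<kappa> g (\<alpha>s ! 0 \<circ> id) (\<alpha>s ! 1 \<circ> id) else 0)"
      using g by (intro bivector_expansion \<kappa>_linear \<kappa>_antisym linear_id)
    also have "\<dots> = poisson_bivector \<omega> \<alpha>s"
      using pair(1) by (auto simp: 1 \<kappa>_def \<pi>_def poisson_bivector_def)
    finally show ?thesis using S(3) by (simp add: 1 poisson_plus_reflections_def)
  next
    case 2
    interpret cyclic_action b n G \<phi> g by (rule cyclic_actionI[OF g])
    let ?P = "moving_part G \<phi> g"
    have P: "linear ?P"
      using linear_compose_sub[OF linear_ident linear_e] by (simp add: moving_part_eq[abs_def])
    have P_id: "?P w = w" if "w \<in> moving_space G \<phi> g" for w
      using that by (simp add: moving_part_eq moving_space_kernel)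
    have "(\<Sum>i<n. \<Sum>j<n. \<kappa> g (coord i) (coord j) / 2 * wedge_component G \<phi> g [b i, b j] \<alpha>s)
      = (\<Sum>i<n. \<Sum>j<n. \<kappa> g (coord i) (coord j) / 2 * wedge [?P (b i), ?P (b j)] \<alpha>s)"
      by (simp add: 2 wedge_component_S)
    also have "\<dots> = (if ?lin then \<kappa> g (\<alpha>s ! 0 \<circ> ?P) (\<alpha>s ! 1 \<circ> ?P) else 0)"
      using g by (intro bivector_expansion \<kappa>_linear \<kappa>_antisym P)
    also have "\<dots> = \<Lambda> g 0 \<alpha>s"
    proof (cases ?lin)
      case True
      then have "\<Lambda> g 0 [\<alpha>s ! 0 \<circ> ?P, \<alpha>s ! 1 \<circ> ?P] = \<Lambda> g 0 [\<alpha>s ! 0, \<alpha>s ! 1]"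
        using pair by (intro exterior_2_properties(3)[OF \<Lambda>_0[OF 2(1)]] P P_id)
      then show ?thesis using True 2 pair(1) by (simp add: \<kappa>_def)
    next
      case False
      then show ?thesis using exterior_2_properties(4)[OF \<Lambda>_0[OF 2(1)]] by auto
    qed
    also have "\<dots> = \<Lambda> g p \<alpha>s" using \<Lambda>_constant[OF 2(1) zero_fixed[OF g] p] by simp
    finally show ?thesis using 2 by (simp add: poisson_plus_reflections_def)
  next
    case 3
    then show ?thesis by (simp add: \<kappa>_def poisson_plus_reflections_def)
  qed
qed

end

section \<open>Existence of the deformation quantization\<close>

theorem proposition5p4:
  fixes G :: "('g, 'm) monoid_scheme"
    and \<phi> :: "'g \<Rightarrow> 'v::real_normed_vector \<Rightarrow> 'v"
    and E :: "'v set"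
    and \<omega> :: "'v \<Rightarrow> 'v \<Rightarrow> real"
    and \<Lambda> :: "'g \<Rightarrow> 'v \<Rightarrow> 'v multivector"
  assumes basis: "finite E" "independent E" "span E = UNIV"
    and symplectic: "symplectic_form \<omega>"
    and finite_group: "group G" "finite (carrier G)"
    and action: "group_action G UNIV \<phi>"
    and linear_action: "\<And>g. g \<in> carrier G \<Longrightarrow> linear (\<phi> g)"
    and symplectic_action: "\<And>g v w. g \<in> carrier G \<Longrightarrow> \<omega> (\<phi> g v) (\<phi> g w) = \<omega> v w"
    and effective: "\<And>g U. g \<in> carrier G \<Longrightarrow> g \<noteq> \<one>\<^bsub>G\<^esub> \<Longrightarrow> open U \<Longrightarrow> U \<noteq> {} \<Longrightarrow>
                      \<not> (\<forall>x \<in> U. \<phi> g x = x)"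
    and \<Lambda>_bivector: "\<And>g p. g \<in> symplectic_reflections G \<phi> \<Longrightarrow> p \<in> fixed_space \<phi> g \<Longrightarrow>
                      \<Lambda> g p \<in> exterior_power 2 (moving_space G \<phi> g)"
    and \<Lambda>_invariant: "\<And>g h p. g \<in> symplectic_reflections G \<phi> \<Longrightarrow> h \<in> carrier G \<Longrightarrow> p \<in> fixed_space \<phi> g \<Longrightarrow>
                      \<Lambda> (h \<otimes>\<^bsub>G\<^esub> g \<otimes>\<^bsub>G\<^esub> inv\<^bsub>G\<^esub> h) (\<phi> h p) = pushforward (\<phi> h) (\<Lambda> g p)"
    and \<Lambda>_constant: "\<And>g p q. g \<in> symplectic_reflections G \<phi> \<Longrightarrow> p \<in> fixed_space \<phi> g \<Longrightarrow> q \<in> fixed_space \<phi> g \<Longrightarrow>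
                      \<Lambda> g p = \<Lambda> g q"
  shows "\<exists>\<P>. class_of_multivector G \<phi> E 2 \<P> (poisson_plus_reflections G \<phi> \<omega> \<Lambda>) \<and>
             noncommutative_poisson (crossed_product G \<phi>) \<P> \<and>
             (\<exists>star. deformation_quantization (crossed_product G \<phi>) \<P> star)"
proof -
  interpret group_action G UNIV \<phi> by (rule action)
  obtain b where b: "bij_betw b {..<card E} E"
    using ex_bij_betw_nat_finite[OF basis(1)] by (auto simp: atLeast0LessThan)
  define n where "n = card E"
  have E: "b ` {..<n} = E" and b_inj: "inj_on b {..<n}"
    using b by (auto simp: bij_betw_def n_def)
  have \<phi>_one: "\<phi> \<one>\<^bsub>G\<^esub> v = v" for v
    using id_eq_one by (metis UNIV_I restrict_apply')
  have \<phi>_mult: "\<phi> (g \<otimes>\<^bsub>G\<^esub> h) v = \<phi> g (\<phi> h v)" if "g \<in> carrier G" "h \<in> carrier G" for g h v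
    using composition_rule[of v g h] that by simp
  have "linear_group_action b n G \<phi>"
    by (intro linear_group_action.intro coordinate_space.intro linear_group_action_axioms.intro
        finite_group linear_action)
      (simp_all add: E b_inj basis \<phi>_one \<phi>_mult)
  then interpret symplectic_group_action b n G \<phi> \<omega> \<Lambda>
    by (intro symplectic_group_action.intro symplectic_group_action_axioms.intro
        symplectic symplectic_action \<Lambda>_bivector \<Lambda>_invariant \<Lambda>_constant)
  obtain Y where Y: "\<forall>i<n. fps_nth (Y i) 0 = mulop (X i)" "equivariant Y"
    "\<forall>\<alpha> \<beta>. linear \<alpha> \<longrightarrow> linear \<beta> \<longrightarrow> comm (lin Y \<alpha>) (lin Y \<beta>) = fps_X * fps_const (K \<alpha> \<beta>)"
    using deformed_coordinates_exist by blast
  interpret deformed_coordinates b n G \<phi> \<kappa> Y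
  proof
    fix g assume "g \<in> carrier G" "\<And>v. \<phi> g v = v"
    then show "g = \<one>\<^bsub>G\<^esub>" using effective[of g UNIV] by auto
  qed (use Y in auto)
  have "class_of_multivector G \<phi> E 2 \<P> (poisson_plus_reflections G \<phi> \<omega> \<Lambda>)"
    unfolding class_of_multivector_def
  proof (intro conjI ballI ext)
    show "\<P> \<in> HH (crossed_product G \<phi>) 2"
      using noncommutative_poisson_\<P> by (simp add: noncommutative_poisson_def)
    fix \<Psi> g p \<alpha>s assume "\<Psi> \<in> \<P>" and g: "g \<in> carrier G" and p: "p \<in> fixed_space \<phi> g"
    moreover have "\<phi> g p = p" using p by (simp add: invariants_def)
    ultimately show "cocycle_to_multivector G \<phi> E 2 \<Psi> g p \<alpha>s = poisson_plus_reflections G \<phi> \<omega> \<Lambda> g p \<alpha>s"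
      using cocycle_to_multivector_value[of \<Psi> g p \<alpha>s] multivector_eq[OF g p, of \<alpha>s] by (simp add: E)
  qed
  then show ?thesis
    using noncommutative_poisson_\<P> deformation_quantization_star by blast
qed

end
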